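(* Let $0<\lambda\le\Lambda$ and define $$\bar\alpha=\frac{2}{\pi}\,\frac{\frac{\lambda^3}{\Lambda^3}}{1+\frac{\lambda}{\Lambda}}\,\arctan\left(\frac{2\frac{\lambda}{\Lambda}}{1-\frac{\lambda}{\Lambda}}\right),$$ where the arctangent is understood as $\pi/2$ when $\lambda=\Lambda$. Then there exists a constant $C=C(\lambda,\Lambda)$, depending only on $\lambda$ and $\Lambda$, such that the following holds. For every continuous function $F:\mathrm{Sym}_2\to\mathbb{R}$ that is uniformly elliptic with ellipticity constants $\lambda,\Lambda$, and every $u\in C^2(B_1)$, $B_1\subset\mathbb{R}^2$, satisfying $F(D^2u)=0$ in $B_1$, one has $$\|u\|_{C^{2,\bar\alpha}(B_{1/2})}\le C(\lambda,\Lambda)\,\|u\|_{L^\infty(B_1)}.$$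
   Context: $\mathrm{Sym}_2$ denotes the space of real symmetric $2\times 2$ matrices, and $B_r\subset\mathbb{R}^2$ is the open ball of radius $r$ centered at the origin. $D^2u$ is the Hessian of $u$. A function $F:\mathrm{Sym}_2\to\mathbb{R}$ is uniformly elliptic with ellipticity constants $0<\lambda\le\Lambda$ if for all $M,N\in\mathrm{Sym}_2$ with $N\ge 0$ (positive semidefinite), $$\lambda\,\mathrm{Tr}(N)\le F(M+N)-F(M)\le\Lambda\,\mathrm{Tr}(N).$$ No convexity, concavity or differentiability of $F$ is assumed. $\|\cdot\|_{C^{2,\alpha}(B_{1/2})}$ is the usual full Hölder norm (sup norms of $u$, $Du$, $D^2u$ plus the $\alpha$-Hölder seminorm of $D^2u$ on $B_{1/2}$). *)

theory Defs
  imports "HOL-Analysis.Analysis" "HOL-Probability.Essential_Supremum"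
begin

definition Sym2 :: "(real ^ 2 ^ 2) set"
  where "Sym2 = {M. transpose M = M}"

definition psd :: "real ^ 2 ^ 2 \<Rightarrow> bool"
  where "psd N \<longleftrightarrow> N \<in> Sym2 \<and> (\<forall>x. 0 \<le> x \<bullet> (N *v x))"

text \<open>Functions on \<open>Sym2\<close> are total functions on all matrices of which only the values
  on \<open>Sym2\<close> are ever used.\<close>

definition uniformly_elliptic :: "real \<Rightarrow> real \<Rightarrow> (real ^ 2 ^ 2 \<Rightarrow> real) \<Rightarrow> bool"
  where "uniformly_elliptic lam Lam F \<longleftrightarrow> 0 < lam \<and> lam \<le> Lam \<and>
    (\<forall>M\<in>Sym2. \<forall>N\<in>Sym2. psd N \<longrightarrow>
       lam * trace N \<le> F (M + N) - F M \<and> F (M + N) - F M \<le> Lam * trace N)"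

definition gradient :: "(real ^ 2 \<Rightarrow> real) \<Rightarrow> real ^ 2 \<Rightarrow> real ^ 2"
  where "gradient u x = (\<chi> i. frechet_derivative u (at x) (axis i 1))"

definition hessian :: "(real ^ 2 \<Rightarrow> real) \<Rightarrow> real ^ 2 \<Rightarrow> real ^ 2 ^ 2"
  where "hessian u x = jacobian (gradient u) (at x)"

text \<open>For open \<open>S\<close> this is \<open>C\<^sup>2(S)\<close>, with no boundedness required and no
  condition on the values of \<open>u\<close> outside \<open>S\<close>.\<close>

definition C2_on :: "(real ^ 2) set \<Rightarrow> (real ^ 2 \<Rightarrow> real) \<Rightarrow> bool"
  where "C2_on S u \<longleftrightarrow>
    (\<forall>x\<in>S. u differentiable (at x)) \<and>
    (\<forall>x\<in>S. gradient u differentiable (at x)) \<and>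
    continuous_on S (hessian u)"

text \<open>All norms below take values in \<open>ennreal\<close>, so they may be infinite.
  The norm of a matrix is the Euclidean (Frobenius) norm of \<open>real ^ 2 ^ 2\<close>.\<close>

definition sup_norm :: "'a set \<Rightarrow> ('a \<Rightarrow> 'b::real_normed_vector) \<Rightarrow> ennreal"
  where "sup_norm S f = (SUP x\<in>S. ennreal (norm (f x)))"

definition hoelder_seminorm ::
    "real \<Rightarrow> 'a::metric_space set \<Rightarrow> ('a \<Rightarrow> 'b::real_normed_vector) \<Rightarrow> ennreal"
  where "hoelder_seminorm a S f =
    (SUP (x, y)\<in>{(x, y). x \<in> S \<and> y \<in> S \<and> x \<noteq> y}.
       ennreal (norm (f x - f y) / dist x y powr a))"

definition C2_hoelder_norm :: "real \<Rightarrow> (real ^ 2) set \<Rightarrow> (real ^ 2 \<Rightarrow> real) \<Rightarrow> ennreal"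
  where "C2_hoelder_norm a S u =
    sup_norm S u + sup_norm S (gradient u) + sup_norm S (hessian u)
      + hoelder_seminorm a S (hessian u)"

definition Linf_norm :: "(real ^ 2) set \<Rightarrow> (real ^ 2 \<Rightarrow> real) \<Rightarrow> ennreal"
  where "Linf_norm S u = esssup (lebesgue_on S) (\<lambda>x. ennreal \<bar>u x\<bar>)"

definition alpha_bar :: "real \<Rightarrow> real \<Rightarrow> real"
  where "alpha_bar lam Lam =
    2 / pi * ((lam ^ 3 / Lam ^ 3) / (1 + lam / Lam)) *
    (if lam = Lam then pi / 2 else arctan (2 * (lam / Lam) / (1 - lam / Lam)))"

end

theory Submission
  imports Defs
begin

text \<open>
  The estimate rests on the fact that in two dimensions the difference of two symmetric matrices
  on the same level set of \<open>F\<close> is a saddle: if \<open>F M = F N\<close> and \<open>M - N\<close> has entries \<open>a, b, b, d\<close>, then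
  \<open>a\<^sup>2 + b\<^sup>2 \<le> K J\<close> and \<open>b\<^sup>2 + d\<^sup>2 \<le> K J\<close> with \<open>J = b\<^sup>2 - a d\<close> and \<open>K = Lam / lam\<close>
  (\<open>cone_of_elliptic\<close>). Completing the square, \<open>M - N = v v\<^sup>T / a - (J / a) e e\<^sup>T\<close> with \<open>v = (a, b)\<close> and
  \<open>e\<close> the second unit vector, is a difference of two positive semidefinite matrices, and ellipticity
  compares their traces.

  A \<open>C\<^sup>2\<close> function \<open>w\<close> whose Hessian satisfies these inequalities everywhere has a quasiregular
  gradient, and this gives a Hoelder estimate with an explicit exponent, by Morrey's argument on
  squares. Green's formula writes the integral of \<open>J\<close> over a square of half side \<open>r\<close> as a line integral
  over its boundary. Cutting the boundary at two opposite corners and subtracting from \<open>w\<^sub>x\<close> the mean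
  of its two corner values bounds the line integral by \<open>r\<close> times the boundary integral of the squared
  tangential derivative of the gradient, hence by \<open>r K\<close> times the boundary integral of \<open>J\<close>. So the
  integral \<open>D(r)\<close> of \<open>J\<close> satisfies \<open>D \<le> r K D'\<close> and decays like \<open>r\<close> to the power \<open>1 / K\<close>
  (\<open>J_integral_decay\<close>). A cutoff argument bounds \<open>D\<close> by the square of the supremum of \<open>w\<close>
  (\<open>energy_bound\<close>), and the decay implies that the gradient of \<open>w\<close> is Hoelder continuous with
  exponent \<open>1 / (2 K)\<close> (\<open>morrey_ray\<close>, \<open>gradient_hoelder\<close>).

  Ellipticity yields a unique \<open>t\<close> with \<open>F (t I) = 0\<close>, and comparison with a paraboloid bounds \<open>\<bar>t\<bar>\<close> by
  eight times the supremum of \<open>u\<close> (\<open>root_bound\<close>). The function \<open>v = u - t \<bar>x\<bar>\<^sup>2 / 2\<close> and all its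
  difference quotients have saddle-shaped Hessians. The gradient estimate for \<open>v\<close> bounds the
  difference quotients, and the gradient estimate for the difference quotients passes to the limit
  and bounds the second derivatives of \<open>v\<close> and their Hoelder seminorm (\<open>hessian_estimates\<close>). Finally
  \<open>1 / (2 K)\<close> is at least the exponent \<open>alpha_bar\<close>, with equality only for \<open>lam = Lam\<close>
  (\<open>alpha_bar_le\<close>).
\<close>

section \<open>Continuously differentiable functions of two variables\<close>

text \<open>\<open>f\<close> is continuously differentiable on the open set \<open>S\<close> with partial derivatives \<open>fx\<close> and \<open>fy\<close>.
  The plane is \<open>real \<times> real\<close> here, so that integrals over rectangles are iterated integrals.\<close>

definition C1_fun :: "(real \<times> real) set \<Rightarrow> (real \<times> real \<Rightarrow> real) \<Rightarrow> (real \<times> real \<Rightarrow> real) \<Rightarrow>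
    (real \<times> real \<Rightarrow> real) \<Rightarrow> bool"
  where "C1_fun S f fx fy \<longleftrightarrow> open S \<and>
    (\<forall>p\<in>S. (f has_derivative (\<lambda>h. fx p * fst h + fy p * snd h)) (at p)) \<and>
    continuous_on S fx \<and> continuous_on S fy"

lemma C1_funD:
  assumes "C1_fun S f fx fy"
  shows "open S" "continuous_on S f" "continuous_on S fx" "continuous_on S fy"
    "\<And>p. p \<in> S \<Longrightarrow> (f has_derivative (\<lambda>h. fx p * fst h + fy p * snd h)) (at p)"
proof -
  show d: "\<And>p. p \<in> S \<Longrightarrow> (f has_derivative (\<lambda>h. fx p * fst h + fy p * snd h)) (at p)"
    using assms unfolding C1_fun_def by auto
  show "continuous_on S f"
    by (rule has_derivative_continuous_on[OF has_derivative_at_withinI[OF d]])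
  show "open S" "continuous_on S fx" "continuous_on S fy" using assms unfolding C1_fun_def by auto
qed

lemma C1_fun_subset:
  assumes "C1_fun S f fx fy" "T \<subseteq> S" "open T"
  shows "C1_fun T f fx fy"
  using assms unfolding C1_fun_def by (auto intro: continuous_on_subset)

lemma C1_fun_path:
  assumes "C1_fun S f fx fy" "(c t, d t) \<in> S"
    and "(c has_real_derivative c') (at t within T)" "(d has_real_derivative d') (at t within T)"
  shows "((\<lambda>t. f (c t, d t)) has_real_derivative (fx (c t, d t) * c' + fy (c t, d t) * d')) (at t within T)"
proof -
  have 1: "((\<lambda>t. (c t, d t)) has_derivative (\<lambda>h. (c' * h, d' * h))) (at t within T)"
    using assms(3,4) by (auto simp: has_field_derivative_def intro!: has_derivative_Pair)
  have 2: "(f has_derivative (\<lambda>h. fx (c t, d t) * fst h + fy (c t, d t) * snd h)) (at (c t, d t))"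
    using C1_funD(5)[OF assms(1,2)] .
  have "((\<lambda>t. f (c t, d t)) has_derivative (\<lambda>h. fx (c t, d t) * (c' * h) + fy (c t, d t) * (d' * h))) (at t within T)"
    using has_derivative_compose[OF 1 2] by simp
  moreover have "(\<lambda>h. fx (c t, d t) * (c' * h) + fy (c t, d t) * (d' * h)) =
     (*) (fx (c t, d t) * c' + fy (c t, d t) * d')" by (auto simp: algebra_simps)
  ultimately show ?thesis by (simp add: has_field_derivative_def)
qed

lemma C1_fun_partial_x:
  assumes "C1_fun S f fx fy" "(x, y) \<in> S"
  shows "((\<lambda>x. f (x, y)) has_real_derivative fx (x, y)) (at x within T)"
  using C1_fun_path[OF assms(1), of "\<lambda>t. t" x "\<lambda>_. y" 1 T 0] assms(2) by (auto intro!: derivative_eq_intros)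

lemma C1_fun_partial_y:
  assumes "C1_fun S f fx fy" "(x, y) \<in> S"
  shows "((\<lambda>y. f (x, y)) has_real_derivative fy (x, y)) (at y within T)"
  using C1_fun_path[OF assms(1), of "\<lambda>_. x" y "\<lambda>t. t" 0 T 1] assms(2) by (auto intro!: derivative_eq_intros)

lemma C1_fun_mult:
  assumes "C1_fun S f fx fy" "C1_fun S g gx gy"
  shows "C1_fun S (\<lambda>p. f p * g p) (\<lambda>p. fx p * g p + f p * gx p) (\<lambda>p. fy p * g p + f p * gy p)"
proof -
  note D = C1_funD[OF assms(1)] C1_funD[OF assms(2)]
  have "((\<lambda>p. f p * g p) has_derivative
     (\<lambda>h. (fx p * g p + f p * gx p) * fst h + (fy p * g p + f p * gy p) * snd h)) (at p)" if "p \<in> S" for p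
    by (rule has_derivative_eq_rhs[OF has_derivative_mult[OF D(5)[OF that] D(10)[OF that]]])
      (auto simp: algebra_simps)
  then show ?thesis using D unfolding C1_fun_def by (auto intro!: continuous_intros)
qed

lemma C1_fun_lincomb:
  assumes "C1_fun S f fx fy" "C1_fun S g gx gy"
  shows "C1_fun S (\<lambda>p. a * f p + b * g p + c) (\<lambda>p. a * fx p + b * gx p) (\<lambda>p. a * fy p + b * gy p)"
proof -
  note D = C1_funD[OF assms(1)] C1_funD[OF assms(2)]
  have "((\<lambda>p. a * f p + b * g p + c) has_derivative
     (\<lambda>h. (a * fx p + b * gx p) * fst h + (a * fy p + b * gy p) * snd h)) (at p)" if "p \<in> S" for p
    using D(5)[OF that] D(10)[OF that] by (auto intro!: derivative_eq_intros simp: algebra_simps)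
  then show ?thesis using D unfolding C1_fun_def by (auto intro!: continuous_intros)
qed

lemma C1_fun_shift:
  assumes "C1_fun S f fx fy"
  shows "C1_fun ((\<lambda>p. p + e) -` S) (\<lambda>p. f (p + e)) (\<lambda>p. fx (p + e)) (\<lambda>p. fy (p + e))"
proof -
  note D = C1_funD[OF assms(1)]
  have c: "continuous_on UNIV (\<lambda>p. p + e)" by (auto intro!: continuous_intros)
  have "((\<lambda>p. f (p + e)) has_derivative (\<lambda>h. fx (p+e) * fst h + fy (p+e) * snd h)) (at p)" if "p + e \<in> S" for p
  proof -
    have "((\<lambda>p. p + e) has_derivative (\<lambda>h. h)) (at p)" by (auto intro!: derivative_eq_intros)
    from has_derivative_compose[OF this D(5)[OF that]] show ?thesis by simp
  qed
  moreover have "continuous_on ((\<lambda>p. p + e) -` S) (\<lambda>p. fx (p + e))" "continuous_on ((\<lambda>p. p + e) -` S) (\<lambda>p. fy (p + e))"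
    by (rule continuous_on_compose2[OF D(3)] continuous_on_compose2[OF D(4)], auto intro!: continuous_intros)+
  ultimately show ?thesis
    unfolding C1_fun_def using open_vimage[OF D(1) c] by auto
qed

text \<open>The second mixed difference is a mixed partial derivative at an intermediate point. Applied to
  \<open>f\<close> and to \<open>f\<close> with exchanged variables, it gives Schwarz's theorem.\<close>

lemma mixed_difference:
  assumes f: "C1_fun S f fx fy" and g: "C1_fun S fx fxx fxy"
    and h: "0 < h" and sub: "{x..x+h} \<times> {y..y+h} \<subseteq> S"
  shows "\<exists>p\<in>{x..x+h} \<times> {y..y+h}. f (x+h,y+h) - f (x+h,y) - f (x,y+h) + f (x,y) = h * h * fxy p"
proof -
  let ?G = "\<lambda>s. f (s,y+h) - f (s,y)"
  have "\<exists>z>x. z < x+h \<and> ?G (x+h) - ?G x = (x + h - x) * (fx (z,y+h) - fx (z,y))"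
    by (rule MVT2) (use h sub in \<open>auto intro!: derivative_eq_intros C1_fun_partial_x[OF f]\<close>)
  then obtain z where z: "x < z" "z < x + h" "?G (x+h) - ?G x = h * (fx (z,y+h) - fx (z,y))" by auto
  have "\<exists>t>y. t < y+h \<and> fx (z,y+h) - fx (z,y) = (y + h - y) * fxy (z,t)"
    by (rule MVT2) (use h sub z in \<open>auto intro!: C1_fun_partial_y[OF g]\<close>)
  then obtain t where t: "y < t" "t < y + h" "fx (z,y+h) - fx (z,y) = h * fxy (z,t)" by auto
  show ?thesis
    by (rule bexI[of _ "(z,t)"]) (use z t in \<open>auto simp: algebra_simps\<close>)
qed

lemma C1_fun_swap:
  assumes "C1_fun S f fx fy"
  shows "C1_fun (prod.swap -` S) (\<lambda>p. f (prod.swap p)) (\<lambda>p. fy (prod.swap p)) (\<lambda>p. fx (prod.swap p))"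
proof -
  note D = C1_funD[OF assms(1)]
  have sw: "prod.swap = (\<lambda>p::real\<times>real. (snd p, fst p))" by auto
  have c: "continuous_on T (prod.swap :: real\<times>real \<Rightarrow> _)" for T
    unfolding sw by (auto intro!: continuous_intros)
  have "((\<lambda>p. f (prod.swap p)) has_derivative (\<lambda>h. fy (prod.swap p) * fst h + fx (prod.swap p) * snd h)) (at p)"
    if "prod.swap p \<in> S" for p
  proof -
    have "(prod.swap has_derivative (\<lambda>h::real\<times>real. (snd h, fst h))) (at p)" unfolding sw by (auto intro!: derivative_eq_intros)
    from has_derivative_compose[OF this D(5)[OF that]] show ?thesis by (simp add: add.commute)
  qed
  moreover have "continuous_on (prod.swap -` S) (\<lambda>p. fx (prod.swap p))" "continuous_on (prod.swap -` S) (\<lambda>p. fy (prod.swap p))"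
    by (rule continuous_on_compose2[OF D(3) c] continuous_on_compose2[OF D(4) c], auto)+
  ultimately show ?thesis
    unfolding C1_fun_def using open_vimage[OF D(1) c] by auto
qed

lemma mixed_partials_commute:
  assumes f: "C1_fun S f fx fy" and g1: "C1_fun S fx fxx fxy" and g2: "C1_fun S fy fyx fyy"
    and p: "p \<in> S"
  shows "fxy p = fyx p"
proof -
  obtain x y where xy: "p = (x,y)" by (cases p)
  note D = C1_funD[OF g1] C1_funD[OF g2]
  have "open S" using D(1) .
  then obtain e where e: "e > 0" "ball p e \<subseteq> S" using p by (meson open_contains_ball)
  have bd: "dist q p \<le> 2 * h" if "q \<in> {x..x+h} \<times> {y..y+h}" for q h
  proof -
    have "dist q p \<le> \<bar>fst q - x\<bar> + \<bar>snd q - y\<bar>"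
      unfolding xy dist_prod_def using sqrt_sum_squares_le_sum_abs by (simp add: dist_real_def)
    also have "\<dots> \<le> 2 * h" using that by (cases q) auto
    finally show ?thesis .
  qed
  have ex: "\<exists>q r. dist q p \<le> 2 * h \<and> dist r p \<le> 2*h \<and> fxy q = fyx r" if h: "0 < h" "2 * h < e" for h
  proof -
    have sub: "{x..x+h} \<times> {y..y+h} \<subseteq> S"
    proof
      fix q assume "q \<in> {x..x+h} \<times> {y..y+h}"
      from bd[OF this] h have "q \<in> ball p e" by (simp add: dist_commute)
      then show "q \<in> S" using e by auto
    qed
    obtain q where q: "q \<in> {x..x+h} \<times> {y..y+h}"
       "f (x+h,y+h) - f (x+h,y) - f (x,y+h) + f (x,y) = h * h * fxy q"
      using mixed_difference[OF f g1 h(1) sub] by blast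
    have sub': "{y..y+h} \<times> {x..x+h} \<subseteq> prod.swap -` S" using sub by auto
    obtain r where r: "r \<in> {y..y+h} \<times> {x..x+h}"
       "f (x+h,y+h) - f (x,y+h) - f (x+h,y) + f (x,y) = h * h * fyx (prod.swap r)"
      using mixed_difference[OF C1_fun_swap[OF f] C1_fun_swap[OF g2] h(1) sub'] by auto
    have "prod.swap r \<in> {x..x+h} \<times> {y..y+h}" using r(1) by (cases r) auto
    moreover have "fxy q = fyx (prod.swap r)"
    proof -
      have "h * h * fxy q = h * h * fyx (prod.swap r)" using q(2) r(2) by linarith
      then show ?thesis using h by simp
    qed
    ultimately show ?thesis
      by (intro exI[of _ q] exI[of _ "prod.swap r"] conjI bd q(1))
  qed
  have "\<exists>q r. \<forall>n. dist (q n) p \<le> 2 * ((e/3) / real (Suc n)) \<and> dist (r n) p \<le> 2 * ((e/3) / real (Suc n)) \<and> fxy (q n) = fyx (r n)"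
  proof -
    have "\<forall>n. \<exists>q r. dist q p \<le> 2 * ((e/3) / real (Suc n)) \<and> dist r p \<le> 2 * ((e/3) / real (Suc n)) \<and> fxy q = fyx r"
    proof
      fix n
      have "2 * ((e/3) / real (Suc n)) \<le> 2 * (e/3)" using e by (intro mult_left_mono) (auto simp: field_simps)
      then have "2 * ((e/3) / real (Suc n)) < e" using e by linarith
      then show "\<exists>q r. dist q p \<le> 2 * ((e/3) / real (Suc n)) \<and> dist r p \<le> 2 * ((e/3) / real (Suc n)) \<and> fxy q = fyx r"
        using e by (intro ex) auto
    qed
    then show ?thesis by (simp only: choice_iff)
  qed
  then obtain q r where qr: "\<And>n. dist (q n) p \<le> 2 * ((e/3) / real (Suc n))"
     "\<And>n. dist (r n) p \<le> 2 * ((e/3) / real (Suc n))" "\<And>n. fxy (q n) = fyx (r n)" by blast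
  have z: "(\<lambda>n. 2 * ((e/3) / real (Suc n))) \<longlonglongrightarrow> 0"
    using tendsto_mult_left[OF LIMSEQ_Suc[OF lim_const_over_n[of "e/3"]], of 2] by simp
  have "q \<longlonglongrightarrow> p" "r \<longlonglongrightarrow> p"
    by (rule metric_tendsto_imp_tendsto[OF z], use qr e in \<open>auto intro!: always_eventually simp: abs_of_pos\<close>)+
  moreover have "isCont fxy p" "isCont fyx p"
    using D p by (auto simp: continuous_on_eq_continuous_at)
  ultimately have "(\<lambda>n. fxy (q n)) \<longlonglongrightarrow> fxy p" "(\<lambda>n. fyx (r n)) \<longlonglongrightarrow> fyx p"
    by (auto intro: isCont_tendsto_compose)
  then show ?thesis using qr(3) LIMSEQ_unique by auto
qed

section \<open>Green's formula on rectangles\<close>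

lemma abs_diff_le_deriv_bound:
  fixes f :: "real \<Rightarrow> real"
  assumes "\<And>x. x \<in> {a..b} \<Longrightarrow> (f has_real_derivative f' x) (at x)"
    and "\<And>x. x \<in> {a..b} \<Longrightarrow> \<bar>f' x\<bar> \<le> B" "x \<in> {a..b}" "y \<in> {a..b}"
  shows "\<bar>f x - f y\<bar> \<le> B * \<bar>x - y\<bar>"
  using field_differentiable_bound[of "{a..b}" f f' B x y] assms
  by (auto intro: has_field_derivative_at_within)

lemma bounded_convergence_interval:
  fixes f :: "nat \<Rightarrow> real \<Rightarrow> real"
  assumes "\<And>n. continuous_on {a..b} (f n)" "\<And>n x. x \<in> {a..b} \<Longrightarrow> \<bar>f n x\<bar> \<le> B"
    and "\<And>x. x \<in> {a..b} \<Longrightarrow> (\<lambda>n. f n x) \<longlonglongrightarrow> g x"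
  shows "(\<lambda>n. integral {a..b} (f n)) \<longlonglongrightarrow> integral {a..b} g"
  by (rule dominated_convergence(2)[where h = "\<lambda>_. B"])
    (use assms in \<open>auto intro: integrable_continuous_interval\<close>)

lemma continuous_on_slice:
  fixes f :: "real \<times> real \<Rightarrow> real"
  assumes "continuous_on S f"
  shows "(\<And>t. t \<in> T \<Longrightarrow> (x, t) \<in> S) \<Longrightarrow> continuous_on T (\<lambda>y. f (x, y))"
    and "(\<And>t. t \<in> T \<Longrightarrow> (t, y) \<in> S) \<Longrightarrow> continuous_on T (\<lambda>x. f (x, y))"
  by (rule continuous_on_compose2[OF assms]; auto intro!: continuous_intros)+

lemma compact_bound:
  fixes f :: "real \<times> real \<Rightarrow> real"
  assumes "continuous_on S f" "{a..b} \<times> {c..d} \<subseteq> S"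
  obtains B where "\<And>x y. x \<in> {a..b} \<Longrightarrow> y \<in> {c..d} \<Longrightarrow> \<bar>f (x, y)\<bar> \<le> B" "0 \<le> B"
proof -
  have "compact (f ` ({a..b} \<times> {c..d}))"
    by (intro compact_continuous_image compact_Times continuous_on_subset[OF assms]) auto
  then have "bounded (f ` ({a..b} \<times> {c..d}))" by (rule compact_imp_bounded)
  then obtain B where "\<forall>v\<in>f ` ({a..b} \<times> {c..d}). norm v \<le> B" unfolding bounded_iff by auto
  then have "\<And>x y. x \<in> {a..b} \<Longrightarrow> y \<in> {c..d} \<Longrightarrow> \<bar>f (x, y)\<bar> \<le> max B 0" by (force simp: le_max_iff_disj)
  then show thesis using that[of "max B 0"] by auto
qed

text \<open>The step that makes Green's formula work for functions that are merely \<open>C\<^sup>1\<close>: the function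
  differentiated here involves \<open>gy\<close>, but its derivative needs no second derivative of \<open>g\<close>, because
  an integration by parts in \<open>y\<close> moves the \<open>y\<close>-derivative from the difference quotient of \<open>g\<close> to \<open>f\<close>.\<close>

lemma green_derivative:
  assumes f: "C1_fun S f fx fy" and g: "C1_fun S g gx gy"
    and e: "0 < e" and cd: "c \<le> d" and sub: "{x0-e..x0+e} \<times> {c..d} \<subseteq> S"
  shows "((\<lambda>x. integral {c..d} (\<lambda>y. f (x,y) * gy (x,y))) has_real_derivative
    integral {c..d} (\<lambda>y. fx (x0,y) * gy (x0,y) - fy (x0,y) * gx (x0,y))
      + (f (x0,d) * gx (x0,d) - f (x0,c) * gx (x0,c))) (at x0)"
proof -
  note Df = C1_funD[OF f] and Dg = C1_funD[OF g]
  let ?U = "{x0-e<..<x0+e}"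
  let ?phi = "\<lambda>x. integral {c..d} (\<lambda>y. f (x,y) * gy (x,y))"
  let ?L = "integral {c..d} (\<lambda>y. fx (x0,y) * gy (x0,y) - fy (x0,y) * gx (x0,y))
      + (f (x0,d) * gx (x0,d) - f (x0,c) * gx (x0,c))"
  have U: "open ?U" "x0 \<in> ?U" using e by auto
  have inS: "(x,y) \<in> S" if "x \<in> {x0-e..x0+e}" "y \<in> {c..d}" for x y using sub that by auto
  obtain Bf where Bf: "\<And>x y. x \<in> {x0-e..x0+e} \<Longrightarrow> y \<in> {c..d} \<Longrightarrow> \<bar>fx (x, y)\<bar> \<le> Bf" "0 \<le> Bf"
    using compact_bound[OF Df(3) sub] by blast
  obtain Bg where Bg: "\<And>x y. x \<in> {x0-e..x0+e} \<Longrightarrow> y \<in> {c..d} \<Longrightarrow> \<bar>gx (x, y)\<bar> \<le> Bg" "0 \<le> Bg"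
    using compact_bound[OF Dg(3) sub] by blast
  obtain Bh where Bh: "\<And>x y. x \<in> {x0-e..x0+e} \<Longrightarrow> y \<in> {c..d} \<Longrightarrow> \<bar>fy (x, y)\<bar> \<le> Bh" "0 \<le> Bh"
    using compact_bound[OF Df(4) sub] by blast
  obtain Bk where Bk: "\<And>x y. x \<in> {x0-e..x0+e} \<Longrightarrow> y \<in> {c..d} \<Longrightarrow> \<bar>gy (x, y)\<bar> \<le> Bk" "0 \<le> Bk"
    using compact_bound[OF Dg(4) sub] by blast
  have "((\<lambda>x. (?phi x - ?phi x0) / (x - x0)) \<longlongrightarrow> ?L) (at x0 within ?U)"
    unfolding tendsto_at_iff_sequentially comp_def
  proof (intro allI impI)
    fix X :: "nat \<Rightarrow> real"
    assume X: "\<forall>i. X i \<in> ?U - {x0}" and lim: "X \<longlonglongrightarrow> x0"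
    have Xin: "X n \<in> {x0-e..x0+e}" "X n \<noteq> x0" for n using X[rule_format, of n] by auto
    have x0in: "x0 \<in> {x0-e..x0+e}" using e by auto
    define qf where "qf n y = (f (X n, y) - f (x0, y)) / (X n - x0)" for n y
    define qg where "qg n y = (g (X n, y) - g (x0, y)) / (X n - x0)" for n y
    have limat: "filterlim X (at x0) sequentially"
      using lim Xin(2) by (auto simp: filterlim_at)
    have qf_lim: "(\<lambda>n. qf n y) \<longlonglongrightarrow> fx (x0, y)" if "y \<in> {c..d}" for y
      using filterlim_compose[OF C1_fun_partial_x[OF f inS[OF x0in that],
         where T=UNIV, unfolded has_field_derivative_iff] limat]
      by (simp add: qf_def)
    have qg_lim: "(\<lambda>n. qg n y) \<longlonglongrightarrow> gx (x0, y)" if "y \<in> {c..d}" for y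
      using filterlim_compose[OF C1_fun_partial_x[OF g inS[OF x0in that],
         where T=UNIV, unfolded has_field_derivative_iff] limat]
      by (simp add: qg_def)
    have qf_bd: "\<bar>qf n y\<bar> \<le> Bf" if "y \<in> {c..d}" for n y
    proof -
      have "\<bar>f (X n, y) - f (x0, y)\<bar> \<le> Bf * \<bar>X n - x0\<bar>"
        by (rule abs_diff_le_deriv_bound[where f = "\<lambda>x. f (x,y)", OF C1_fun_partial_x[OF f inS]])
          (use that Bf Xin x0in in auto)
      then show ?thesis using Xin(2)[of n] by (simp add: qf_def abs_divide field_simps)
    qed
    have qg_bd: "\<bar>qg n y\<bar> \<le> Bg" if "y \<in> {c..d}" for n y
    proof -
      have "\<bar>g (X n, y) - g (x0, y)\<bar> \<le> Bg * \<bar>X n - x0\<bar>"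
        by (rule abs_diff_le_deriv_bound[where f = "\<lambda>x. g (x,y)", OF C1_fun_partial_x[OF g inS]])
          (use that Bg Xin x0in in auto)
      then show ?thesis using Xin(2)[of n] by (simp add: qg_def abs_divide field_simps)
    qed
    have c0: "continuous_on {c..d} (\<lambda>y. f (x,y))" "continuous_on {c..d} (\<lambda>y. g (x,y))"
      "continuous_on {c..d} (\<lambda>y. gy (x,y))" "continuous_on {c..d} (\<lambda>y. fy (x,y))"
      if "x \<in> {x0-e..x0+e}" for x
      using Df Dg that by (auto intro!: continuous_on_slice inS)
    note cX = c0[OF Xin(1)] and c0 = c0[OF x0in]
    have cont_q: "continuous_on {c..d} (qf n)" "continuous_on {c..d} (qg n)" for n
      unfolding qf_def qg_def using Xin(2) by (auto intro!: continuous_intros c0 cX)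
    let ?u = "\<lambda>n y. qf n y * gy (X n, y) - fy (x0, y) * qg n y"
    have gy_lim: "(\<lambda>n. gy (X n, y)) \<longlonglongrightarrow> gy (x0, y)" if "y \<in> {c..d}" for y
    proof -
      have "isCont gy (x0, y)" using Dg(1,4) inS[OF x0in that] by (auto simp: continuous_on_eq_continuous_at)
      then show ?thesis by (rule isCont_tendsto_compose) (auto intro!: tendsto_intros lim)
    qed
    have main: "(\<lambda>n. integral {c..d} (?u n)) \<longlonglongrightarrow>
        integral {c..d} (\<lambda>y. fx (x0,y) * gy (x0,y) - fy (x0,y) * gx (x0,y))"
    proof (rule bounded_convergence_interval[where B = "Bf * Bk + Bh * Bg"])
      show "continuous_on {c..d} (?u n)" for n
        by (auto intro!: continuous_intros c0 cX cont_q)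
      show "\<bar>?u n y\<bar> \<le> Bf * Bk + Bh * Bg" if "y \<in> {c..d}" for n y
      proof -
        have "\<bar>qf n y * gy (X n, y)\<bar> \<le> Bf * Bk" unfolding abs_mult
          by (rule mult_mono) (use qf_bd Bk Bf Xin that in auto)
        moreover have "\<bar>fy (x0, y) * qg n y\<bar> \<le> Bh * Bg" unfolding abs_mult
          by (rule mult_mono) (use qg_bd Bh Bg x0in that in auto)
        ultimately show ?thesis by linarith
      qed
      show "(\<lambda>n. ?u n y) \<longlonglongrightarrow> fx (x0,y) * gy (x0,y) - fy (x0,y) * gx (x0,y)" if "y \<in> {c..d}" for y
        using that by (intro tendsto_intros qf_lim qg_lim gy_lim)
    qed
    have id: "(?phi (X n) - ?phi x0) / (X n - x0) =
        integral {c..d} (?u n) + (f (x0,d) * qg n d - f (x0,c) * qg n c)" for n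
    proof -
      let ?D = "X n - x0"
      have D0: "?D \<noteq> 0" using Xin(2)[of n] by simp
      have parts: "((\<lambda>y. fy (x0,y) * (g (X n,y) - g (x0,y)) + f (x0,y) * (gy (X n,y) - gy (x0,y)))
          has_integral (f (x0,d) * (g (X n,d) - g (x0,d)) - f (x0,c) * (g (X n,c) - g (x0,c)))) {c..d}"
      proof (rule fundamental_theorem_of_calculus[OF cd])
        fix y assume y: "y \<in> {c..d}"
        have "((\<lambda>y. f (x0,y) * (g (X n,y) - g (x0,y))) has_real_derivative
           (fy (x0,y) * (g (X n,y) - g (x0,y)) + f (x0,y) * (gy (X n,y) - gy (x0,y)))) (at y within {c..d})"
          by (rule derivative_eq_intros C1_fun_partial_y[OF f] C1_fun_partial_y[OF g] inS x0in Xin y refl)+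
             (simp add: algebra_simps)
        then show "((\<lambda>y. f (x0,y) * (g (X n,y) - g (x0,y))) has_vector_derivative
           (fy (x0,y) * (g (X n,y) - g (x0,y)) + f (x0,y) * (gy (X n,y) - gy (x0,y)))) (at y within {c..d})"
          by (simp add: has_real_derivative_iff_has_vector_derivative)
      qed
      have u: "((\<lambda>y. ?D * ?u n y) has_integral (?D * integral {c..d} (?u n))) {c..d}"
        by (intro has_integral_mult_right integrable_integral integrable_continuous_interval)
          (auto intro!: continuous_intros c0 cX cont_q)
      have e1: "((\<lambda>y. f (X n,y) * gy (X n,y) - f (x0,y) * gy (x0,y)) has_integral (?phi (X n) - ?phi x0)) {c..d}"
        by (intro has_integral_diff integrable_integral integrable_continuous_interval)
          (auto intro!: continuous_intros c0 cX)
      have "((\<lambda>y. f (X n,y) * gy (X n,y) - f (x0,y) * gy (x0,y)) has_integral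
         (?D * integral {c..d} (?u n) + (f (x0,d) * (g (X n,d) - g (x0,d)) - f (x0,c) * (g (X n,c) - g (x0,c))))) {c..d}"
      proof (rule has_integral_eq[rotated, OF has_integral_add[OF u parts]])
        fix y
        have q: "?D * qf n y = f (X n,y) - f (x0,y)" "?D * qg n y = g (X n,y) - g (x0,y)"
          using D0 by (auto simp: qf_def qg_def)
        have "?D * ?u n y = (?D * qf n y) * gy (X n, y) - fy (x0, y) * (?D * qg n y)" by (simp add: algebra_simps)
        then show "?D * ?u n y + (fy (x0,y) * (g (X n,y) - g (x0,y)) + f (x0,y) * (gy (X n,y) - gy (x0,y)))
          = f (X n,y) * gy (X n,y) - f (x0,y) * gy (x0,y)"
          unfolding q by (simp add: algebra_simps)
      qed
      from has_integral_unique[OF e1 this] have "?phi (X n) - ?phi x0 = ?D * integral {c..d} (?u n) +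
          (f (x0,d) * (?D * qg n d) - f (x0,c) * (?D * qg n c))"
        using D0 by (simp add: qg_def)
      also have "\<dots> = ?D * (integral {c..d} (?u n) + (f (x0,d) * qg n d - f (x0,c) * qg n c))"
        by (simp only: algebra_simps)
      finally show ?thesis using D0 by simp
    qed
    show "(\<lambda>n. (?phi (X n) - ?phi x0) / (X n - x0)) \<longlonglongrightarrow> ?L"
      unfolding id by (intro tendsto_intros main qg_lim) (use cd in auto)
  qed
  then show ?thesis
    unfolding has_field_derivative_iff using at_within_open[OF U(2,1)] by simp
qed

theorem green_rectangle:
  assumes f: "C1_fun S f fx fy" and g: "C1_fun S g gx gy"
    and ab: "a \<le> b" and cd: "c \<le> d" and sub: "{a..b} \<times> {c..d} \<subseteq> S"
  shows "integral (cbox (a,c) (b,d)) (\<lambda>p. fx p * gy p - fy p * gx p) =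
    integral {c..d} (\<lambda>y. f (b,y) * gy (b,y)) - integral {c..d} (\<lambda>y. f (a,y) * gy (a,y))
    - integral {a..b} (\<lambda>x. f (x,d) * gx (x,d)) + integral {a..b} (\<lambda>x. f (x,c) * gx (x,c))"
proof -
  note Df = C1_funD[OF f] and Dg = C1_funD[OF g]
  let ?J = "\<lambda>p. fx p * gy p - fy p * gx p"
  let ?phi = "\<lambda>x. integral {c..d} (\<lambda>y. f (x,y) * gy (x,y))"
  have cJS: "continuous_on S ?J" using Df Dg by (intro continuous_intros) auto
  have cJ: "continuous_on (cbox (a,c) (b,d)) ?J"
    by (rule continuous_on_subset[OF cJS]) (use sub in \<open>auto simp: cbox_Pair_eq\<close>)
  obtain e where e: "e > 0" "(\<Union>p\<in>{a..b} \<times> {c..d}. cball p e) \<subseteq> S"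
    using compact_subset_open_imp_cball_epsilon_subset[of "{a..b} \<times> {c..d}" S] Df(1) sub
    by (auto intro: compact_Times)
  have sub': "{x-e..x+e} \<times> {c..d} \<subseteq> S" if "x \<in> {a..b}" for x
  proof
    fix p assume "p \<in> {x-e..x+e} \<times> {c..d}"
    then have "p \<in> cball (x, snd p) e" "(x, snd p) \<in> {a..b} \<times> {c..d}"
      using that by (cases p; auto simp: dist_Pair_Pair dist_real_def)+
    then show "p \<in> S" using e(2) by blast
  qed
  have "((\<lambda>x. integral {c..d} (\<lambda>y. ?J (x,y)) + (f (x,d) * gx (x,d) - f (x,c) * gx (x,c)))
      has_integral (?phi b - ?phi a)) {a..b}"
    by (rule fundamental_theorem_of_calculus[OF ab])
      (use green_derivative[OF f g e(1) cd sub'] in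
        \<open>auto simp: has_real_derivative_iff_has_vector_derivative[symmetric] intro: has_field_derivative_at_within\<close>)
  moreover have "((\<lambda>x. f (x,d) * gx (x,d) - f (x,c) * gx (x,c)) has_integral
     (integral {a..b} (\<lambda>x. f (x,d) * gx (x,d)) - integral {a..b} (\<lambda>x. f (x,c) * gx (x,c)))) {a..b}"
    using sub cd Df(2) Dg(3)
    by (intro has_integral_diff integrable_integral integrable_continuous_interval continuous_intros)
      (auto intro!: continuous_on_slice)
  ultimately have "((\<lambda>x. integral {c..d} (\<lambda>y. ?J (x,y))) has_integral
     (?phi b - ?phi a - (integral {a..b} (\<lambda>x. f (x,d) * gx (x,d)) - integral {a..b} (\<lambda>x. f (x,c) * gx (x,c))))) {a..b}"
    by (rule has_integral_eq[rotated, OF has_integral_diff]) auto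
  then show ?thesis
    using integral_prod_continuous[OF cJ] by (auto simp: integral_unique)
qed

section \<open>Integrals over squares and over their boundaries\<close>

lemma abs_diff_le_integral_deriv:
  fixes f :: "real \<Rightarrow> real"
  assumes "\<And>t. t \<in> {a..b} \<Longrightarrow> (f has_real_derivative f' t) (at t within {a..b})"
    and "continuous_on {a..b} f'" "a \<le> x" "x \<le> y" "y \<le> b"
  shows "\<bar>f y - f x\<bar> \<le> integral {x..y} (\<lambda>t. \<bar>f' t\<bar>)"
proof -
  have "(f' has_integral (f y - f x)) {x..y}"
  proof (rule fundamental_theorem_of_calculus[OF assms(4)])
    fix t assume "t \<in> {x..y}"
    then have "(f has_real_derivative f' t) (at t within {x..y})"
      using assms(3-5) by (intro DERIV_subset[OF assms(1)]) auto
    then show "(f has_vector_derivative f' t) (at t within {x..y})"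
      by (simp add: has_real_derivative_iff_has_vector_derivative)
  qed
  then have "norm (integral {x..y} f') = \<bar>f y - f x\<bar>" "f' integrable_on {x..y}"
    by (auto simp: integral_unique)
  moreover have "norm (integral {x..y} f') \<le> integral {x..y} (\<lambda>t. \<bar>f' t\<bar>)"
    using assms by (intro integral_norm_bound_integral integrable_continuous_interval continuous_intros)
      (auto intro: continuous_on_subset)
  ultimately show ?thesis by simp
qed

lemma integral_abs_power2_le:
  fixes f :: "real \<Rightarrow> real"
  assumes "continuous_on {a..b} f" "a \<le> b"
  shows "(integral {a..b} (\<lambda>t. \<bar>f t\<bar>))\<^sup>2 \<le> (b - a) * integral {a..b} (\<lambda>t. (f t)\<^sup>2)"
proof (cases "a = b")
  case False
  with assms have ab: "a < b" by simp
  let ?V = "integral {a..b} (\<lambda>t. \<bar>f t\<bar>)" and ?E = "integral {a..b} (\<lambda>t. (f t)\<^sup>2)"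
  define m where "m = ?V / (b - a)"
  have "((\<lambda>t. (f t)\<^sup>2 - 2 * m * \<bar>f t\<bar> + m\<^sup>2) has_integral (?E - 2 * m * ?V + (b - a) * m\<^sup>2)) {a..b}"
  proof (intro has_integral_add has_integral_diff has_integral_mult_right integrable_integral integrable_continuous_interval)
    show "((\<lambda>t. m\<^sup>2) has_integral (b - a) * m\<^sup>2) {a..b}"
      using has_integral_const_real[of "m\<^sup>2" a b] ab by simp
  qed (use assms in \<open>auto intro!: continuous_intros\<close>)
  moreover have "0 \<le> (f t)\<^sup>2 - 2 * m * \<bar>f t\<bar> + m\<^sup>2" for t
    using zero_le_power2[of "\<bar>f t\<bar> - m"] by (simp add: power2_diff algebra_simps)
  ultimately have "0 \<le> ?E - 2 * m * ?V + (b - a) * m\<^sup>2" by (rule has_integral_nonneg)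
  also have "\<dots> = ?E - ?V\<^sup>2 / (b - a)"
  proof -
    have "?V = m * (b - a)" using ab by (simp add: m_def)
    then show ?thesis using ab by (simp add: power2_eq_square)
  qed
  finally show ?thesis using ab by (simp add: field_simps)
qed auto

lemma abs_diff_midpoint_le:
  fixes v A B m :: real
  assumes "\<bar>v - A\<bar> \<le> I1" "\<bar>m - v\<bar> \<le> I2" "\<bar>B - m\<bar> \<le> I3"
  shows "\<bar>v - (A + B) / 2\<bar> \<le> (I1 + I2 + I3) / 2"
  using assms by (auto simp: abs_if field_simps split: if_splits)

text \<open>An isoperimetric inequality on an arc made of two consecutive edges of length \<open>2 r\<close>: when \<open>c\<close> is
  the mean of the values of \<open>f\<close> at the two ends of the arc, \<open>\<bar>f - c\<bar>\<close> is at most half of the total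
  variation of \<open>f\<close> along the arc. The function \<open>u\<close> will be the tangential derivative of the second
  component of a plane map with first component \<open>f\<close>.\<close>

lemma two_edge_arc_bound:
  fixes f1 f2 :: "real \<Rightarrow> real"
  assumes d1: "\<And>t. t \<in> {a1..b1} \<Longrightarrow> (f1 has_real_derivative f1' t) (at t within {a1..b1})"
    and d2: "\<And>t. t \<in> {a2..b2} \<Longrightarrow> (f2 has_real_derivative f2' t) (at t within {a2..b2})"
    and c1: "continuous_on {a1..b1} f1'" "continuous_on {a1..b1} u1"
    and c2: "continuous_on {a2..b2} f2'" "continuous_on {a2..b2} u2"
    and r: "0 \<le> r" "b1 - a1 = 2 * r" "b2 - a2 = 2 * r" and meet: "f1 b1 = f2 a2"
    and c: "c = (f1 a1 + f2 b2) / 2"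
  shows "\<bar>integral {a1..b1} (\<lambda>t. (f1 t - c) * u1 t) + integral {a2..b2} (\<lambda>t. (f2 t - c) * u2 t)\<bar>
    \<le> r * (integral {a1..b1} (\<lambda>t. (f1' t)\<^sup>2 + (u1 t)\<^sup>2) + integral {a2..b2} (\<lambda>t. (f2' t)\<^sup>2 + (u2 t)\<^sup>2))"
proof -
  have ab: "a1 \<le> b1" "a2 \<le> b2" using r by auto
  have cf: "continuous_on {a1..b1} f1" "continuous_on {a2..b2} f2"
    by (rule DERIV_continuous_on; use d1 d2 in blast)+
  let ?I = "\<lambda>a b g. integral {a..b} (\<lambda>t::real. \<bar>g t\<bar> :: real)"
  define V1 V2 W1 W2 where "V1 = ?I a1 b1 f1'" and "V2 = ?I a2 b2 f2'"
    and "W1 = ?I a1 b1 u1" and "W2 = ?I a2 b2 u2"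
  define P1 P2 Q1 Q2 where "P1 = integral {a1..b1} (\<lambda>t. (f1' t)\<^sup>2)"
    and "P2 = integral {a2..b2} (\<lambda>t. (f2' t)\<^sup>2)"
    and "Q1 = integral {a1..b1} (\<lambda>t. (u1 t)\<^sup>2)" and "Q2 = integral {a2..b2} (\<lambda>t. (u2 t)\<^sup>2)"
  have nn: "0 \<le> W1" "0 \<le> W2" "0 \<le> V1" "0 \<le> V2"
    unfolding W1_def W2_def V1_def V2_def
    by (intro integral_nonneg integrable_continuous_interval continuous_intros c1 c2; simp)+
  have split1: "?I a1 x f1' + ?I x b1 f1' = V1" if "x \<in> {a1..b1}" for x
    unfolding V1_def using that c1 by (intro Henstock_Kurzweil_Integration.integral_combine integrable_continuous_interval continuous_intros) auto
  have split2: "?I a2 x f2' + ?I x b2 f2' = V2" if "x \<in> {a2..b2}" for x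
    unfolding V2_def using that c2 by (intro Henstock_Kurzweil_Integration.integral_combine integrable_continuous_interval continuous_intros) auto
  have b1: "\<bar>f1 x - c\<bar> \<le> (V1 + V2) / 2" if "x \<in> {a1..b1}" for x
  proof -
    have "\<bar>f1 x - f1 a1\<bar> \<le> ?I a1 x f1'" "\<bar>f1 b1 - f1 x\<bar> \<le> ?I x b1 f1'"
      using that by (intro abs_diff_le_integral_deriv[OF d1 c1(1)]; simp)+
    moreover have "\<bar>f2 b2 - f2 a2\<bar> \<le> V2" unfolding V2_def
      using ab by (intro abs_diff_le_integral_deriv[OF d2 c2(1)]) auto
    ultimately show ?thesis
      using abs_diff_midpoint_le[of "f1 x" "f1 a1" "?I a1 x f1'" "f1 b1" "?I x b1 f1'" "f2 b2" V2]
        split1[OF that] meet unfolding c by simp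
  qed
  have b2: "\<bar>f2 x - c\<bar> \<le> (V1 + V2) / 2" if "x \<in> {a2..b2}" for x
  proof -
    have "\<bar>f2 x - f2 a2\<bar> \<le> ?I a2 x f2'" "\<bar>f2 b2 - f2 x\<bar> \<le> ?I x b2 f2'"
      using that by (intro abs_diff_le_integral_deriv[OF d2 c2(1)]; simp)+
    moreover have "\<bar>f1 b1 - f1 a1\<bar> \<le> V1" unfolding V1_def
      using ab by (intro abs_diff_le_integral_deriv[OF d1 c1(1)]) auto
    ultimately show ?thesis
      using abs_diff_midpoint_le[of "f2 x" "f2 b2" "?I x b2 f2'" "f2 a2" "?I a2 x f2'" "f1 a1" V1]
        split2[OF that] meet unfolding c
      by (simp add: abs_minus_commute add_ac)
  qed
  have e1: "\<bar>integral {a1..b1} (\<lambda>t. (f1 t - c) * u1 t)\<bar> \<le> (V1 + V2) / 2 * W1"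
  proof -
    have "norm (integral {a1..b1} (\<lambda>t. (f1 t - c) * u1 t)) \<le> integral {a1..b1} (\<lambda>t. (V1 + V2) / 2 * \<bar>u1 t\<bar>)"
      by (intro integral_norm_bound_integral integrable_continuous_interval continuous_intros c1 cf)
        (simp only: real_norm_def abs_mult, intro mult_right_mono b1 abs_ge_zero, simp)
    then show ?thesis by (simp add: W1_def)
  qed
  have e2: "\<bar>integral {a2..b2} (\<lambda>t. (f2 t - c) * u2 t)\<bar> \<le> (V1 + V2) / 2 * W2"
  proof -
    have "norm (integral {a2..b2} (\<lambda>t. (f2 t - c) * u2 t)) \<le> integral {a2..b2} (\<lambda>t. (V1 + V2) / 2 * \<bar>u2 t\<bar>)"
      by (intro integral_norm_bound_integral integrable_continuous_interval continuous_intros c2 cf)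
        (simp only: real_norm_def abs_mult, intro mult_right_mono b2 abs_ge_zero, simp)
    then show ?thesis by (simp add: W2_def)
  qed
  have sq: "V1\<^sup>2 \<le> 2 * r * P1" "V2\<^sup>2 \<le> 2 * r * P2" "W1\<^sup>2 \<le> 2 * r * Q1" "W2\<^sup>2 \<le> 2 * r * Q2"
    unfolding V1_def V2_def W1_def W2_def P1_def P2_def Q1_def Q2_def
    using integral_abs_power2_le[OF c1(1) ab(1)] integral_abs_power2_le[OF c1(2) ab(1)]
      integral_abs_power2_le[OF c2(1) ab(2)] integral_abs_power2_le[OF c2(2) ab(2)] r by auto
  have "(V1 + V2) / 2 * (W1 + W2) \<le> ((V1 + V2)\<^sup>2 + (W1 + W2)\<^sup>2) / 4"
    using zero_le_power2[of "(V1 + V2) - (W1 + W2)"] by (simp add: power2_eq_square algebra_simps)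
  also have "\<dots> \<le> (2 * (V1\<^sup>2 + V2\<^sup>2) + 2 * (W1\<^sup>2 + W2\<^sup>2)) / 4"
    using zero_le_power2[of "V1 - V2"] zero_le_power2[of "W1 - W2"] by (simp add: power2_eq_square algebra_simps)
  also have "\<dots> \<le> r * ((P1 + Q1) + (P2 + Q2))"
    using sq by (simp add: algebra_simps)
  also have "P1 + Q1 = integral {a1..b1} (\<lambda>t. (f1' t)\<^sup>2 + (u1 t)\<^sup>2)" unfolding P1_def Q1_def
    by (intro integral_add[symmetric] integrable_continuous_interval continuous_intros c1)
  also have "P2 + Q2 = integral {a2..b2} (\<lambda>t. (f2' t)\<^sup>2 + (u2 t)\<^sup>2)" unfolding P2_def Q2_def
    by (intro integral_add[symmetric] integrable_continuous_interval continuous_intros c2)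
  finally show ?thesis using e1 e2 by (simp add: algebra_simps)
qed

text \<open>The closed square with centre \<open>z\<close> and half side \<open>r\<close>.\<close>

definition sq :: "real \<times> real \<Rightarrow> real \<Rightarrow> (real \<times> real) set"
  where "sq z r = {fst z - r..fst z + r} \<times> {snd z - r..snd z + r}"

lemma sq_cbox: "sq z r = cbox (fst z - r, snd z - r) (fst z + r, snd z + r)"
  by (simp add: sq_def cbox_Pair_eq)

lemma sq_subset_sq:
  assumes "\<bar>fst z - fst p\<bar> + s \<le> r" "\<bar>snd z - snd p\<bar> + s \<le> r"
  shows "sq z s \<subseteq> sq p r"
  using assms unfolding sq_def by auto

text \<open>The integral of \<open>J\<close> over the boundary of the square, with respect to arc length.\<close>

definition boundary_integral :: "(real \<times> real \<Rightarrow> real) \<Rightarrow> real \<times> real \<Rightarrow> real \<Rightarrow> real"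
  where "boundary_integral J z r =
    integral {snd z - r..snd z + r} (\<lambda>t. J (fst z + r, t) + J (fst z - r, t)) +
    integral {fst z - r..fst z + r} (\<lambda>t. J (t, snd z + r) + J (t, snd z - r))"

lemma symmetric_integral_derivative:
  fixes h :: "real \<Rightarrow> real"
  assumes "continuous_on {x-R..x+R} h" "0 < s" "s < R"
  shows "((\<lambda>s. integral {x-s..x+s} h) has_real_derivative (h (x+s) + h (x-s))) (at s)"
proof -
  let ?H = "\<lambda>t. integral {x-R..t} h"
  have der: "(?H has_real_derivative h t) (at t)" if "t \<in> {x-R<..<x+R}" for t
    using integral_has_real_derivative[OF assms(1), of t] at_within_interior[of t "{x-R..x+R}"] that
    by auto
  have eq: "integral {x-s..x+s} h = ?H (x+s) - ?H (x-s)" if "s \<in> {0<..<R}" for s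
  proof -
    have "integral {x-R..x-s} h + integral {x-s..x+s} h = integral {x-R..x+s} h"
      using that by (intro Henstock_Kurzweil_Integration.integral_combine integrable_continuous_interval continuous_on_subset[OF assms(1)]) auto
    then show ?thesis by simp
  qed
  have "((\<lambda>s. ?H (x+s) - ?H (x-s)) has_real_derivative (h (x+s) * 1 - h (x-s) * (-1))) (at s)"
    by (intro DERIV_diff DERIV_chain2[of ?H] der) (use assms in \<open>auto intro!: derivative_eq_intros\<close>)
  then have "((\<lambda>s. ?H (x+s) - ?H (x-s)) has_real_derivative (h (x+s) + h (x-s))) (at s)" by simp
  then show ?thesis
    by (rule has_field_derivative_transform_within_open[where S = "{0<..<R}"])
      (use assms eq in auto)
qed

lemma integral_rescale:
  fixes h :: "real \<Rightarrow> real"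
  assumes "continuous_on {x-s..x+s} h" "0 < s"
  shows "integral {x-s..x+s} h = s * integral {-1..1} (\<lambda>t. h (x + s * t))"
proof -
  have "((\<lambda>t. h (s *\<^sub>R t + x)) has_integral (integral {x-s..x+s} h /\<^sub>R s ^ DIM(real)))
      (cbox ((x - s - x) /\<^sub>R s) ((x + s - x) /\<^sub>R s))"
    by (rule has_integral_affinity')
      (use assms in \<open>auto intro!: integrable_integral integrable_continuous_interval\<close>)
  then have "((\<lambda>t. h (x + s * t)) has_integral (integral {x-s..x+s} h / s)) {-1..1}"
    using assms(2) by (simp add: add.commute divide_inverse mult.commute)
  then show ?thesis using assms(2) by (simp add: integral_unique)
qed

text \<open>Both sides of the square move with \<open>r\<close>; the two half sides are treated as independent variables
  and the total derivative is assembled from the two partial derivatives.\<close>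

lemma square_integral_derivative:
  fixes J :: "real \<times> real \<Rightarrow> real"
  assumes J: "continuous_on (sq z R) J" and r: "0 < r" "r < R"
  shows "((\<lambda>r. integral (sq z r) J) has_real_derivative boundary_integral J z r) (at r)"
proof -
  obtain x y where z: "z = (x,y)" by (cases z)
  let ?X = "{0<..<R}"
  have J': "continuous_on ({x-R..x+R} \<times> {y-R..y+R}) J" using J by (simp add: z sq_def)
  define A where "A = (\<lambda>s r. integral {x-s..x+s} (\<lambda>\<xi>. integral {y-r..y+r} (\<lambda>t. J (\<xi>,t))))"
  have sub: "continuous_on (cbox (x-s, y-r) (x+s, y+r)) J" if "s \<in> ?X" "r \<in> ?X" for s r
    by (rule continuous_on_subset[OF J']) (use that in \<open>auto simp: cbox_Pair_eq\<close>)
  have A1: "integral (sq z r) J = A r r" if "r \<in> ?X" for r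
    using integral_prod_continuous[OF sub[OF that that]] by (simp add: A_def sq_cbox z)
  have A2: "A s r = integral {y-r..y+r} (\<lambda>t. integral {x-s..x+s} (\<lambda>\<xi>. J (\<xi>,t)))"
    if "s \<in> ?X" "r \<in> ?X" for s r
    using integral_swap_continuous[of "x-s" "y-r" "x+s" "y+r" "\<lambda>a b. J (a,b)"] sub[OF that]
    by (simp add: A_def)
  define Q where "Q = (\<lambda>s t. integral {x-s..x+s} (\<lambda>\<xi>. J (\<xi>,t)))"
  have Qsc: "Q s t = s * integral (cbox (-1) 1) (\<lambda>\<tau>. J (x + s * \<tau>,t))"
    if "s \<in> ?X" "t \<in> {y-R..y+R}" for s t
    unfolding Q_def using that
    by (subst integral_rescale) (auto intro!: continuous_on_slice(2)[OF J'])
  have scale_in: "x + s * \<tau> \<in> {x-R..x+R}" if "s \<in> ?X" "\<tau> \<in> {-1..1}" for s \<tau>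
  proof -
    have "\<bar>s * \<tau>\<bar> \<le> R * 1" unfolding abs_mult by (rule mult_mono) (use that in auto)
    then show ?thesis by (auto simp: abs_le_iff)
  qed
  have Qc: "continuous_on (?X \<times> {y-R..y+R}) (\<lambda>p. Q (fst p) (snd p))"
  proof -
    let ?W = "?X \<times> {y-R..y+R}"
    have "continuous_on (?W \<times> cbox (-1) 1) (\<lambda>q. J (x + fst (fst q) * snd q, snd (fst q)))"
    proof (rule continuous_on_compose2[OF J'])
      show "continuous_on (?W \<times> cbox (-1) 1) (\<lambda>q. (x + fst (fst q) * snd q, snd (fst q)))"
        by (intro continuous_intros)
      show "(\<lambda>q. (x + fst (fst q) * snd q, snd (fst q))) ` (?W \<times> cbox (-1) 1) \<subseteq> {x-R..x+R} \<times> {y-R..y+R}"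
      proof (intro image_subsetI)
        fix q :: "(real \<times> real) \<times> real" assume "q \<in> ?W \<times> cbox (-1) 1"
        then show "(x + fst (fst q) * snd q, snd (fst q)) \<in> {x-R..x+R} \<times> {y-R..y+R}"
          using scale_in[of "fst (fst q)" "snd q"] by (auto simp: mem_Times_iff)
      qed
    qed
    then have "continuous_on ?W (\<lambda>p. integral (cbox (-1) 1) (\<lambda>\<tau>. J (x + fst p * \<tau>, snd p)))"
      by (intro integral_continuous_on_param) (simp add: split_beta)
    then have "continuous_on ?W (\<lambda>p. fst p * integral (cbox (-1) 1) (\<lambda>\<tau>. J (x + fst p * \<tau>, snd p)))"
      by (intro continuous_on_mult continuous_on_fst continuous_on_id)
    then show ?thesis by (rule continuous_on_eq) (auto simp: Qsc)
  qed
  define q where "q = (\<lambda>s r. Q s (y+r) + Q s (y-r))"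
  have qc: "continuous_on (?X \<times> ?X) (\<lambda>p. q (fst p) (snd p))"
    unfolding q_def
  proof (intro continuous_on_add)
    have "continuous_on (?X \<times> ?X) (\<lambda>p. Q (fst (fst p, y + snd p)) (snd (fst p, y + snd p)))"
      by (rule continuous_on_compose2[OF Qc]) (auto intro!: continuous_intros)
    then show "continuous_on (?X \<times> ?X) (\<lambda>p. Q (fst p) (y + snd p))" by simp
    have "continuous_on (?X \<times> ?X) (\<lambda>p. Q (fst (fst p, y - snd p)) (snd (fst p, y - snd p)))"
      by (rule continuous_on_compose2[OF Qc]) (auto intro!: continuous_intros)
    then show "continuous_on (?X \<times> ?X) (\<lambda>p. Q (fst p) (y - snd p))" by simp
  qed
  have Qslice: "continuous_on {y-R..y+R} (Q s)" if "s \<in> ?X" for s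
  proof -
    have "continuous_on {y-R..y+R} (\<lambda>t. Q (fst (s,t)) (snd (s,t)))"
      by (rule continuous_on_compose2[OF Qc]) (use that in \<open>auto intro!: continuous_intros\<close>)
    then show ?thesis by simp
  qed
  have Ar: "((\<lambda>r. A s r) has_real_derivative q s r) (at r)" if "s \<in> ?X" "r \<in> ?X" for s r
  proof -
    have "((\<lambda>r. integral {y-r..y+r} (Q s)) has_real_derivative q s r) (at r)"
      unfolding q_def by (rule symmetric_integral_derivative[OF Qslice]) (use that in auto)
    then show ?thesis
      by (rule has_field_derivative_transform_within_open[where S = ?X])
        (use that in \<open>auto simp: A2 Q_def\<close>)
  qed
  have As: "((\<lambda>s. A s r) has_real_derivative
      (integral {y-r..y+r} (\<lambda>t. J (x+r,t)) + integral {y-r..y+r} (\<lambda>t. J (x-r,t)))) (at r)"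
    unfolding A_def
  proof (rule symmetric_integral_derivative[of x R])
    have "continuous_on {x-R..x+R} (\<lambda>\<xi>. integral (cbox (y-r) (y+r)) (\<lambda>t. J (\<xi>,t)))"
      by (rule integral_continuous_on_param) (use r in \<open>auto intro: continuous_on_subset[OF J']\<close>)
    then show "continuous_on {x-R..x+R} (\<lambda>\<xi>. integral {y-r..y+r} (\<lambda>t. J (\<xi>,t)))" by simp
  qed (use r in auto)
  let ?a = "integral {y-r..y+r} (\<lambda>t. J (x+r,t)) + integral {y-r..y+r} (\<lambda>t. J (x-r,t))"
  have rX: "r \<in> ?X" using r by auto
  have P: "((\<lambda>(s, r). A s r) has_derivative (\<lambda>(ts, tr). ?a * ts + blinfun_mult_right (q r r) tr)) (at (r, r) within ?X \<times> ?X)"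
  proof (rule has_derivative_partialsI[where f = A and fx = "\<lambda>ts. ?a * ts"
        and fy = "\<lambda>s r. blinfun_mult_right (q s r)"])
    show "((\<lambda>s. A s r) has_derivative (\<lambda>ts. ?a * ts)) (at r within ?X)"
      using As by (auto simp: has_field_derivative_def intro: has_derivative_at_withinI)
    show "((\<lambda>r. A s r) has_derivative blinfun_apply (blinfun_mult_right (q s r))) (at r within ?X)"
      if "s \<in> ?X" "r \<in> ?X" for s r
      using Ar[OF that] by (auto simp: has_field_derivative_def intro: has_derivative_at_withinI)
    have "continuous_on (?X \<times> ?X) (\<lambda>p. blinfun_mult_right (q (fst p) (snd p)))"
      by (intro bounded_linear.continuous_on[OF bounded_linear_blinfun_mult_right] qc)
    then show "continuous (at (r, r) within ?X \<times> ?X) (\<lambda>(s, r). blinfun_mult_right (q s r))"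
      using rX by (simp add: continuous_on_eq_continuous_within case_prod_unfold)
    show "r \<in> ?X" by (rule rX)
    show "convex ?X" by simp
  qed
  have opX: "at (r, r) within ?X \<times> ?X = at (r, r)" 
    using rX by (intro at_within_open) (auto intro: open_Times)
  have "((\<lambda>r. (r, r)) has_derivative (\<lambda>h. (h, h))) (at r)" by (auto intro!: derivative_eq_intros)
  from has_derivative_compose[OF this P[unfolded opX]]
  have "((\<lambda>r. A r r) has_real_derivative (?a + q r r)) (at r)"
    by (auto simp: has_field_derivative_def algebra_simps elim!: has_derivative_eq_rhs)
  then have "((\<lambda>r. integral (sq z r) J) has_real_derivative (?a + q r r)) (at r)"
    by (rule has_field_derivative_transform_within_open[where S = ?X]) (use rX A1 in auto)
  moreover have "?a + q r r = boundary_integral J z r"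
    unfolding boundary_integral_def z q_def Q_def fst_conv snd_conv
    using r by (subst (1 2) integral_add)
      (auto intro!: integrable_continuous_interval continuous_on_slice[OF J'])
  ultimately show ?thesis by simp
qed

section \<open>Functions with a saddle-shaped Hessian\<close>

lemma enlarge_square:
  assumes "open S" "sq z r \<subseteq> S"
  obtains e where "e > 0" "sq z (r + e) \<subseteq> S"
proof -
  have "compact (sq z r)" by (simp add: sq_cbox compact_cbox)
  then obtain e where e: "e > 0" "(\<Union>p\<in>sq z r. cball p e) \<subseteq> S"
    using compact_subset_open_imp_cball_epsilon_subset assms by metis
  show thesis
  proof (cases "r \<ge> 0")
    case False
    then have "sq z (r + (-r/2)) = {}" by (auto simp: sq_def)
    then show thesis using False that[of "-r/2"] by auto
  next
    case True
    have "sq z (r + e/2) \<subseteq> S"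
    proof
      fix q assume q: "q \<in> sq z (r + e/2)"
      \<comment> \<open>clamping both coordinates yields a nearby point of the smaller square\<close>
    define cl where "cl = (\<lambda>a t::real. max (a - r) (min (a + r) t))"
      let ?p = "(cl (fst z) (fst q), cl (snd z) (snd q))"
      have "?p \<in> sq z r" using True by (auto simp: sq_def cl_def)
      moreover have "dist ?p q \<le> e"
      proof -
        have "dist ?p q \<le> \<bar>fst ?p - fst q\<bar> + \<bar>snd ?p - snd q\<bar>"
          unfolding dist_prod_def using sqrt_sum_squares_le_sum_abs by (simp add: dist_real_def)
        also have "\<dots> \<le> e/2 + e/2"
          using q True e by (intro add_mono) (auto simp: sq_def cl_def abs_if max_def min_def mem_Times_iff)
        finally show ?thesis by simp
      qed
      ultimately have "q \<in> (\<Union>p\<in>sq z r. cball p e)" by (intro UN_I[of ?p]) auto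
      then show "q \<in> S" using e(2) by blast
    qed
    then show thesis using e(1) that[of "e/2"] by auto
  qed
qed

text \<open>A \<open>C\<^sup>2\<close> function \<open>w\<close> with its first and second partial derivatives, whose Hessian lies in the cone
  of saddles with eccentricity \<open>K\<close>. Both inequalities bound the squared norm of a row of the Hessian
  by \<open>K\<close> times minus its determinant, so that the gradient of \<open>w\<close> is an orientation reversing
  quasiregular map.\<close>

locale saddle_function =
  fixes K :: real and S :: "(real \<times> real) set" and w wx wy wxx wxy wyy :: "real \<times> real \<Rightarrow> real"
  assumes K_ge_1: "1 \<le> K"
    and C1_w: "C1_fun S w wx wy" and C1_wx: "C1_fun S wx wxx wxy" and C1_wy: "C1_fun S wy wxy wyy"
    and cone_x: "p \<in> S \<Longrightarrow> (wxx p)\<^sup>2 + (wxy p)\<^sup>2 \<le> K * ((wxy p)\<^sup>2 - wxx p * wyy p)"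
    and cone_y: "p \<in> S \<Longrightarrow> (wxy p)\<^sup>2 + (wyy p)\<^sup>2 \<le> K * ((wxy p)\<^sup>2 - wxx p * wyy p)"
begin

text \<open>Minus the determinant of the Hessian.\<close>

definition J :: "real \<times> real \<Rightarrow> real"
  where "J p = (wxy p)\<^sup>2 - wxx p * wyy p"

lemmas C1D = C1_funD[OF C1_w] C1_funD[OF C1_wx] C1_funD[OF C1_wy]

lemma cont: "continuous_on S w" "continuous_on S wx" "continuous_on S wy" "continuous_on S wxx"
  "continuous_on S wxy" "continuous_on S wyy" "continuous_on S J"
proof -
  have "J = (\<lambda>p. (wxy p)\<^sup>2 - wxx p * wyy p)" by (auto simp: J_def)
  then show "continuous_on S J" using C1D by (auto intro!: continuous_intros)
qed (use C1D in auto)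

lemma J_nonneg: "p \<in> S \<Longrightarrow> 0 \<le> J p"
proof -
  assume "p \<in> S"
  then have "0 \<le> K * J p" using cone_x[of p] unfolding J_def by (smt (verit) zero_le_power2)
  then show "0 \<le> J p" using K_ge_1 by (simp add: zero_le_mult_iff)
qed

lemma cone_J:
  assumes "p \<in> S"
  shows "(wxx p)\<^sup>2 + (wxy p)\<^sup>2 \<le> K * J p" "(wxy p)\<^sup>2 + (wyy p)\<^sup>2 \<le> K * J p"
  using cone_x[OF assms] cone_y[OF assms] by (simp_all add: J_def)

text \<open>Green's formula turns the left-hand side into a line integral of \<open>(wx - c) d(wy)\<close>. The constant
  \<open>c\<close> is the mean of the values of \<open>wx\<close> at the lower left and the upper right corner, so that
  \<open>two_edge_arc_bound\<close> applies to each of the two arcs between these corners.\<close>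

lemma J_integral_le_boundary:
  assumes sub: "sq z r \<subseteq> S" and r: "0 \<le> r"
  shows "integral (sq z r) J \<le> r * K * boundary_integral J z r"
proof -
  obtain x y where z: "z = (x,y)" by (cases z)
  have sub': "{x-r..x+r} \<times> {y-r..y+r} \<subseteq> S" using sub by (simp add: sq_def z)
  have in1: "(s,t) \<in> S" if "s \<in> {x-r..x+r}" "t \<in> {y-r..y+r}" for s t using sub' that by auto
  have in2: "(t,y-r) \<in> S" "(t,y+r) \<in> S" if "t \<in> {x-r..x+r}" for t
    using in1[OF that, of "y-r"] in1[OF that, of "y+r"] r by auto
  have in3: "(x-r,t) \<in> S" "(x+r,t) \<in> S" if "t \<in> {y-r..y+r}" for t
    using in1[of "x-r" t] in1[of "x+r" t] that r by auto
  note sl = continuous_on_slice[OF cont(4)] continuous_on_slice[OF cont(5)] continuous_on_slice[OF cont(6)]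
    continuous_on_slice[OF cont(7)]
  define c where "c = (wx (x-r,y-r) + wx (x+r,y+r)) / 2"
  let ?B = "integral {x-r..x+r} (\<lambda>t. (wx (t,y-r) - c) * wxy (t,y-r))"
  let ?T = "integral {x-r..x+r} (\<lambda>t. (wx (t,y+r) - c) * wxy (t,y+r))"
  let ?L = "integral {y-r..y+r} (\<lambda>t. (wx (x-r,t) - c) * wyy (x-r,t))"
  let ?R = "integral {y-r..y+r} (\<lambda>t. (wx (x+r,t) - c) * wyy (x+r,t))"
  have C1c: "C1_fun S (\<lambda>p. wx p - c) wxx wxy"
    using C1_fun_lincomb[OF C1_wx C1_wx, of 1 0 "-c"] by simp
  have "integral (sq z r) (\<lambda>p. wxx p * wyy p - wxy p * wxy p) = ?R - ?L - ?T + ?B"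
    using green_rectangle[OF C1c C1_wy _ _ sub'] r by (simp add: sq_cbox z)
  moreover have "integral (sq z r) J = - integral (sq z r) (\<lambda>p. wxx p * wyy p - wxy p * wxy p)"
    unfolding integral_neg[symmetric] by (simp add: J_def[abs_def] power2_eq_square)
  ultimately have 1: "integral (sq z r) J = (?L + ?T) - (?B + ?R)" by simp
  have 2: "\<bar>?B + ?R\<bar> \<le> r * (integral {x-r..x+r} (\<lambda>t. (wxx (t,y-r))\<^sup>2 + (wxy (t,y-r))\<^sup>2) +
      integral {y-r..y+r} (\<lambda>t. (wxy (x+r,t))\<^sup>2 + (wyy (x+r,t))\<^sup>2))"
    by (rule two_edge_arc_bound)
      (use r in2 in3 in \<open>auto simp: c_def intro!: sl C1_fun_partial_x[OF C1_wx] C1_fun_partial_y[OF C1_wx]\<close>)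
  have 3: "\<bar>?L + ?T\<bar> \<le> r * (integral {y-r..y+r} (\<lambda>t. (wxy (x-r,t))\<^sup>2 + (wyy (x-r,t))\<^sup>2) +
      integral {x-r..x+r} (\<lambda>t. (wxx (t,y+r))\<^sup>2 + (wxy (t,y+r))\<^sup>2))"
    by (rule two_edge_arc_bound)
      (use r in2 in3 in \<open>auto simp: c_def intro!: sl C1_fun_partial_x[OF C1_wx] C1_fun_partial_y[OF C1_wx]\<close>)
  have h: "integral {x-r..x+r} (\<lambda>t. (wxx (t,v))\<^sup>2 + (wxy (t,v))\<^sup>2) \<le> K * integral {x-r..x+r} (\<lambda>t. J (t,v))"
    if "v = y - r \<or> v = y + r" for v
    unfolding integral_mult_right[symmetric]
    by (rule integral_le; (intro integrable_continuous_interval continuous_intros)?)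
      (use that in2 cone_J in \<open>auto intro!: sl\<close>)
  have v: "integral {y-r..y+r} (\<lambda>t. (wxy (v,t))\<^sup>2 + (wyy (v,t))\<^sup>2) \<le> K * integral {y-r..y+r} (\<lambda>t. J (v,t))"
    if "v = x - r \<or> v = x + r" for v
    unfolding integral_mult_right[symmetric]
    by (rule integral_le; (intro integrable_continuous_interval continuous_intros)?)
      (use that in3 cone_J in \<open>auto intro!: sl\<close>)
  have "integral (sq z r) J \<le> \<bar>?L + ?T\<bar> + \<bar>?B + ?R\<bar>" unfolding 1 by linarith
  also have "\<dots> \<le> r * (K * integral {y-r..y+r} (\<lambda>t. J (x-r,t)) + K * integral {x-r..x+r} (\<lambda>t. J (t,y+r))) +
     r * (K * integral {x-r..x+r} (\<lambda>t. J (t,y-r)) + K * integral {y-r..y+r} (\<lambda>t. J (x+r,t)))"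
    by (intro add_mono order_trans[OF 2] order_trans[OF 3] mult_left_mono h v r) auto
  also have "\<dots> = r * K * boundary_integral J z r"
    unfolding boundary_integral_def z fst_conv snd_conv
    using in2 in3 by (subst (1 2) integral_add)
      (auto intro!: integrable_continuous_interval sl simp: algebra_simps)
  finally show ?thesis .
qed

text \<open>The preceding inequality says that the integral over the square of half side \<open>r\<close>, divided by
  \<open>r powr (1 / K)\<close>, is nondecreasing in \<open>r\<close>.\<close>

lemma J_integral_decay:
  assumes sub: "sq z r0 \<subseteq> S" and r: "0 < r" "r \<le> r0"
  shows "integral (sq z r) J \<le> (r / r0) powr (1 / K) * integral (sq z r0) J"
proof -
  obtain e where e: "e > 0" "sq z (r0 + e) \<subseteq> S"
    using enlarge_square[OF C1D(1) sub] .
  have cJ: "continuous_on (sq z (r0 + e)) J" using continuous_on_subset[OF cont(7) e(2)] .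
  let ?D = "\<lambda>t. integral (sq z t) J"
  have "r powr (- (1/K)) * ?D r \<le> r0 powr (- (1/K)) * ?D r0"
  proof (rule DERIV_nonneg_imp_nondecreasing[OF r(2)])
    fix t assume t: "r \<le> t" "t \<le> r0"
    then have t0: "0 < t" using r by simp
    let ?d = "(- (1/K)) * t powr (- (1/K) - 1) * ?D t + t powr (- (1/K)) * boundary_integral J z t"
    have "((\<lambda>t. t powr (- (1/K)) * ?D t) has_real_derivative ?d) (at t)"
      using has_real_derivative_powr[OF t0, of "-(1/K)"] square_integral_derivative[OF cJ t0] t e t0
      by (auto intro!: derivative_eq_intros)
    moreover have "?d = t powr (- (1/K) - 1) * (t * boundary_integral J z t - ?D t / K)"
    proof -
      have "t powr (- (1/K)) = t powr (- (1/K) - 1) * t"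
        using t0 by (simp add: powr_diff)
      then show ?thesis by (simp only: algebra_simps) (simp add: algebra_simps)
    qed
    moreover have "0 \<le> t powr (- (1/K) - 1) * (t * boundary_integral J z t - ?D t / K)"
    proof -
      have "sq z t \<subseteq> S" using sub t by (force simp: sq_def)
      from J_integral_le_boundary[OF this] t0 have "?D t \<le> t * K * boundary_integral J z t" by simp
      then have "?D t / K \<le> t * boundary_integral J z t" using K_ge_1 by (simp add: field_simps)
      then show ?thesis by simp
    qed
    ultimately show "\<exists>y. ((\<lambda>t. t powr (- (1/K)) * ?D t) has_real_derivative y) (at t) \<and> 0 \<le> y" by metis
  qed
  then have "r powr (1/K) * (r powr (- (1/K)) * ?D r) \<le> r powr (1/K) * (r0 powr (- (1/K)) * ?D r0)"
    by (rule mult_left_mono) simp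
  then show ?thesis using r by (simp add: powr_minus powr_divide field_simps)
qed
end

section \<open>The energy estimate\<close>

lemma four_mult_le_weighted:
  fixes X Y a :: real
  assumes "0 < a"
  shows "4 * (X * Y) \<le> X\<^sup>2 / a + 4 * a * Y\<^sup>2"
proof -
  have "0 \<le> (X - 2 * a * Y)\<^sup>2 / a" using assms by simp
  also have "\<dots> = X\<^sup>2 / a + 4 * a * Y\<^sup>2 - 4 * (X * Y)"
    using assms by (simp add: power2_eq_square field_simps)
  finally show ?thesis by simp
qed

text \<open>A polynomial that vanishes on the boundary of the square \<open>sq z R\<close> and is at most one inside,
  followed by its two partial derivatives.\<close>

definition cutoff :: "real \<times> real \<Rightarrow> real \<Rightarrow> real \<times> real \<Rightarrow> real"
  where "cutoff z R p = (1 - ((fst p - fst z) / R)\<^sup>2) * (1 - ((snd p - snd z) / R)\<^sup>2)"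

definition cutoff_x :: "real \<times> real \<Rightarrow> real \<Rightarrow> real \<times> real \<Rightarrow> real"
  where "cutoff_x z R p = (- 2 * ((fst p - fst z) / R) / R) * (1 - ((snd p - snd z) / R)\<^sup>2)"

definition cutoff_y :: "real \<times> real \<Rightarrow> real \<Rightarrow> real \<times> real \<Rightarrow> real"
  where "cutoff_y z R p = (1 - ((fst p - fst z) / R)\<^sup>2) * (- 2 * ((snd p - snd z) / R) / R)"

lemma C1_fun_cutoff:
  assumes "R > 0" "open S"
  shows "C1_fun S (cutoff z R) (cutoff_x z R) (cutoff_y z R)"
proof -
  have "(cutoff z R has_derivative (\<lambda>h. cutoff_x z R p * fst h + cutoff_y z R p * snd h)) (at p)" for p
    unfolding cutoff_def[abs_def] cutoff_x_def cutoff_y_def using assms(1)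
    by (auto intro!: derivative_eq_intros simp: field_simps power2_eq_square)
  moreover have "continuous_on S (cutoff_x z R)" "continuous_on S (cutoff_y z R)"
    unfolding cutoff_x_def[abs_def] cutoff_y_def[abs_def] using assms(1) by (auto intro!: continuous_intros)
  ultimately show ?thesis using assms unfolding C1_fun_def by auto
qed

lemma C1_fun_power:
  assumes "C1_fun S f fx fy"
  shows "C1_fun S (\<lambda>p. f p ^ n) (\<lambda>p. real n * f p ^ (n - 1) * fx p) (\<lambda>p. real n * f p ^ (n - 1) * fy p)"
proof -
  note D = C1_funD[OF assms]
  have "((\<lambda>p. f p ^ n) has_derivative
     (\<lambda>h. (real n * f p ^ (n - 1) * fx p) * fst h + (real n * f p ^ (n - 1) * fy p) * snd h)) (at p)" if "p \<in> S" for p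
    using has_derivative_power[OF D(5)[OF that], of n] by (auto elim!: has_derivative_eq_rhs simp: algebra_simps)
  then show ?thesis using D unfolding C1_fun_def by (auto intro!: continuous_intros)
qed

lemma cutoff_bounds:
  assumes R: "R > 0" and p: "p \<in> sq z R"
  shows "0 \<le> cutoff z R p" "cutoff z R p \<le> 1" "\<bar>cutoff_x z R p\<bar> \<le> 2 / R" "\<bar>cutoff_y z R p\<bar> \<le> 2 / R"
proof -
  define a b where "a = (fst p - fst z) / R" and "b = (snd p - snd z) / R"
  have ab: "\<bar>a\<bar> \<le> 1" "\<bar>b\<bar> \<le> 1"
    using p R by (auto simp: a_def b_def sq_def abs_le_iff divide_simps mem_Times_iff)
  then have ab2: "a\<^sup>2 \<le> 1" "b\<^sup>2 \<le> 1" by (simp_all add: abs_square_le_1)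
  show "0 \<le> cutoff z R p" unfolding cutoff_def using ab2 by (simp add: a_def b_def)
  show "cutoff z R p \<le> 1" unfolding cutoff_def a_def[symmetric] b_def[symmetric]
    using ab2 by (intro mult_le_one) auto
  have "\<bar>a\<bar> * (1 - b\<^sup>2) \<le> 1" "(1 - a\<^sup>2) * \<bar>b\<bar> \<le> 1"
    using ab ab2 by (intro mult_le_one; simp)+
  then have "2 * (\<bar>a\<bar> * (1 - b\<^sup>2)) / R \<le> 2 / R" "2 * ((1 - a\<^sup>2) * \<bar>b\<bar>) / R \<le> 2 / R"
    using R by (auto intro!: divide_right_mono)
  moreover have "\<bar>cutoff_x z R p\<bar> = 2 * (\<bar>a\<bar> * (1 - b\<^sup>2)) / R" "\<bar>cutoff_y z R p\<bar> = 2 * ((1 - a\<^sup>2) * \<bar>b\<bar>) / R"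
    unfolding cutoff_x_def cutoff_y_def a_def[symmetric] b_def[symmetric]
    using R ab2 by (auto simp: abs_mult)
  ultimately show "\<bar>cutoff_x z R p\<bar> \<le> 2 / R" "\<bar>cutoff_y z R p\<bar> \<le> 2 / R" by auto
qed

lemma cutoff_boundary:
  assumes "R > 0"
  shows "cutoff z R (fst z + R, t) = 0" "cutoff z R (fst z - R, t) = 0"
    "cutoff z R (t, snd z + R) = 0" "cutoff z R (t, snd z - R) = 0"
  using assms by (auto simp: cutoff_def)

lemma cutoff_half:
  assumes R: "R > 0" and p: "p \<in> sq z (R/2)"
  shows "1 / 10 \<le> cutoff z R p ^ 4"
proof -
  define a b where "a = (fst p - fst z) / R" and "b = (snd p - snd z) / R"
  have "\<bar>a\<bar> \<le> 1/2" "\<bar>b\<bar> \<le> 1/2"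
    using p R by (auto simp: a_def b_def sq_def abs_if divide_simps mem_Times_iff)
  then have "a\<^sup>2 \<le> (1/2)\<^sup>2" "b\<^sup>2 \<le> (1/2)\<^sup>2" by (auto simp: abs_le_square_iff[symmetric])
  then have "3/4 * (3/4) \<le> (1 - a\<^sup>2) * (1 - b\<^sup>2)"
    by (intro mult_mono) (auto simp: power2_eq_square)
  \<comment> \<open>\<open>(9/16)\<^sup>4\<close> is slightly more than \<open>1/10\<close>\<close>
  then have "(9/16) ^ 4 \<le> cutoff z R p ^ 4"
    unfolding cutoff_def a_def[symmetric] b_def[symmetric] by (intro power_mono) auto
  then show ?thesis by (simp add: power4_eq_xxxx)
qed

lemma C1_fun_snd: "open S \<Longrightarrow> C1_fun S snd (\<lambda>_. 0) (\<lambda>_. 1)"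
  unfolding C1_fun_def by (auto intro!: derivative_eq_intros)

context saddle_function
begin

text \<open>Caccioppoli's inequality. With \<open>g\<close> the cutoff function, \<open>E\<close> the integral of \<open>g\<^sup>4 J\<close> and \<open>P\<close> the
  integral of \<open>g\<^sup>2 wx\<^sup>2\<close>, Green's formula for the pair \<open>g\<^sup>4 wx, wy\<close> bounds \<open>E\<close> by \<open>P\<close>, and for the pair
  \<open>g\<^sup>2 w wx, y\<close> it bounds \<open>P\<close> by a small multiple of \<open>E\<close> plus a multiple of \<open>M\<^sup>2\<close>.\<close>

theorem energy_bound:
  assumes sub: "sq z R \<subseteq> S" and R: "0 < R" and M: "\<And>p. p \<in> sq z R \<Longrightarrow> \<bar>w p\<bar> \<le> M"
  shows "integral (sq z (R/2)) J \<le> (81920 * K * (32 * K\<^sup>2 + 2) / R\<^sup>2) * M\<^sup>2"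
proof -
  let ?Q = "sq z R"
  have sub': "{fst z - R..fst z + R} \<times> {snd z - R..snd z + R} \<subseteq> S" using sub by (simp add: sq_def)
  define g gx gy where "g = cutoff z R" and "gx = cutoff_x z R" and "gy = cutoff_y z R"
  define L where "L = 2 / R"
  have L: "0 < L" using R by (simp add: L_def)
  note oS = C1D(1)
  have C1g: "C1_fun S g gx gy" unfolding g_def gx_def gy_def by (rule C1_fun_cutoff[OF R oS])
  note Cg = C1_funD[OF C1g]
  note cc = cont Cg(2-4)
  have gb: "0 \<le> g p" "g p \<le> 1" "\<bar>gx p\<bar> \<le> L" "\<bar>gy p\<bar> \<le> L" if "p \<in> ?Q" for p
    using cutoff_bounds[OF R that] by (auto simp: g_def gx_def gy_def L_def)
  have bd: "g (fst z + R, t) = 0" "g (fst z - R, t) = 0" "g (t, snd z + R) = 0" "g (t, snd z - R) = 0" for t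
    using cutoff_boundary[OF R] by (auto simp: g_def)
  have int: "h integrable_on ?Q" if "continuous_on S h" for h :: "real \<times> real \<Rightarrow> real"
    unfolding sq_cbox by (rule integrable_continuous, rule continuous_on_subset[OF that])
      (use sub in \<open>simp add: sq_cbox\<close>)
  define E where "E = integral ?Q (\<lambda>p. g p ^ 4 * J p)"
  define P where "P = integral ?Q (\<lambda>p. (g p)\<^sup>2 * (wx p)\<^sup>2)"
  have E_int: "((\<lambda>p. g p ^ 4 * J p) has_integral E) ?Q"
    unfolding E_def by (intro integrable_integral int continuous_intros cc)
  have P_int: "((\<lambda>p. (g p)\<^sup>2 * (wx p)\<^sup>2) has_integral P) ?Q"
    unfolding P_def by (intro integrable_integral int continuous_intros cc)
  let ?h1 = "\<lambda>p. wx p * (4 * g p ^ 3 * gx p * wyy p - 4 * g p ^ 3 * gy p * wxy p)"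
  let ?h2 = "\<lambda>p. 2 * g p * gx p * w p * wx p + (g p)\<^sup>2 * (wx p)\<^sup>2 + (g p)\<^sup>2 * w p * wxx p"
  \<comment> \<open>the two integral identities; all boundary terms vanish with the cutoff function\<close>
  have id1: "((\<lambda>p. ?h1 p - g p ^ 4 * J p) has_integral 0) ?Q"
  proof -
    have "integral ?Q (\<lambda>p. (real 4 * g p ^ (4 - 1) * gx p * wx p + g p ^ 4 * wxx p) * wyy p
        - (real 4 * g p ^ (4 - 1) * gy p * wx p + g p ^ 4 * wxy p) * wxy p) = 0"
      unfolding sq_cbox
      using green_rectangle[OF C1_fun_mult[OF C1_fun_power[OF C1g, of 4] C1_wx] C1_wy _ _ sub'] R
      by (simp add: bd)
    moreover have "(real 4 * g p ^ (4 - 1) * gx p * wx p + g p ^ 4 * wxx p) * wyy p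
        - (real 4 * g p ^ (4 - 1) * gy p * wx p + g p ^ 4 * wxy p) * wxy p = ?h1 p - g p ^ 4 * J p" for p
      by (simp add: J_def power2_eq_square algebra_simps)
    ultimately have "integral ?Q (\<lambda>p. ?h1 p - g p ^ 4 * J p) = 0" by simp
    moreover have "(\<lambda>p. ?h1 p - g p ^ 4 * J p) integrable_on ?Q"
      by (intro int continuous_intros cc)
    ultimately show ?thesis by (simp only: has_integral_integrable_integral simp_thms)
  qed
  have id2: "(?h2 has_integral 0) ?Q"
  proof -
    have "integral ?Q (\<lambda>p. ((real 2 * g p ^ (2 - 1) * gx p * w p + (g p)\<^sup>2 * wx p) * wx p + (g p)\<^sup>2 * w p * wxx p) * 1
        - ((real 2 * g p ^ (2 - 1) * gy p * w p + (g p)\<^sup>2 * wy p) * wx p + (g p)\<^sup>2 * w p * wxy p) * 0) = 0"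
      unfolding sq_cbox
      using green_rectangle[OF C1_fun_mult[OF C1_fun_mult[OF C1_fun_power[OF C1g, of 2] C1_w] C1_wx] C1_fun_snd[OF oS] _ _ sub'] R
      by (simp add: bd)
    moreover have "((real 2 * g p ^ (2 - 1) * gx p * w p + (g p)\<^sup>2 * wx p) * wx p + (g p)\<^sup>2 * w p * wxx p) * 1
        - ((real 2 * g p ^ (2 - 1) * gy p * w p + (g p)\<^sup>2 * wy p) * wx p + (g p)\<^sup>2 * w p * wxy p) * 0 = ?h2 p" for p
      by (simp add: power2_eq_square algebra_simps)
    ultimately have "integral ?Q ?h2 = 0" by simp
    moreover have "?h2 integrable_on ?Q"
      by (intro int continuous_intros cc)
    ultimately show ?thesis by (simp only: has_integral_integrable_integral simp_thms)
  qed
  have K0: "0 < K" using K_ge_1 by simp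
  have pw1: "?h1 p \<le> 1/2 * (g p ^ 4 * J p) + 16 * K * L\<^sup>2 * ((g p)\<^sup>2 * (wx p)\<^sup>2)" if p: "p \<in> ?Q" for p
  proof -
    let ?s = "\<bar>wyy p\<bar> + \<bar>wxy p\<bar>"
    have pS: "p \<in> S" using p sub by auto
    have "?h1 p \<le> \<bar>?h1 p\<bar>" by simp
    also have "\<dots> \<le> \<bar>wx p\<bar> * (4 * g p ^ 3 * L * \<bar>wyy p\<bar> + 4 * g p ^ 3 * L * \<bar>wxy p\<bar>)"
      unfolding abs_mult
    proof (rule mult_left_mono)
      have "\<bar>4 * g p ^ 3 * gx p * wyy p\<bar> \<le> 4 * g p ^ 3 * L * \<bar>wyy p\<bar>"
        "\<bar>4 * g p ^ 3 * gy p * wxy p\<bar> \<le> 4 * g p ^ 3 * L * \<bar>wxy p\<bar>"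
        unfolding abs_mult using gb[OF p] by (auto intro!: mult_mono)
      then show "\<bar>4 * g p ^ 3 * gx p * wyy p - 4 * g p ^ 3 * gy p * wxy p\<bar>
          \<le> 4 * g p ^ 3 * L * \<bar>wyy p\<bar> + 4 * g p ^ 3 * L * \<bar>wxy p\<bar>" by linarith
    qed simp
    also have "\<dots> = 4 * (((g p)\<^sup>2 * ?s) * (L * g p * \<bar>wx p\<bar>))"
      by (simp add: power2_eq_square power3_eq_cube algebra_simps)
    also have "\<dots> \<le> ((g p)\<^sup>2 * ?s)\<^sup>2 / (4 * K) + 4 * (4 * K) * (L * g p * \<bar>wx p\<bar>)\<^sup>2"
      by (rule four_mult_le_weighted) (use K0 in simp)
    also have "((g p)\<^sup>2 * ?s)\<^sup>2 / (4 * K) \<le> 1/2 * (g p ^ 4 * J p)"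
    proof -
      have "?s\<^sup>2 \<le> 2 * ((wyy p)\<^sup>2 + (wxy p)\<^sup>2)"
        using zero_le_power2[of "\<bar>wyy p\<bar> - \<bar>wxy p\<bar>"] by (simp add: power2_diff power2_sum)
      also have "\<dots> \<le> 2 * (K * J p)" using cone_J(2)[OF pS] by simp
      finally have "g p ^ 4 * ?s\<^sup>2 \<le> g p ^ 4 * (2 * (K * J p))"
        by (rule mult_left_mono) simp
      moreover have "((g p)\<^sup>2 * ?s)\<^sup>2 = g p ^ 4 * ?s\<^sup>2"
        by (simp add: power_mult_distrib flip: power_mult)
      ultimately show ?thesis using K0 by (simp add: field_simps)
    qed
    finally show ?thesis by (simp add: power_mult_distrib algebra_simps)
  qed
  \<comment> \<open>large enough for half of \<open>E\<close> to be absorbed when the two inequalities are combined\<close>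
  define b where "b = 32 * K\<^sup>2 * L\<^sup>2"
  have b0: "0 < b" using K0 L by (simp add: b_def)
  have pw2: "(g p)\<^sup>2 * (wx p)\<^sup>2 - ?h2 p \<le> 1/2 * ((g p)\<^sup>2 * (wx p)\<^sup>2) + K / (4 * b) * (g p ^ 4 * J p) + (b + 2 * L\<^sup>2) * M\<^sup>2"
    if p: "p \<in> ?Q" for p
  proof -
    have pS: "p \<in> S" using p sub by auto
    have w2: "(w p)\<^sup>2 \<le> M\<^sup>2" using M[OF p] by (simp add: abs_le_square_iff[symmetric])
    have "- (2 * g p * gx p * w p * wx p) = 4 * ((- (gx p * w p)) * (g p * wx p / 2))" by simp
    also have "\<dots> \<le> (- (gx p * w p))\<^sup>2 / (1/2) + 4 * (1/2) * (g p * wx p / 2)\<^sup>2"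
      by (rule four_mult_le_weighted) simp
    also have "\<dots> = 2 * ((gx p)\<^sup>2 * (w p)\<^sup>2) + 1/2 * ((g p)\<^sup>2 * (wx p)\<^sup>2)" by (simp add: power_mult_distrib power_divide)
    also have "(gx p)\<^sup>2 * (w p)\<^sup>2 \<le> L\<^sup>2 * M\<^sup>2"
      using gb[OF p] w2 L by (intro mult_mono) (auto simp: abs_le_square_iff[symmetric])
    finally have 1: "- (2 * g p * gx p * w p * wx p) \<le> 2 * (L\<^sup>2 * M\<^sup>2) + 1/2 * ((g p)\<^sup>2 * (wx p)\<^sup>2)" by simp
    have "- ((g p)\<^sup>2 * w p * wxx p) = 4 * (((g p)\<^sup>2 * wxx p) * (- w p / 4))" by simp
    also have "\<dots> \<le> ((g p)\<^sup>2 * wxx p)\<^sup>2 / (4 * b) + 4 * (4 * b) * (- w p / 4)\<^sup>2"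
      by (rule four_mult_le_weighted) (use b0 in simp)
    also have "\<dots> = (g p ^ 4 * (wxx p)\<^sup>2) / (4 * b) + b * (w p)\<^sup>2"
      by (simp add: power_mult_distrib power_divide flip: power_mult)
    also have "\<dots> \<le> (g p ^ 4 * (K * J p)) / (4 * b) + b * M\<^sup>2"
      using cone_J(1)[OF pS] w2 b0
      by (intro add_mono divide_right_mono mult_left_mono) (auto intro: order_trans[rotated])
    finally have 2: "- ((g p)\<^sup>2 * w p * wxx p) \<le> K / (4 * b) * (g p ^ 4 * J p) + b * M\<^sup>2"
      by (simp add: algebra_simps)
    show ?thesis using 1 2 by (simp add: algebra_simps)
  qed
  define V where "V = 4 * R\<^sup>2 * ((b + 2 * L\<^sup>2) * M\<^sup>2)"
  have Vint: "((\<lambda>p. (b + 2 * L\<^sup>2) * M\<^sup>2) has_integral V) ?Q"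
    unfolding sq_cbox V_def
    using has_integral_const[of "(b + 2 * L\<^sup>2) * M\<^sup>2" "(fst z - R, snd z - R)" "(fst z + R, snd z + R)"] R
    by (simp add: content_Pair power2_eq_square)
  have "E \<le> 1/2 * E + 16 * K * L\<^sup>2 * P"
  proof (rule has_integral_le)
    show "(?h1 has_integral E) ?Q"
      using has_integral_add[OF id1 E_int] by simp
    show "((\<lambda>p. 1/2 * (g p ^ 4 * J p) + 16 * K * L\<^sup>2 * ((g p)\<^sup>2 * (wx p)\<^sup>2)) has_integral 1/2 * E + 16 * K * L\<^sup>2 * P) ?Q"
      by (intro has_integral_add has_integral_mult_right E_int P_int)
  qed (rule pw1)
  then have E1: "E \<le> 32 * K * L\<^sup>2 * P" by simp
  have "P \<le> 1/2 * P + K / (4 * b) * E + V"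
  proof (rule has_integral_le)
    show "((\<lambda>p. (g p)\<^sup>2 * (wx p)\<^sup>2 - ?h2 p) has_integral P) ?Q"
      using has_integral_diff[OF P_int id2] by simp
    show "((\<lambda>p. 1/2 * ((g p)\<^sup>2 * (wx p)\<^sup>2) + K / (4 * b) * (g p ^ 4 * J p) + (b + 2 * L\<^sup>2) * M\<^sup>2)
        has_integral 1/2 * P + K / (4 * b) * E + V) ?Q"
      by (intro has_integral_add has_integral_mult_right E_int P_int Vint)
  qed (rule pw2)
  then have P1: "P \<le> K / (2 * b) * E + 2 * V" by simp
  have "E \<le> 32 * K * L\<^sup>2 * (K / (2 * b) * E + 2 * V)"
    using E1 P1 K0 by (intro order_trans[OF E1] mult_left_mono) auto
  also have "\<dots> = 1/2 * E + 64 * K * L\<^sup>2 * V"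
    using K0 L by (simp add: b_def field_simps power2_eq_square)
  finally have "E \<le> 128 * K * L\<^sup>2 * V" by simp
  also have "\<dots> = (8192 * K * (32 * K\<^sup>2 + 2) / R\<^sup>2) * M\<^sup>2"
    using R by (simp add: V_def b_def L_def power_divide field_simps power2_eq_square)
  finally have Efin: "E \<le> (8192 * K * (32 * K\<^sup>2 + 2) / R\<^sup>2) * M\<^sup>2" .
  have hs: "sq z (R/2) \<subseteq> ?Q" using R by (intro sq_subset_sq) auto
  have "1/10 * integral (sq z (R/2)) J \<le> integral (sq z (R/2)) (\<lambda>p. g p ^ 4 * J p)"
    unfolding integral_mult_right[symmetric]
  proof (rule integral_le)
    show "(\<lambda>p. 1/10 * J p) integrable_on sq z (R/2)" "(\<lambda>p. g p ^ 4 * J p) integrable_on sq z (R/2)"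
      unfolding sq_cbox using sub hs
      by (intro integrable_continuous continuous_intros continuous_on_subset[OF cont(7)] continuous_on_subset[OF Cg(2)];
          simp add: sq_cbox)+
    show "1/10 * J p \<le> g p ^ 4 * J p" if "p \<in> sq z (R/2)" for p
      using cutoff_half[OF R that] J_nonneg[of p] that hs sub unfolding g_def by (intro mult_right_mono) auto
  qed
  also have "\<dots> \<le> E" unfolding E_def
  proof (rule integral_subset_le[OF hs])
    show "(\<lambda>p. g p ^ 4 * J p) integrable_on sq z (R/2)"
      unfolding sq_cbox using sub hs
      by (intro integrable_continuous continuous_intros continuous_on_subset[OF cont(7)] continuous_on_subset[OF Cg(2)];
          simp add: sq_cbox)+
    show "(\<lambda>p. g p ^ 4 * J p) integrable_on ?Q" using E_int by blast
    show "\<forall>p\<in>?Q. 0 \<le> g p ^ 4 * J p" using J_nonneg sub by (auto simp: subset_iff)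
  qed
  finally have "integral (sq z (R/2)) J \<le> 10 * E" by simp
  also have "\<dots> \<le> 10 * ((8192 * K * (32 * K\<^sup>2 + 2) / R\<^sup>2) * M\<^sup>2)" using Efin by simp
  also have "\<dots> = (81920 * K * (32 * K\<^sup>2 + 2) / R\<^sup>2) * M\<^sup>2" using R by (simp add: field_simps)
  finally show ?thesis .
qed

end

section \<open>Hoelder continuity of the gradient\<close>

lemma integral_rescale_square:
  assumes "continuous_on (sq z m) J" "0 < m"
  shows "integral (sq 0 1) (\<lambda>q. J (z + m *\<^sub>R q)) = integral (sq z m) J / m\<^sup>2"
proof -
  have "(J has_integral integral (sq z m) J) (cbox (fst z - m, snd z - m) (fst z + m, snd z + m))"
    using assms(1) unfolding sq_cbox by (intro integrable_integral integrable_continuous)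
  from has_integral_affinity'[OF this assms(2), of z]
  have "((\<lambda>q. J (z + m *\<^sub>R q)) has_integral integral (sq z m) J / m\<^sup>2)
     (cbox (((fst z - m, snd z - m) - z) /\<^sub>R m) (((fst z + m, snd z + m) - z) /\<^sub>R m))"
    by (simp add: add.commute divide_inverse mult.commute power2_eq_square)
  moreover have "((fst z - m, snd z - m) - z) /\<^sub>R m = (-1,-1)" "((fst z + m, snd z + m) - z) /\<^sub>R m = (1,1)"
    using assms(2) by (auto simp: prod_eq_iff)
  ultimately show ?thesis by (simp add: sq_cbox integral_unique)
qed

lemma integral_affine_square:
  fixes g :: "real \<times> real \<Rightarrow> real"
  assumes "continuous_on (cbox (-1,-1) (1,1)) g"
  shows "integral (cbox (-1,-1) (1,1)) (\<lambda>q. a + b * g q) = 4 * a + b * integral (cbox (-1,-1) (1,1)) g"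
proof -
  have "integral (cbox (-1,-1) (1,1)) (\<lambda>q. a + b * g q) =
      integral (cbox (-1,-1) (1,1)) (\<lambda>q::real\<times>real. a) + integral (cbox (-1,-1) (1,1)) (\<lambda>q. b * g q)"
    by (intro integral_add integrable_continuous continuous_intros assms)
  then show ?thesis by (simp add: content_Pair)
qed

text \<open>Morrey's growth lemma. The mean of \<open>f\<close> over the square with centre \<open>z + s e\<close> and half side \<open>s h\<close>
  is differentiated along \<open>0 \<le> s \<le> 1\<close>; it starts at \<open>f z\<close> and ends at the mean over the square with
  centre \<open>z + e\<close> and half side \<open>h\<close>. The points \<open>z\<close> and \<open>z + 2 e\<close> are compared through the
  same final square.\<close>

lemma morrey_ray:
  fixes e :: "real \<times> real"
  assumes f: "C1_fun S f fx fy" and cJ: "continuous_on S J"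
    and dom: "\<And>p. p \<in> S \<Longrightarrow> (fx p)\<^sup>2 + (fy p)\<^sup>2 \<le> K * J p" and K: "0 \<le> K"
    and h: "0 < h" "\<bar>fst e\<bar> \<le> h" "\<bar>snd e\<bar> \<le> h" and k: "0 < k" and B: "0 < B"
    and sub: "\<And>s. 0 \<le> s \<Longrightarrow> s \<le> 1 \<Longrightarrow> sq (z + s *\<^sub>R e) (s * h) \<subseteq> S"
    and growth: "\<And>s. 0 < s \<Longrightarrow> s \<le> 1 \<Longrightarrow> integral (sq (z + s *\<^sub>R e) (s * h)) J \<le> B\<^sup>2 * (s * h) powr k"
  shows "\<bar>f z - integral (sq 0 1) (\<lambda>q. f (z + e + h *\<^sub>R q)) / 4\<bar> \<le> B * (2 + K) / k * h powr (k / 2)"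
proof -
  note D = C1_funD[OF f]
  let ?Q = "cbox (-1,-1) (1,1) :: (real \<times> real) set"
  have Q: "sq 0 1 = ?Q" by (simp add: sq_cbox)
  define c where "c = (\<lambda>s q. z + s *\<^sub>R (e + h *\<^sub>R q))"
  have c_in: "c s q \<in> S" if "s \<in> {0..1}" "q \<in> ?Q" for s q
  proof -
    have "\<bar>s * (h * fst q)\<bar> \<le> s * h" "\<bar>s * (h * snd q)\<bar> \<le> s * h"
      using that h unfolding abs_mult
      by (auto simp: cbox_Pair_eq mem_Times_iff abs_le_iff intro!: mult_left_mono mult_left_le)
    then have "c s q \<in> sq (z + s *\<^sub>R e) (s * h)"
      by (auto simp: c_def sq_def mem_Times_iff abs_le_iff algebra_simps)
    then show ?thesis using sub[of s] that by auto
  qed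
  have c_cont: "continuous_on T (\<lambda>x. c (fst x) (snd x))" for T
    unfolding c_def by (intro continuous_intros)
  have c_cont': "continuous_on T (c s)" for T s
    unfolding c_def by (intro continuous_intros)
  define F' where "F' = (\<lambda>s q. fx (c s q) * (fst e + h * fst q) + fy (c s q) * (snd e + h * snd q))"
  define b where "b = (\<lambda>s. integral ?Q (\<lambda>q. f (c s q)))"
  have cF': "continuous_on ({0..1} \<times> ?Q) (\<lambda>(s, q). F' s q)"
    unfolding F'_def split_beta
    by (intro continuous_intros continuous_on_compose2[OF D(3) c_cont] continuous_on_compose2[OF D(4) c_cont])
      (use c_in in auto)
  have der: "(b has_real_derivative integral ?Q (F' s)) (at s within {0..1})" if "s \<in> {0..1}" for s
    unfolding b_def
  proof (rule leibniz_rule_field_derivative[OF _ _ cF' that])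
    fix s q assume sq: "s \<in> {0..1::real}" "q \<in> ?Q"
    have "((\<lambda>s. f (fst z + s * (fst e + h * fst q), snd z + s * (snd e + h * snd q))) has_real_derivative F' s q) (at s within {0..1})"
      unfolding F'_def c_def
    proof (rule C1_fun_path[OF f, THEN DERIV_cong])
      show "((\<lambda>s. fst z + s * (fst e + h * fst q)) has_real_derivative (fst e + h * fst q)) (at s within {0..1})"
        "((\<lambda>s. snd z + s * (snd e + h * snd q)) has_real_derivative (snd e + h * snd q)) (at s within {0..1})"
        by (auto intro!: derivative_eq_intros)
      show "(fst z + s * (fst e + h * fst q), snd z + s * (snd e + h * snd q)) \<in> S"
        using c_in[OF sq] by (cases z; cases e; cases q) (simp add: c_def)
    qed (cases z; cases e; cases q; simp)
    then show "((\<lambda>s. f (c s q)) has_real_derivative F' s q) (at s within {0..1})"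
      unfolding c_def by (cases z; cases e; cases q) simp
  next
    fix s assume s: "s \<in> {0..1::real}"
    show "(\<lambda>q. f (c s q)) integrable_on ?Q"
      by (intro integrable_continuous continuous_on_compose2[OF D(2) c_cont']) (use c_in s in auto)
  qed simp
  define A where "A = 2 * B * (2 + K) * h powr (k / 2)"
  have bound: "\<bar>integral ?Q (F' s)\<bar> \<le> A * s powr (k / 2 - 1)" if s: "0 < s" "s \<le> 1" for s
  proof -
    define m where "m = s * h"
    have m: "0 < m" using s h by (simp add: m_def)
    \<comment> \<open>the weight that balances the two terms of the inequality \<open>2 X \<le> th + X\<^sup>2 / th\<close>\<close>
    define th where "th = B * m powr (k / 2 - 1)"
    have th: "0 < th" using B m by (simp add: th_def)
    have s01: "s \<in> {0..1}" using s by auto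
    have subm: "sq (z + s *\<^sub>R e) m \<subseteq> S" using sub[of s] s by (simp add: m_def)
    have pw: "norm (F' s q) \<le> h * th + 2 * h * K / th * J (z + s *\<^sub>R e + m *\<^sub>R q)" if q: "q \<in> ?Q" for q
    proof -
      have ceq: "c s q = z + s *\<^sub>R e + m *\<^sub>R q" by (simp add: c_def m_def algebra_simps)
      let ?X = "\<bar>fx (c s q)\<bar> + \<bar>fy (c s q)\<bar>"
      have q': "\<bar>fst q\<bar> \<le> 1" "\<bar>snd q\<bar> \<le> 1" using q by (auto simp: cbox_Pair_eq mem_Times_iff)
      have "\<bar>h * fst q\<bar> \<le> h" "\<bar>h * snd q\<bar> \<le> h"
        unfolding abs_mult using h q' by (auto intro!: mult_left_le)
      then have "\<bar>fst e + h * fst q\<bar> \<le> 2 * h" "\<bar>snd e + h * snd q\<bar> \<le> 2 * h"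
        using h by linarith+
      then have "norm (F' s q) \<le> \<bar>fx (c s q)\<bar> * (2 * h) + \<bar>fy (c s q)\<bar> * (2 * h)"
        unfolding F'_def real_norm_def
        by (intro order_trans[OF abs_triangle_ineq] add_mono) (auto simp: abs_mult intro!: mult_left_mono)
      also have "\<dots> = h * (2 * ?X)" by (simp add: algebra_simps)
      also have "2 * ?X \<le> th + ?X\<^sup>2 / th"
        using zero_le_power2[of "?X - th"] th by (simp add: field_simps power2_eq_square)
      also have "?X\<^sup>2 / th \<le> (2 * (K * J (c s q))) / th"
      proof (rule divide_right_mono)
        have "?X\<^sup>2 \<le> 2 * ((fx (c s q))\<^sup>2 + (fy (c s q))\<^sup>2)"
          using zero_le_power2[of "\<bar>fx (c s q)\<bar> - \<bar>fy (c s q)\<bar>"] by (simp add: power2_diff power2_sum)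
        also have "\<dots> \<le> 2 * (K * J (c s q))" using dom[OF c_in[OF s01 q]] by simp
        finally show "?X\<^sup>2 \<le> 2 * (K * J (c s q))" .
      qed (use th in simp)
      finally show ?thesis using h unfolding ceq by (simp add: algebra_simps)
    qed
    have Jc: "continuous_on ?Q (\<lambda>q. J (z + s *\<^sub>R e + m *\<^sub>R q))"
    proof -
      have "continuous_on ?Q (\<lambda>q. J (c s q))"
        by (rule continuous_on_compose2[OF cJ c_cont']) (use c_in s01 in auto)
      moreover have "c s q = z + s *\<^sub>R e + m *\<^sub>R q" for q by (simp add: c_def m_def algebra_simps)
      ultimately show ?thesis by simp
    qed
    have F'c: "continuous_on ?Q (F' s)"
      unfolding F'_def
      by (intro continuous_intros continuous_on_compose2[OF D(3) c_cont'] continuous_on_compose2[OF D(4) c_cont'])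
        (use c_in s01 in auto)
    have "norm (integral ?Q (F' s)) \<le> integral ?Q (\<lambda>q. h * th + 2 * h * K / th * J (z + s *\<^sub>R e + m *\<^sub>R q))"
    proof (rule integral_norm_bound_integral)
      show "F' s integrable_on ?Q" "(\<lambda>q. h * th + 2 * h * K / th * J (z + s *\<^sub>R e + m *\<^sub>R q)) integrable_on ?Q"
        by (intro integrable_continuous F'c continuous_intros Jc)+
    qed (rule pw)
    also have "\<dots> = 4 * (h * th) + 2 * h * K / th * integral ?Q (\<lambda>q. J (z + s *\<^sub>R e + m *\<^sub>R q))"
      by (rule integral_affine_square[OF Jc])
    also have "integral ?Q (\<lambda>q. J (z + s *\<^sub>R e + m *\<^sub>R q)) = integral (sq (z + s *\<^sub>R e) m) J / m\<^sup>2"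
      unfolding Q[symmetric] by (rule integral_rescale_square[OF continuous_on_subset[OF cJ subm] m])
    also have "2 * h * K / th * (integral (sq (z + s *\<^sub>R e) m) J / m\<^sup>2) \<le> 2 * h * K / th * (th\<^sup>2)"
    proof (rule mult_left_mono)
      have "integral (sq (z + s *\<^sub>R e) m) J \<le> B\<^sup>2 * m powr k" using growth[OF s] by (simp add: m_def)
      also have "\<dots> = th\<^sup>2 * m\<^sup>2"
      proof -
        have "(m powr (k / 2 - 1))\<^sup>2 * m\<^sup>2 = m powr k"
        proof -
          have "(m powr (k / 2 - 1))\<^sup>2 = m powr (k - 2)"
            by (simp add: power2_eq_square flip: powr_add)
          moreover have "m powr (k - 2) * m powr 2 = m powr k" by (simp flip: powr_add)
          ultimately show ?thesis using m by simp
        qed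
        then show ?thesis by (simp add: th_def power_mult_distrib algebra_simps)
      qed
      finally show "integral (sq (z + s *\<^sub>R e) m) J / m\<^sup>2 \<le> th\<^sup>2" using m by (simp add: field_simps)
    qed (use h K th in auto)
    finally have "\<bar>integral ?Q (F' s)\<bar> \<le> 4 * (h * th) + 2 * h * K * th"
      using th by (simp add: power2_eq_square)
    also have "\<dots> = 2 * B * (2 + K) * (h * h powr (k / 2 - 1)) * s powr (k / 2 - 1)"
      using s h by (simp add: th_def m_def powr_mult algebra_simps)
    also have "h * h powr (k / 2 - 1) = h powr (k / 2)" using h by (simp add: powr_diff)
    finally show ?thesis by (simp add: A_def)
  qed
  have mono: "\<sigma> * b 0 \<le> \<sigma> * b 1 + A * (2 / k)" if \<sigma>: "\<bar>\<sigma>\<bar> = 1" for \<sigma> :: real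
  proof -
    let ?g = "\<lambda>s. \<sigma> * b s + A * (2 / k) * s powr (k / 2)"
    have "?g 0 \<le> ?g 1"
    proof (rule DERIV_nonneg_imp_increasing_open[where f = ?g])
      fix s :: real assume s: "0 < s" "s < 1"
      have "at s within {0..1} = at s" using at_within_interior[of s "{0..1}"] s by auto
      then have "(b has_real_derivative integral ?Q (F' s)) (at s)" using der[of s] s by simp
      then have "(?g has_real_derivative (\<sigma> * integral ?Q (F' s) + A * (2 / k) * ((k / 2) * s powr (k / 2 - 1)))) (at s)"
        using s by (auto intro!: derivative_eq_intros has_real_derivative_powr)
      moreover have "0 \<le> \<sigma> * integral ?Q (F' s) + A * (2 / k) * ((k / 2) * s powr (k / 2 - 1))"
      proof -
        have "\<bar>\<sigma> * integral ?Q (F' s)\<bar> \<le> A * s powr (k / 2 - 1)"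
          using bound[of s] s \<sigma> by (simp add: abs_mult)
        then show ?thesis using k by (simp add: abs_le_iff)
      qed
      ultimately show "\<exists>y. (?g has_real_derivative y) (at s) \<and> 0 \<le> y" by blast
    next
      have "continuous_on {0..1} b" by (rule DERIV_continuous_on[OF der])
      then show "continuous_on {0..1} ?g"
        using k by (auto intro!: continuous_intros continuous_on_powr')
    qed simp
    then show ?thesis by simp
  qed
  have b0: "b 0 = 4 * f z" by (simp add: b_def c_def content_Pair)
  have b1: "b 1 = integral (sq 0 1) (\<lambda>q. f (z + e + h *\<^sub>R q))" by (simp add: b_def c_def Q add.assoc)
  have "\<bar>b 0 - b 1\<bar> \<le> A * (2 / k)" using mono[of 1] mono[of "-1"] by (simp add: abs_le_iff)
  moreover have "b 0 - b 1 = 4 * (f z - b 1 / 4)" by (simp add: b0)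
  ultimately have "4 * \<bar>f z - b 1 / 4\<bar> \<le> A * (2 / k)" by (simp only: abs_mult abs_numeral)
  then have "\<bar>f z - b 1 / 4\<bar> \<le> A * (2 / k) / 4"
    by (subst pos_le_divide_eq) (simp_all only: mult.commute zero_less_numeral)
  also have "A * (2 / k) / 4 = B * (2 + K) / k * h powr (k / 2)"
    using k by (simp add: A_def field_simps)
  finally show ?thesis unfolding b1 .
qed

text \<open>The constant in the Hoelder estimate for the gradient on the square of half side \<open>R / 4\<close>. The
  square root contains the constant of \<open>energy_bound\<close>.\<close>

definition hoelder_const :: "real \<Rightarrow> real \<Rightarrow> real"
  where "hoelder_const K R = 2 * K * (2 + K) * sqrt (81920 * K * (32 * K\<^sup>2 + 2) / R\<^sup>2) * (4 / R) powr (1 / (2 * K))"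

context saddle_function
begin

lemma J_integral_mono:
  assumes "sq z s \<subseteq> sq p r" "sq p r \<subseteq> S"
  shows "integral (sq z s) J \<le> integral (sq p r) J"
proof (rule integral_subset_le[OF assms(1)])
  have "sq z s \<subseteq> S" using assms by blast
  then show "J integrable_on sq z s" "J integrable_on sq p r"
    using assms unfolding sq_cbox by (auto intro!: integrable_continuous continuous_on_subset[OF cont(7)])
qed (use assms J_nonneg in blast)

text \<open>The function \<open>f\<close> will be \<open>wx\<close> or \<open>wy\<close>.\<close>

lemma hoelder_of_dominated_gradient:
  assumes f: "C1_fun S f fx fy" and dom: "\<And>p. p \<in> S \<Longrightarrow> (fx p)\<^sup>2 + (fy p)\<^sup>2 \<le> K * J p"
    and sub: "sq p R \<subseteq> S" and R: "0 < R" and M: "\<And>q. q \<in> sq p R \<Longrightarrow> \<bar>w q\<bar> \<le> M" and M0: "0 < M"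
    and a: "a \<in> sq p (R/4)" and b: "b \<in> sq p (R/4)"
  shows "\<bar>f a - f b\<bar> \<le> hoelder_const K R * M * dist a b powr (1 / (2 * K))"
proof (cases "a = b")
  case True
  then show ?thesis using K_ge_1 M0 by (simp add: hoelder_const_def)
next
  case False
  have K0: "0 < K" using K_ge_1 by simp
  define E where "E = (81920 * K * (32 * K\<^sup>2 + 2) / R\<^sup>2)"
  have E0: "0 < E" using K0 R by (simp add: E_def add_nonneg_pos)
  have Eb: "integral (sq p (R/2)) J \<le> E * M\<^sup>2"
    using energy_bound[OF sub R M] by (simp add: E_def)
  define B where "B = sqrt E * M * (4 / R) powr (1 / (2 * K))"
  have B0: "0 < B" using E0 M0 R by (simp add: B_def)
  have B2: "B\<^sup>2 = E * M\<^sup>2 * (4 / R) powr (1 / K)"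
  proof -
    have "((4 / R) powr (1 / (2 * K)))\<^sup>2 = (4 / R) powr (1 / K)" 
      by (simp add: power2_eq_square flip: powr_add)
    then show ?thesis using E0 by (simp add: B_def power_mult_distrib)
  qed
  have half: "sq p (R/2) \<subseteq> S" using sub R sq_subset_sq[of p p "R/2" R] by auto
  have growth: "integral (sq z r) J \<le> B\<^sup>2 * r powr (1 / K)" if z: "z \<in> sq p (R/4)" and r: "0 < r" "r \<le> R/4" for z r
  proof -
    have zsub: "sq z (R/4) \<subseteq> sq p (R/2)"
      using z by (intro sq_subset_sq) (auto simp: sq_def mem_Times_iff abs_if)
    have "integral (sq z r) J \<le> (r / (R/4)) powr (1 / K) * integral (sq z (R/4)) J"
      by (rule J_integral_decay) (use zsub half r in auto)
    also have "\<dots> \<le> (r / (R/4)) powr (1 / K) * (E * M\<^sup>2)"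
      using J_integral_mono[OF zsub half] Eb by (intro mult_left_mono) auto
    also have "r / (R/4) = r * (4 / R)" by simp
    also have "(r * (4 / R)) powr (1 / K) = r powr (1 / K) * (4 / R) powr (1 / K)"
      using r R by (intro powr_mult) 
    finally show ?thesis by (simp add: B2 algebra_simps)
  qed
  define e where "e = (1/2) *\<^sub>R (b - a)"
  define h where "h = max \<bar>fst e\<bar> \<bar>snd e\<bar>"
  have h0: "0 < h" using False by (auto simp: h_def e_def prod_eq_iff less_max_iff_disj)
  have "\<bar>fst b - fst a\<bar> \<le> R/2" "\<bar>snd b - snd a\<bar> \<le> R/2"
    using a b by (auto simp: sq_def mem_Times_iff abs_if)
  then have "\<bar>fst e\<bar> \<le> R/4" "\<bar>snd e\<bar> \<le> R/4"
    by (auto simp: e_def abs_mult)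
  then have hR: "h \<le> R/4" by (simp add: h_def)
  have mid: "z + s *\<^sub>R ((1/2) *\<^sub>R (z' - z)) \<in> sq p (R/4)"
    if "z \<in> sq p (R/4)" "z' \<in> sq p (R/4)" "0 \<le> s" "s \<le> 1" for z z' s
  proof -
    have "z + s *\<^sub>R ((1/2) *\<^sub>R (z' - z)) = (1 - s/2) *\<^sub>R z + (s/2) *\<^sub>R z'"
      by (simp add: algebra_simps scaleR_diff_right flip: scaleR_add_left)
    moreover have "convex (sq p (R/4))" by (simp add: sq_cbox)
    ultimately show ?thesis using that convexD[of "sq p (R/4)" z z' "1 - s/2" "s/2"] by auto
  qed
  have ray: "\<bar>f z - integral (sq 0 1) (\<lambda>q. f (z + d + h *\<^sub>R q)) / 4\<bar> \<le> B * (2 + K) / (1 / K) * h powr (1 / K / 2)"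
    if z: "z \<in> sq p (R/4)" "z' \<in> sq p (R/4)" and d: "d = (1/2) *\<^sub>R (z' - z)" "\<bar>fst d\<bar> \<le> h" "\<bar>snd d\<bar> \<le> h" for z z' d
  proof -
    have m: "z + s *\<^sub>R d \<in> sq p (R/4)" if "0 \<le> s" "s \<le> 1" for s
      unfolding d using mid[OF z that] .
    have sh: "s * h \<le> R/4" if "0 \<le> s" "s \<le> 1" for s
      using mult_left_le_one_le[of h s] that h0 hR by linarith
    have "sq (z + s *\<^sub>R d) (s * h) \<subseteq> sq p (R/2)" if "0 \<le> s" "s \<le> 1" for s
      using m[OF that] sh[OF that] by (intro sq_subset_sq) (auto simp: sq_def mem_Times_iff abs_if)
    then have "sq (z + s *\<^sub>R d) (s * h) \<subseteq> S" if "0 \<le> s" "s \<le> 1" for s using half that by blast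
    moreover have "integral (sq (z + s *\<^sub>R d) (s * h)) J \<le> B\<^sup>2 * (s * h) powr (1 / K)" if "0 < s" "s \<le> 1" for s
      using growth[OF m _ sh] that h0 by simp
    ultimately show ?thesis
      by (intro morrey_ray[OF f cont(7) dom _ h0 d(2,3) _ B0]) (use K0 in auto)
  qed
  define G where "G = B * (2 + K) / (1 / K) * h powr (1 / K / 2)"
  have "a + e = b + (- e)" by (simp add: e_def prod_eq_iff field_simps)
  moreover have "\<bar>f a - integral (sq 0 1) (\<lambda>q. f (a + e + h *\<^sub>R q)) / 4\<bar> \<le> G" unfolding G_def
    by (rule ray[OF a b]) (auto simp: e_def h_def)
  moreover have "\<bar>f b - integral (sq 0 1) (\<lambda>q. f (b + (- e) + h *\<^sub>R q)) / 4\<bar> \<le> G" unfolding G_def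
    by (rule ray[OF b a]) (auto simp: e_def h_def scaleR_diff_right)
  ultimately have "\<bar>f a - f b\<bar> \<le> 2 * G" by (auto simp: abs_le_iff)
  also have "\<dots> = hoelder_const K R * M * h powr (1 / (2 * K))"
    by (simp add: G_def B_def hoelder_const_def E_def field_simps)
  also have "\<dots> \<le> hoelder_const K R * M * dist a b powr (1 / (2 * K))"
  proof (intro mult_left_mono powr_mono2)
    have "\<bar>fst e\<bar> \<le> norm e" "\<bar>snd e\<bar> \<le> norm e"
      using norm_fst_le[of "fst e" "snd e"] norm_snd_le[of "snd e" "fst e"] by auto
    moreover have "norm e \<le> dist a b" by (simp add: e_def dist_norm norm_minus_commute)
    ultimately show "h \<le> dist a b" by (auto simp: h_def)
  qed (use K0 M0 h0 in \<open>auto simp: hoelder_const_def\<close>)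
  finally show ?thesis .
qed

end

text \<open>The constant in the bound of the gradient at the centre of a square of half side \<open>R\<close>.\<close>

definition gradient_const :: "real \<Rightarrow> real \<Rightarrow> real"
  where "gradient_const K R = 8 / R + hoelder_const K R * (R / 4) powr (1 / (2 * K))"

lemma hoelder_const_nonneg: "1 \<le> K \<Longrightarrow> 0 < R \<Longrightarrow> 0 \<le> hoelder_const K R"
  by (simp add: hoelder_const_def)

lemma gradient_const_pos: "1 \<le> K \<Longrightarrow> 0 < R \<Longrightarrow> 0 < gradient_const K R"
  unfolding gradient_const_def using hoelder_const_nonneg[of K R]
  by (intro add_pos_nonneg mult_nonneg_nonneg) auto

context saddle_function
begin

theorem gradient_hoelder:
  assumes "sq p R \<subseteq> S" "0 < R" "\<And>q. q \<in> sq p R \<Longrightarrow> \<bar>w q\<bar> \<le> M" "0 < M"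
    and "a \<in> sq p (R/4)" "b \<in> sq p (R/4)"
  shows "\<bar>wx a - wx b\<bar> \<le> hoelder_const K R * M * dist a b powr (1 / (2 * K))"
    and "\<bar>wy a - wy b\<bar> \<le> hoelder_const K R * M * dist a b powr (1 / (2 * K))"
  using hoelder_of_dominated_gradient[OF C1_wx cone_J(1) assms]
    hoelder_of_dominated_gradient[OF C1_wy cone_J(2) assms] by auto

text \<open>By the mean value theorem, each partial derivative is at most \<open>8 M / R\<close> at some point at distance
  at most \<open>R / 4\<close> from the centre; the Hoelder estimate carries the bound to the centre.\<close>

theorem gradient_bound:
  assumes sub: "sq p R \<subseteq> S" and R: "0 < R" and M: "\<And>q. q \<in> sq p R \<Longrightarrow> \<bar>w q\<bar> \<le> M" and M0: "0 < M"
  shows "\<bar>wx p\<bar> \<le> gradient_const K R * M" "\<bar>wy p\<bar> \<le> gradient_const K R * M"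
proof -
  obtain x y where p: "p = (x, y)" by (cases p)
  have pin: "p \<in> sq p (R/4)" using R by (auto simp: sq_def mem_Times_iff)
  have key: "\<bar>f p\<bar> \<le> gradient_const K R * M"
    if q: "q \<in> sq p (R/4)" "dist p q \<le> R/4" and e: "(R/4) * \<bar>f q\<bar> \<le> 2 * M"
      and h: "\<bar>f p - f q\<bar> \<le> hoelder_const K R * M * dist p q powr (1 / (2 * K))" for f :: "real \<times> real \<Rightarrow> real" and q
  proof -
    have "\<bar>f q\<bar> \<le> 8 / R * M" using e R by (simp add: field_simps)
    moreover have "hoelder_const K R * M * dist p q powr (1 / (2 * K)) \<le> hoelder_const K R * M * (R / 4) powr (1 / (2 * K))"
      using q(2) K_ge_1 M0 R hoelder_const_nonneg[of K R] by (intro mult_left_mono powr_mono2) auto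
    ultimately have "\<bar>f p\<bar> \<le> 8 / R * M + hoelder_const K R * M * (R / 4) powr (1 / (2 * K))"
      using h by linarith
    then show ?thesis by (simp add: gradient_const_def algebra_simps)
  qed
  have diff: "\<bar>w a - w b\<bar> \<le> 2 * M" if "a \<in> sq p R" "b \<in> sq p R" for a b
    using M[OF that(1)] M[OF that(2)] by linarith
  have inx: "(s, y) \<in> S" if "x \<le> s" "s \<le> x + R/4" for s using sub that R by (auto simp: sq_def p subset_iff)
  have iny: "(x, s) \<in> S" if "y \<le> s" "s \<le> y + R/4" for s using sub that R by (auto simp: sq_def p subset_iff)
  have "\<exists>s>x. s < x + R/4 \<and> w (x + R/4, y) - w (x, y) = (x + R/4 - x) * wx (s, y)"
    by (rule MVT2) (use R inx in \<open>auto intro!: C1_fun_partial_x[OF C1_w]\<close>)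
  then obtain s where s: "x < s" "s < x + R/4" "w (x + R/4, y) - w (x, y) = R/4 * wx (s, y)" by auto
  have "\<exists>s>y. s < y + R/4 \<and> w (x, y + R/4) - w (x, y) = (y + R/4 - y) * wy (x, s)"
    by (rule MVT2) (use R iny in \<open>auto intro!: C1_fun_partial_y[OF C1_w]\<close>)
  then obtain t where t: "y < t" "t < y + R/4" "w (x, y + R/4) - w (x, y) = R/4 * wy (x, t)" by auto
  show "\<bar>wx p\<bar> \<le> gradient_const K R * M"
  proof (rule key)
    show q: "(s, y) \<in> sq p (R/4)" using s R by (auto simp: sq_def p)
    show "dist p (s, y) \<le> R/4" using s by (simp add: p dist_Pair_Pair dist_real_def)
    have "\<bar>R/4 * wx (s, y)\<bar> \<le> 2 * M" unfolding s(3)[symmetric] using R by (intro diff) (auto simp: sq_def p)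
    then show "R/4 * \<bar>wx (s, y)\<bar> \<le> 2 * M" using R by (simp add: abs_mult)
    show "\<bar>wx p - wx (s, y)\<bar> \<le> hoelder_const K R * M * dist p (s, y) powr (1 / (2 * K))"
      by (rule gradient_hoelder(1)[OF sub R M M0 pin q])
  qed
  show "\<bar>wy p\<bar> \<le> gradient_const K R * M"
  proof (rule key)
    show q: "(x, t) \<in> sq p (R/4)" using t R by (auto simp: sq_def p)
    show "dist p (x, t) \<le> R/4" using t by (simp add: p dist_Pair_Pair dist_real_def)
    have "\<bar>R/4 * wy (x, t)\<bar> \<le> 2 * M" unfolding t(3)[symmetric] using R by (intro diff) (auto simp: sq_def p)
    then show "R/4 * \<bar>wy (x, t)\<bar> \<le> 2 * M" using R by (simp add: abs_mult)
    show "\<bar>wy p - wy (x, t)\<bar> \<le> hoelder_const K R * M * dist p (x, t) powr (1 / (2 * K))"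
      by (rule gradient_hoelder(2)[OF sub R M M0 pin q])
  qed
qed

end


section \<open>Difference quotients and the Hessian\<close>

lemma C1_fun_difference_quotient_limit:
  assumes "C1_fun S f fx fy" "a \<in> S"
  shows "((\<lambda>t. (f (a + t *\<^sub>R d) - f a) / t) \<longlongrightarrow> fx a * fst d + fy a * snd d) (at_right 0)"
proof -
  have "((\<lambda>t. f (fst a + t * fst d, snd a + t * snd d)) has_real_derivative
     (fx (fst a + 0 * fst d, snd a + 0 * snd d) * fst d + fy (fst a + 0 * fst d, snd a + 0 * snd d) * snd d)) (at 0)"
    by (rule C1_fun_path[OF assms(1)]) (use assms(2) in \<open>auto intro!: derivative_eq_intros\<close>)
  moreover have "a + t *\<^sub>R d = (fst a + t * fst d, snd a + t * snd d)" for t by (simp add: prod_eq_iff)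
  ultimately have "((\<lambda>t. f (a + t *\<^sub>R d)) has_real_derivative (fx a * fst d + fy a * snd d)) (at 0)" by simp
  then have "((\<lambda>t. (f (a + t *\<^sub>R d) - f a) / t) \<longlongrightarrow> fx a * fst d + fy a * snd d) (at 0)"
    by (simp add: has_field_derivative_iff)
  then show ?thesis by (rule tendsto_mono[rotated]) (simp add: at_le)
qed

lemma limit_abs_bound:
  fixes g :: "real \<Rightarrow> real"
  assumes "(g \<longlongrightarrow> l) (at_right 0)" "0 < r" "\<And>t. 0 < t \<Longrightarrow> t < r \<Longrightarrow> \<bar>g t\<bar> \<le> B"
  shows "\<bar>l\<bar> \<le> B"
proof (rule tendsto_upperbound[OF tendsto_rabs[OF assms(1)]])
  show "\<forall>\<^sub>F t in at_right 0. \<bar>g t\<bar> \<le> B"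
    using assms(2,3) eventually_at_right_less[of 0] by (auto simp: eventually_at_right_field)
qed simp

text \<open>In addition, the differences of the Hessian at any two points lie in the cone, so that
  every difference quotient of \<open>w\<close> has a saddle-shaped Hessian. This does not follow from the condition
  on the Hessian itself, because the cone is not convex.\<close>

locale saddle_differences = saddle_function +
  assumes diff_cone: "p \<in> S \<Longrightarrow> q \<in> S \<Longrightarrow>
      (wxx p - wxx q)\<^sup>2 + (wxy p - wxy q)\<^sup>2 \<le> K * ((wxy p - wxy q)\<^sup>2 - (wxx p - wxx q) * (wyy p - wyy q)) \<and>
      (wxy p - wxy q)\<^sup>2 + (wyy p - wyy q)\<^sup>2 \<le> K * ((wxy p - wxy q)\<^sup>2 - (wxx p - wxx q) * (wyy p - wyy q))"
begin

lemma difference_quotient_saddle: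
  fixes d :: "real \<times> real"
  assumes t: "0 < t"
  defines "Q \<equiv> \<lambda>f p. (f (p + t *\<^sub>R d) - f p) / t"
  shows "saddle_function K (S \<inter> (\<lambda>p. p + t *\<^sub>R d) -` S) (Q w) (Q wx) (Q wy) (Q wxx) (Q wxy) (Q wyy)"
proof -
  let ?S = "S \<inter> (\<lambda>p. p + t *\<^sub>R d) -` S"
  have C: "C1_fun ?S (Q f) (Q fx) (Q fy)" if "C1_fun S f fx fy" for f fx fy
  proof -
    note sh = C1_fun_shift[OF that, of "t *\<^sub>R d"]
    have op: "open ?S" using C1_funD(1)[OF that] C1_funD(1)[OF sh] by (rule open_Int)
    have "C1_fun ?S (\<lambda>p. (1/t) * f (p + t *\<^sub>R d) + (-1/t) * f p + 0)
       (\<lambda>p. (1/t) * fx (p + t *\<^sub>R d) + (-1/t) * fx p) (\<lambda>p. (1/t) * fy (p + t *\<^sub>R d) + (-1/t) * fy p)"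
      by (intro C1_fun_lincomb C1_fun_subset[OF sh] C1_fun_subset[OF that] op) auto
    then show ?thesis unfolding Q_def by (simp add: diff_divide_distrib)
  qed
  have scale: "(a / t)\<^sup>2 + (b / t)\<^sup>2 \<le> K * ((b / t)\<^sup>2 - (a / t) * (c / t))"
      "(b / t)\<^sup>2 + (c / t)\<^sup>2 \<le> K * ((b / t)\<^sup>2 - (a / t) * (c / t))"
    if "a\<^sup>2 + b\<^sup>2 \<le> K * (b\<^sup>2 - a * c) \<and> b\<^sup>2 + c\<^sup>2 \<le> K * (b\<^sup>2 - a * c)" for a b c
  proof -
    have "(a / t)\<^sup>2 + (b / t)\<^sup>2 = (a\<^sup>2 + b\<^sup>2) / t\<^sup>2" "(b / t)\<^sup>2 + (c / t)\<^sup>2 = (b\<^sup>2 + c\<^sup>2) / t\<^sup>2"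
      by (simp_all add: power_divide add_divide_distrib)
    moreover have "K * ((b / t)\<^sup>2 - (a / t) * (c / t)) = K * (b\<^sup>2 - a * c) / t\<^sup>2"
      by (simp add: power_divide power2_eq_square flip: diff_divide_distrib)
    ultimately show "(a / t)\<^sup>2 + (b / t)\<^sup>2 \<le> K * ((b / t)\<^sup>2 - (a / t) * (c / t))"
      "(b / t)\<^sup>2 + (c / t)\<^sup>2 \<le> K * ((b / t)\<^sup>2 - (a / t) * (c / t))"
      using that by (simp_all add: divide_right_mono)
  qed
  show ?thesis
  proof
    show "1 \<le> K" by (rule K_ge_1)
    show "C1_fun ?S (Q w) (Q wx) (Q wy)" by (rule C[OF C1_w])
    show "C1_fun ?S (Q wx) (Q wxx) (Q wxy)" by (rule C[OF C1_wx])
    show "C1_fun ?S (Q wy) (Q wxy) (Q wyy)" by (rule C[OF C1_wy])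
    fix p assume "p \<in> ?S"
    then have d: "p + t *\<^sub>R d \<in> S" "p \<in> S" by auto
    show "(Q wxx p)\<^sup>2 + (Q wxy p)\<^sup>2 \<le> K * ((Q wxy p)\<^sup>2 - Q wxx p * Q wyy p)"
      "(Q wxy p)\<^sup>2 + (Q wyy p)\<^sup>2 \<le> K * ((Q wxy p)\<^sup>2 - Q wxx p * Q wyy p)"
      unfolding Q_def by (rule scale[OF diff_cone[OF d]])+
  qed
qed

text \<open>The second derivatives in the direction \<open>d\<close> are limits of the gradients of the difference quotients
  of \<open>w\<close> in the direction \<open>d\<close>. These quotients are bounded by \<open>G\<close>, the bound for the gradient of \<open>w\<close>.\<close>

theorem hessian_estimates:
  fixes d :: "real \<times> real"
  assumes sub: "sq p (2 * R) \<subseteq> S" and R: "0 < R" and M: "\<And>q. q \<in> sq p (2 * R) \<Longrightarrow> \<bar>w q\<bar> \<le> M" and M0: "0 < M"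
    and d: "\<bar>fst d\<bar> + \<bar>snd d\<bar> \<le> 1"
  defines "G \<equiv> gradient_const K (R/2) * M"
  shows "a \<in> sq p (R/4) \<Longrightarrow> b \<in> sq p (R/4) \<Longrightarrow>
      \<bar>(wxx a * fst d + wxy a * snd d) - (wxx b * fst d + wxy b * snd d)\<bar> \<le> hoelder_const K R * G * dist a b powr (1 / (2 * K))"
    and "a \<in> sq p (R/4) \<Longrightarrow> b \<in> sq p (R/4) \<Longrightarrow>
      \<bar>(wxy a * fst d + wyy a * snd d) - (wxy b * fst d + wyy b * snd d)\<bar> \<le> hoelder_const K R * G * dist a b powr (1 / (2 * K))"
    and "\<bar>wxx p * fst d + wxy p * snd d\<bar> \<le> gradient_const K R * G"
    and "\<bar>wxy p * fst d + wyy p * snd d\<bar> \<le> gradient_const K R * G"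
proof -
  have G0: "0 < G" unfolding G_def using gradient_const_pos[OF K_ge_1, of "R/2"] R M0 by simp
  have grad: "\<bar>wx q\<bar> \<le> G" "\<bar>wy q\<bar> \<le> G" if q: "q \<in> sq p (3 * R / 2)" for q
  proof -
    have qs: "sq q (R/2) \<subseteq> sq p (2 * R)"
      using q by (intro sq_subset_sq) (auto simp: sq_def mem_Times_iff abs_if)
    show "\<bar>wx q\<bar> \<le> G" "\<bar>wy q\<bar> \<le> G" unfolding G_def
      by (rule gradient_bound; use qs sub M R M0 in auto)+
  qed
  have d1: "\<bar>fst d\<bar> \<le> 1" "\<bar>snd d\<bar> \<le> 1" using d by linarith+
  have shift: "q + s *\<^sub>R d \<in> sq p (3 * R / 2)" if q: "q \<in> sq p R" and s: "0 \<le> s" "s \<le> R/2" for q s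
  proof -
    have "\<bar>s * fst d\<bar> \<le> R/2 * 1" "\<bar>s * snd d\<bar> \<le> R/2 * 1"
      unfolding abs_mult using s d1 by (intro mult_mono; simp)+
    then show ?thesis using q by (auto simp: sq_def mem_Times_iff abs_le_iff)
  qed
  have big: "sq p (3 * R / 2) \<subseteq> S" using sub sq_subset_sq[of p p "3 * R / 2" "2 * R"] R by auto
  define Q where "Q = (\<lambda>t f p. (f (p + t *\<^sub>R d) - f p) / t)"
  let ?S = "\<lambda>t. S \<inter> (\<lambda>p. p + t *\<^sub>R d) -` S"
  have sad: "saddle_function K (?S t) (Q t w) (Q t wx) (Q t wy) (Q t wxx) (Q t wxy) (Q t wyy)" if "0 < t" for t
    unfolding Q_def by (rule difference_quotient_saddle[OF that])
  have dom: "sq p R \<subseteq> ?S t" if "0 < t" "t < R/2" for t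
  proof
    fix q assume q: "q \<in> sq p R"
    show "q \<in> ?S t" using shift[OF q, of t] shift[OF q, of 0] that big R by auto
  qed
  have Qw: "\<bar>Q t w q\<bar> \<le> G" if t: "0 < t" "t < R/2" and q: "q \<in> sq p R" for t q
  proof -
    have in_big: "q + s *\<^sub>R d \<in> sq p (3 * R / 2)" if "0 \<le> s" "s \<le> t" for s
      using shift[OF q, of s] that t by auto
    let ?w = "\<lambda>s. w (fst q + s * fst d, snd q + s * snd d)"
    have eq: "q + s *\<^sub>R d = (fst q + s * fst d, snd q + s * snd d)" for s by (simp add: prod_eq_iff)
    have "\<exists>s>0. s < t \<and> ?w t - ?w 0 = (t - 0) * (wx (q + s *\<^sub>R d) * fst d + wy (q + s *\<^sub>R d) * snd d)"
    proof (rule MVT2[OF t(1)])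
      fix s assume "0 \<le> s" "s \<le> t"
      then show "(?w has_real_derivative (wx (q + s *\<^sub>R d) * fst d + wy (q + s *\<^sub>R d) * snd d)) (at s)"
        unfolding eq using in_big[of s] big
        by (intro C1_fun_path[OF C1_w]) (auto simp: eq intro!: derivative_eq_intros)
    qed
    then obtain s where s: "0 < s" "s < t" "?w t - ?w 0 = t * (wx (q + s *\<^sub>R d) * fst d + wy (q + s *\<^sub>R d) * snd d)"
      by auto
    have "Q t w q = wx (q + s *\<^sub>R d) * fst d + wy (q + s *\<^sub>R d) * snd d"
      using s(3) t by (simp add: Q_def eq)
    also have "\<bar>\<dots>\<bar> \<le> G * \<bar>fst d\<bar> + G * \<bar>snd d\<bar>"
      using grad[OF in_big[of s]] s
      by (intro order_trans[OF abs_triangle_ineq] add_mono) (auto simp: abs_mult intro!: mult_right_mono)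
    also have "\<dots> = G * (\<bar>fst d\<bar> + \<bar>snd d\<bar>)" by (simp add: algebra_simps)
    also have "\<dots> \<le> G * 1" using d G0 by (intro mult_left_mono) auto
    finally show ?thesis by simp
  qed
  have R2: "0 < R/2" using R by simp
  have inS: "a \<in> S" if "a \<in> sq p (R/4)" for a
    using that big R sq_subset_sq[of p p "R/4" "3 * R / 2"] by auto
  note lim = C1_fun_difference_quotient_limit[OF C1_wx, of _ d] C1_fun_difference_quotient_limit[OF C1_wy, of _ d]
  {
    assume a: "a \<in> sq p (R/4)" and b: "b \<in> sq p (R/4)"
    note est = saddle_function.gradient_hoelder[OF sad dom R Qw G0 a b]
    show "\<bar>(wxx a * fst d + wxy a * snd d) - (wxx b * fst d + wxy b * snd d)\<bar> \<le> hoelder_const K R * G * dist a b powr (1 / (2 * K))"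
      by (rule limit_abs_bound[OF tendsto_diff[OF lim(1)[OF inS[OF a]] lim(1)[OF inS[OF b]]] R2])
        (use est(1) in \<open>auto simp: Q_def\<close>)
    show "\<bar>(wxy a * fst d + wyy a * snd d) - (wxy b * fst d + wyy b * snd d)\<bar> \<le> hoelder_const K R * G * dist a b powr (1 / (2 * K))"
      by (rule limit_abs_bound[OF tendsto_diff[OF lim(2)[OF inS[OF a]] lim(2)[OF inS[OF b]]] R2])
        (use est(2) in \<open>auto simp: Q_def\<close>)
  }
  have p: "p \<in> S" using inS[of p] R by (auto simp: sq_def mem_Times_iff)
  note est = saddle_function.gradient_bound[OF sad dom R Qw G0]
  show "\<bar>wxx p * fst d + wxy p * snd d\<bar> \<le> gradient_const K R * G"
    by (rule limit_abs_bound[OF lim(1)[OF p] R2]) (use est(1) in \<open>auto simp: Q_def\<close>)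
  show "\<bar>wxy p * fst d + wyy p * snd d\<bar> \<le> gradient_const K R * G"
    by (rule limit_abs_bound[OF lim(2)[OF p] R2]) (use est(2) in \<open>auto simp: Q_def\<close>)
qed

end

section \<open>Uniform ellipticity in two dimensions\<close>

text \<open>The symmetric matrix with rows \<open>(a, b)\<close> and \<open>(b, d)\<close>.\<close>

definition symmat :: "real \<Rightarrow> real \<Rightarrow> real \<Rightarrow> real ^ 2 ^ 2"
  where "symmat a b d = (\<chi> i j. if i = 1 then (if j = 1 then a else b) else (if j = 1 then b else d))"

lemma two_neq_one [simp]: "(2::2) \<noteq> 1" "(1::2) \<noteq> 2"
  by auto

lemma symmat_nth [simp]: "symmat a b d $ 1 $ 1 = a" "symmat a b d $ 1 $ 2 = b" "symmat a b d $ 2 $ 1 = b" "symmat a b d $ 2 $ 2 = d"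
  by (simp_all add: symmat_def)

lemma matrix2_eq_iff:
  fixes M N :: "real ^ 2 ^ 2"
  shows "M = N \<longleftrightarrow> M $ 1 $ 1 = N $ 1 $ 1 \<and> M $ 1 $ 2 = N $ 1 $ 2 \<and> M $ 2 $ 1 = N $ 2 $ 1 \<and> M $ 2 $ 2 = N $ 2 $ 2"
  by (auto simp: vec_eq_iff forall_2)

lemma symmat_Sym2 [simp]: "symmat a b d \<in> Sym2"
  by (simp add: Sym2_def matrix2_eq_iff transpose_def)

lemma symmat_add: "symmat a b d + symmat a' b' d' = symmat (a + a') (b + b') (d + d')"
  by (simp add: matrix2_eq_iff)

lemma symmat_uminus: "- symmat a b d = symmat (- a) (- b) (- d)"
  by (simp add: matrix2_eq_iff)

lemma trace_symmat [simp]: "trace (symmat a b d) = a + d"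
  by (simp add: trace_def sum_2)

lemma psd_symmatI:
  assumes "\<And>x y. 0 \<le> a * x\<^sup>2 + 2 * b * x * y + d * y\<^sup>2"
  shows "psd (symmat a b d)"
proof -
  have "x \<bullet> (symmat a b d *v x) = a * (x $ 1)\<^sup>2 + 2 * b * (x $ 1) * (x $ 2) + d * (x $ 2)\<^sup>2" for x
    by (simp add: inner_vec_def matrix_vector_mult_def sum_2 power2_eq_square algebra_simps)
  then show ?thesis using assms by (simp add: psd_def)
qed

lemma uniformly_ellipticD:
  assumes "uniformly_elliptic lam Lam F" "psd (symmat a' b' d')"
  shows "lam * (a' + d') \<le> F (symmat (a + a') (b + b') (d + d')) - F (symmat a b d)"
    "F (symmat (a + a') (b + b') (d + d')) - F (symmat a b d) \<le> Lam * (a' + d')"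
  using assms unfolding uniformly_elliptic_def symmat_add[symmetric] by (metis symmat_Sym2 trace_symmat)+

text \<open>If two matrices on the same level set of \<open>F\<close> differ by \<open>P - Q\<close> with \<open>P\<close> and \<open>Q\<close> positive
  semidefinite, then moving up by \<open>P\<close> from one and by \<open>Q\<close> from the other leads to the same matrix.\<close>

lemma elliptic_trace_le:
  assumes F: "uniformly_elliptic lam Lam F" and eq: "F (symmat a b d) = F (symmat a' b' d')"
    and P: "psd (symmat p q r)" "psd (symmat p' q' r')"
    and diff: "a - a' = p - p'" "b - b' = q - q'" "d - d' = r - r'"
  shows "lam * (p + r) \<le> Lam * (p' + r')"
proof -
  have "symmat (a' + p) (b' + q) (d' + r) = symmat (a + p') (b + q') (d + r')"
    using diff by (simp add: matrix2_eq_iff)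
  then show ?thesis
    using uniformly_ellipticD(1)[OF F P(1), of a' b' d'] uniformly_ellipticD(2)[OF F P(2), of a b d] eq by simp
qed

text \<open>Stated without division by \<open>lam\<close>, and for a positive diagonal entry only. Exchanging the two
  matrices gives the case of a negative entry.\<close>

lemma cone_of_elliptic_pos:
  assumes F: "uniformly_elliptic lam Lam F" and eq: "F (symmat a1 b1 d1) = F (symmat a2 b2 d2)"
    and a: "a = a1 - a2" and b: "b = b1 - b2" and d: "d = d1 - d2"
  shows "0 < a \<Longrightarrow> lam * (a\<^sup>2 + b\<^sup>2) \<le> Lam * (b\<^sup>2 - a * d)"
    and "0 < d \<Longrightarrow> lam * (b\<^sup>2 + d\<^sup>2) \<le> Lam * (b\<^sup>2 - a * d)"
proof -
  have ll: "0 < lam" "lam \<le> Lam" using F by (auto simp: uniformly_elliptic_def)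
  have zero: "psd (symmat 0 0 0)" by (rule psd_symmatI) simp
  \<comment> \<open>otherwise the difference is positive definite, against strict monotonicity of \<open>F\<close>\<close>
  have nonneg_det: "0 \<le> b\<^sup>2 - a * d" if pos: "0 < a \<or> 0 < d"
  proof (rule ccontr)
    assume "\<not> 0 \<le> b\<^sup>2 - a * d"
    then have det: "b\<^sup>2 < a * d" by simp
    then have "0 < a * d" using zero_le_power2[of b] by linarith
    then have ad: "0 < a" "0 < d" using pos by (auto simp: zero_less_mult_iff)
    have "psd (symmat a b d)"
    proof (rule psd_symmatI)
      fix x y :: real
      have "a * (a * x\<^sup>2 + 2 * b * x * y + d * y\<^sup>2) = (a * x + b * y)\<^sup>2 + (a * d - b\<^sup>2) * y\<^sup>2"
        by (simp add: power2_eq_square algebra_simps)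
      also have "0 \<le> \<dots>" using det by simp
      finally show "0 \<le> a * x\<^sup>2 + 2 * b * x * y + d * y\<^sup>2" using ad by (simp add: zero_le_mult_iff)
    qed
    from elliptic_trace_le[OF F eq this zero] have "lam * (a + d) \<le> 0" by (simp add: a b d)
    then show False using ad ll by (simp add: mult_le_0_iff)
  qed
  {
    assume a0: "0 < a"
    \<comment> \<open>the matrix \<open>v v\<^sup>T / a\<close> with \<open>v = (a, b)\<close>; the difference has its only nonzero entry in the lower right corner\<close>
    have "psd (symmat a b (b\<^sup>2 / a))"
    proof (rule psd_symmatI)
      fix x y :: real
      have "a * x\<^sup>2 + 2 * b * x * y + b\<^sup>2 / a * y\<^sup>2 = (a * x + b * y)\<^sup>2 / a"
        using a0 by (simp add: power2_eq_square field_simps)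
      then show "0 \<le> a * x\<^sup>2 + 2 * b * x * y + b\<^sup>2 / a * y\<^sup>2" using a0 by simp
    qed
    moreover have "psd (symmat 0 0 ((b\<^sup>2 - a * d) / a))"
      using nonneg_det a0 by (intro psd_symmatI) simp
    ultimately have "lam * (a + b\<^sup>2 / a) \<le> Lam * (0 + (b\<^sup>2 - a * d) / a)"
      by (rule elliptic_trace_le[OF F eq]) (use a0 in \<open>auto simp: a b d diff_divide_distrib\<close>)
    then have "a * (lam * (a + b\<^sup>2 / a)) \<le> a * (Lam * (0 + (b\<^sup>2 - a * d) / a))"
      using a0 by (intro mult_left_mono) auto
    moreover have "a * (lam * (a + b\<^sup>2 / a)) = lam * (a\<^sup>2 + b\<^sup>2)"
      using a0 by (simp add: power2_eq_square field_simps)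
    ultimately show "lam * (a\<^sup>2 + b\<^sup>2) \<le> Lam * (b\<^sup>2 - a * d)" using a0 by simp
  }
  {
    assume d0: "0 < d"
    \<comment> \<open>the same with the two coordinates exchanged\<close>
    have "psd (symmat (b\<^sup>2 / d) b d)"
    proof (rule psd_symmatI)
      fix x y :: real
      have "b\<^sup>2 / d * x\<^sup>2 + 2 * b * x * y + d * y\<^sup>2 = (b * x + d * y)\<^sup>2 / d"
        using d0 by (simp add: power2_eq_square field_simps)
      then show "0 \<le> b\<^sup>2 / d * x\<^sup>2 + 2 * b * x * y + d * y\<^sup>2" using d0 by simp
    qed
    moreover have "psd (symmat ((b\<^sup>2 - a * d) / d) 0 0)"
      using nonneg_det d0 by (intro psd_symmatI) simp
    ultimately have "lam * (b\<^sup>2 / d + d) \<le> Lam * ((b\<^sup>2 - a * d) / d + 0)"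
      by (rule elliptic_trace_le[OF F eq]) (use d0 in \<open>auto simp: a b d diff_divide_distrib\<close>)
    then have "d * (lam * (b\<^sup>2 / d + d)) \<le> d * (Lam * ((b\<^sup>2 - a * d) / d + 0))"
      using d0 by (intro mult_left_mono) auto
    moreover have "d * (lam * (b\<^sup>2 / d + d)) = lam * (b\<^sup>2 + d\<^sup>2)"
      using d0 by (simp add: power2_eq_square field_simps)
    ultimately show "lam * (b\<^sup>2 + d\<^sup>2) \<le> Lam * (b\<^sup>2 - a * d)" using d0 by simp
  }
qed

theorem cone_of_elliptic:
  assumes F: "uniformly_elliptic lam Lam F" and eq: "F (symmat a1 b1 d1) = F (symmat a2 b2 d2)"
  defines "a \<equiv> a1 - a2" and "b \<equiv> b1 - b2" and "d \<equiv> d1 - d2"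
  shows "a\<^sup>2 + b\<^sup>2 \<le> Lam / lam * (b\<^sup>2 - a * d) \<and> b\<^sup>2 + d\<^sup>2 \<le> Lam / lam * (b\<^sup>2 - a * d)"
proof -
  have ll: "0 < lam" "lam \<le> Lam" using F by (auto simp: uniformly_elliptic_def)
  have ab: "- a = a2 - a1" "- b = b2 - b1" "- d = d2 - d1" by (auto simp: a_def b_def d_def)
  note c1 = cone_of_elliptic_pos[OF F eq a_def[THEN meta_eq_to_obj_eq] b_def[THEN meta_eq_to_obj_eq] d_def[THEN meta_eq_to_obj_eq]]
  note c2 = cone_of_elliptic_pos[OF F eq[symmetric] ab]
  have bb: "lam * b\<^sup>2 \<le> Lam * b\<^sup>2" using ll by (intro mult_right_mono) auto
  have "lam * (a\<^sup>2 + b\<^sup>2) \<le> Lam * (b\<^sup>2 - a * d)"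
    using c1(1) c2(1) bb by (cases a "0::real" rule: linorder_cases) auto
  moreover have "lam * (b\<^sup>2 + d\<^sup>2) \<le> Lam * (b\<^sup>2 - a * d)"
    using c1(2) c2(2) bb by (cases d "0::real" rule: linorder_cases) auto
  ultimately show ?thesis using ll by (simp add: field_simps)
qed

lemma elliptic_root:
  assumes F: "uniformly_elliptic lam Lam F" and cF: "continuous_on Sym2 F"
  obtains t where "F (symmat t 0 t) = 0"
proof -
  have ll: "0 < lam" using F by (auto simp: uniformly_elliptic_def)
  define f where "f = (\<lambda>t. F (symmat t 0 t))"
  have "(\<lambda>t. symmat t 0 t) = (\<lambda>t. t *\<^sub>R symmat 1 0 1)" by (simp add: fun_eq_iff matrix2_eq_iff)
  moreover have "continuous_on UNIV (\<lambda>t. t *\<^sub>R symmat 1 0 1)" by (intro continuous_intros)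
  ultimately have "continuous_on UNIV (\<lambda>t. symmat t 0 t)" by (simp only:)
  then have cf: "continuous_on T f" for T
    unfolding f_def
    by (rule continuous_on_compose2[OF cF continuous_on_subset]) (simp_all add: image_subset_iff)
  have psd: "psd (symmat t 0 t)" if "0 \<le> t" for t
    by (rule psd_symmatI) (use that in auto)
  have mono: "f s + 2 * lam * t \<le> f (s + t)" if "0 \<le> t" for s t
    using uniformly_ellipticD(1)[OF F psd[OF that], of s 0 s] by (simp add: f_def algebra_simps)
  define T where "T = \<bar>f 0\<bar> / (2 * lam)"
  have T: "0 \<le> T" "2 * lam * T = \<bar>f 0\<bar>" using ll by (auto simp: T_def)
  have "f (- T) \<le> 0" "0 \<le> f T" using mono[of T 0] mono[of T "-T"] T by auto
  then have "\<exists>t. -T \<le> t \<and> t \<le> T \<and> f t = 0" using T by (intro IVT' cf) auto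
  then show thesis using that by (auto simp: f_def)
qed

lemma C1_fun_subtract_quadratic:
  assumes "C1_fun S U Ux Uy" "C1_fun S Ux Uxx Uxy" "C1_fun S Uy Uxy Uyy"
  shows "C1_fun S (\<lambda>p. U p - s / 2 * ((fst p)\<^sup>2 + (snd p)\<^sup>2)) (\<lambda>p. Ux p - s * fst p) (\<lambda>p. Uy p - s * snd p)"
    "C1_fun S (\<lambda>p. Ux p - s * fst p) (\<lambda>p. Uxx p - s) Uxy"
    "C1_fun S (\<lambda>p. Uy p - s * snd p) Uxy (\<lambda>p. Uyy p - s)"
proof -
  have op: "open S" using C1_funD(1)[OF assms(1)] .
  have q: "C1_fun S (\<lambda>p. (fst p)\<^sup>2 + (snd p)\<^sup>2) (\<lambda>p. 2 * fst p) (\<lambda>p. 2 * snd p)"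
    "C1_fun S fst (\<lambda>p. 1) (\<lambda>p. 0)" "C1_fun S snd (\<lambda>p. 0) (\<lambda>p. 1)"
    unfolding C1_fun_def using op by (auto intro!: derivative_eq_intros continuous_intros simp: algebra_simps)
  show "C1_fun S (\<lambda>p. U p - s / 2 * ((fst p)\<^sup>2 + (snd p)\<^sup>2)) (\<lambda>p. Ux p - s * fst p) (\<lambda>p. Uy p - s * snd p)"
    using C1_fun_lincomb[OF assms(1) q(1), of 1 "- s / 2" 0] by simp
  show "C1_fun S (\<lambda>p. Ux p - s * fst p) (\<lambda>p. Uxx p - s) Uxy"
    using C1_fun_lincomb[OF assms(2) q(2), of 1 "- s" 0] by simp
  show "C1_fun S (\<lambda>p. Uy p - s * snd p) Uxy (\<lambda>p. Uyy p - s)"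
    using C1_fun_lincomb[OF assms(3) q(3), of 1 "- s" 0] by simp
qed

text \<open>The Hessian is negative semidefinite at an interior local maximum.\<close>

lemma second_derivative_test_max:
  assumes C: "C1_fun S U Ux Uy" "C1_fun S Ux Uxx Uxy" "C1_fun S Uy Uxy Uyy"
    and p: "p \<in> S" and e: "0 < e" "ball p e \<subseteq> S" and max: "\<And>q. q \<in> ball p e \<Longrightarrow> U q \<le> U p"
  shows "Uxx p * x\<^sup>2 + 2 * Uxy p * x * y + Uyy p * y\<^sup>2 \<le> 0"
proof (rule ccontr)
  assume "\<not> ?thesis"
  then have pos: "0 < Uxx p * x\<^sup>2 + 2 * Uxy p * x * y + Uyy p * y\<^sup>2" by simp
  define c where "c = (\<lambda>t. p + t *\<^sub>R (x, y))"
  have ceq: "c t = (fst p + t * x, snd p + t * y)" for t by (simp add: c_def prod_eq_iff)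
  \<comment> \<open>the line through \<open>p\<close> in the direction \<open>(x, y)\<close> stays in the ball for parameters below \<open>\<delta>\<close>\<close>
  define \<delta> where "\<delta> = e / (norm (x, y) + 1)"
  have \<delta>: "0 < \<delta>" using e by (simp add: \<delta>_def add_nonneg_pos)
  have c_in: "c t \<in> ball p e" if "\<bar>t\<bar> < \<delta>" for t
  proof -
    have "\<bar>t\<bar> * norm (x, y) \<le> \<delta> * norm (x, y)" using that by (intro mult_right_mono) auto
    also have "\<dots> < \<delta> * (norm (x, y) + 1)" using \<delta> by simp
    also have "\<dots> = e"
    proof -
      have "norm (x, y) + 1 \<noteq> 0" using norm_ge_zero[of "(x, y)"] by linarith
      then show ?thesis by (metis \<delta>_def nonzero_mult_div_cancel_right times_divide_eq_left)
    qed
    also have "\<bar>t\<bar> * norm (x, y) = dist (c t) p" by (simp only: c_def dist_norm add_diff_cancel_left' norm_scaleR)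
    finally show ?thesis by (simp add: dist_commute)
  qed
  define g where "g = (\<lambda>t. U (c t))"
  define g' where "g' = (\<lambda>t. Ux (c t) * x + Uy (c t) * y)"
  have dg: "(g has_real_derivative g' t) (at t)" if "\<bar>t\<bar> < \<delta>" for t
    unfolding g_def g'_def ceq
    by (rule C1_fun_path[OF C(1)]) (use c_in[OF that] e in \<open>auto simp: ceq intro!: derivative_eq_intros\<close>)
  have c0: "c 0 = p" by (simp add: ceq)
  have path: "((\<lambda>t. f (c t)) has_real_derivative (fx p * x + fy p * y)) (at 0)" if "C1_fun S f fx fy" for f fx fy
  proof -
    have "((\<lambda>t. f (fst p + t * x, snd p + t * y)) has_real_derivative
       (fx (fst p + 0 * x, snd p + 0 * y) * x + fy (fst p + 0 * x, snd p + 0 * y) * y)) (at 0)"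
      by (rule C1_fun_path[OF that]) (use p in \<open>auto intro!: derivative_eq_intros\<close>)
    then show ?thesis by (simp add: ceq)
  qed
  have "(g' has_real_derivative ((Uxx p * x + Uxy p * y) * x + (Uxy p * x + Uyy p * y) * y)) (at 0)"
    unfolding g'_def by (intro DERIV_add DERIV_cmult_right path C)
  then have dg': "(g' has_real_derivative (Uxx p * x\<^sup>2 + 2 * Uxy p * x * y + Uyy p * y\<^sup>2)) (at 0)"
    by (simp add: power2_eq_square algebra_simps)
  have loc: "g t \<le> g 0" if "\<bar>t\<bar> < \<delta>" for t unfolding g_def c0 using max[OF c_in[OF that]] .
  have "g' 0 = 0"
    by (rule DERIV_local_max[OF dg \<delta>]) (use \<delta> loc in auto)
  obtain r where r: "0 < r" "\<And>h. 0 < h \<Longrightarrow> h < r \<Longrightarrow> g' 0 < g' (0 + h)"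
    using DERIV_pos_inc_right[OF dg' pos] by blast
  define h where "h = min r \<delta> / 2"
  have h: "0 < h" "h < r" "h < \<delta>" using r \<delta> by (auto simp: h_def min_def)
  have "\<exists>z>0. z < h \<and> g h - g 0 = (h - 0) * g' z"
    by (rule MVT2) (use h in \<open>auto intro!: dg\<close>)
  then obtain z where z: "0 < z" "z < h" "g h - g 0 = h * g' z" by auto
  have "0 < g' z" using r(2)[of z] z h \<open>g' 0 = 0\<close> by simp
  then have "0 < g h - g 0" using z h by simp
  then show False using loc[of h] h by simp
qed

text \<open>If \<open>8 M < s < t\<close>, the function \<open>U - s \<bar>x\<bar>\<^sup>2 / 2\<close> is smaller on the circle of radius \<open>9 / 10\<close> than at
  the origin, so it has an interior maximum. There the Hessian of \<open>U\<close> is at most \<open>s I\<close>, which is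
  strictly below \<open>t I\<close>, so that \<open>F\<close> cannot vanish at both.\<close>

lemma root_bound_upper:
  assumes C: "C1_fun S U Ux Uy" "C1_fun S Ux Uxx Uxy" "C1_fun S Uy Uxy Uyy"
    and S: "S = ball 0 1" and M: "\<And>p. p \<in> S \<Longrightarrow> \<bar>U p\<bar> \<le> M"
    and F: "uniformly_elliptic lam Lam F" and t: "F (symmat t 0 t) = 0"
    and sol: "\<And>p. p \<in> S \<Longrightarrow> F (symmat (Uxx p) (Uxy p) (Uyy p)) = 0"
  shows "t \<le> 8 * M"
proof (rule ccontr)
  assume "\<not> t \<le> 8 * M"
  then have tM: "8 * M < t" by simp
  have "0 \<in> S" by (simp add: S)
  from M[OF this] have M0: "0 \<le> M" by linarith
  \<comment> \<open>any number strictly between \<open>8 M\<close> and \<open>t\<close>\<close>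
  define s where "s = (8 * M + t) / 2"
  have s: "8 * M < s" "s < t" using tM by (auto simp: s_def)
  define h where "h = (\<lambda>p. U p - s / 2 * ((fst p)\<^sup>2 + (snd p)\<^sup>2))"
  note C' = C1_fun_subtract_quadratic[OF C, of s, folded h_def]
  let ?D = "cball 0 (9/10) :: (real \<times> real) set"
  have DS: "?D \<subseteq> S" by (auto simp: S)
  obtain p where p: "p \<in> ?D" "\<And>q. q \<in> ?D \<Longrightarrow> h q \<le> h p"
    using continuous_attains_sup[of ?D h] continuous_on_subset[OF C1_funD(2)[OF C'(1)] DS] by auto
  have np: "(fst p)\<^sup>2 + (snd p)\<^sup>2 = (norm p)\<^sup>2" for p :: "real \<times> real"
    by (cases p) (simp add: norm_Pair)
  have "norm p < 9/10"
  proof (rule ccontr)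
    assume "\<not> norm p < 9/10"
    then have n: "norm p = 9/10" using p(1) by simp
    have "- M \<le> U 0" using M[OF \<open>0 \<in> S\<close>] by linarith
    also have "U 0 = h 0" by (simp add: h_def)
    also have "\<dots> \<le> h p" by (rule p(2)) simp
    also have "\<dots> = U p - s / 2 * (81/100)" unfolding h_def np n by (simp add: power2_eq_square)
    also have "U p \<le> M" using M[of p] p(1) DS by (auto simp: abs_le_iff)
    finally show False using s M0 by simp
  qed
  define e where "e = 9/10 - norm p"
  have e: "0 < e" using \<open>norm p < 9/10\<close> by (simp add: e_def)
  have bD: "ball p e \<subseteq> ?D"
  proof
    fix q assume "q \<in> ball p e"
    then have "norm (q - p) < e" by (simp add: dist_norm norm_minus_commute)
    then show "q \<in> ?D" using norm_triangle_ineq2[of q p] by (simp add: e_def)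
  qed
  have hess: "(Uxx p - s) * x\<^sup>2 + 2 * Uxy p * x * y + (Uyy p - s) * y\<^sup>2 \<le> 0" for x y
    by (rule second_derivative_test_max[OF C' _ e]) (use bD p DS in auto)
  have st: "0 \<le> (t - s) * x\<^sup>2" for x using s by simp
  have psd: "psd (symmat (t - Uxx p) (- Uxy p) (t - Uyy p))"
  proof (rule psd_symmatI)
    fix x y show "0 \<le> (t - Uxx p) * x\<^sup>2 + 2 * (- Uxy p) * x * y + (t - Uyy p) * y\<^sup>2"
      using hess[of x y] st[of x] st[of y] by (simp add: algebra_simps)
  qed
  have "0 < t - Uxx p" "0 < t - Uyy p" using hess[of 1 0] hess[of 0 1] s by auto
  then have "0 < lam * ((t - Uxx p) + (t - Uyy p))"
    using F by (auto simp: uniformly_elliptic_def intro!: mult_pos_pos)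
  moreover have "lam * ((t - Uxx p) + (t - Uyy p)) \<le> 0"
    using uniformly_ellipticD(1)[OF F psd, of "Uxx p" "Uxy p" "Uyy p"] sol[of p] t p DS by auto
  ultimately show False by simp
qed

text \<open>The lower bound on \<open>t\<close> is the upper bound for \<open>- U\<close> and the operator \<open>M \<mapsto> - F (- M)\<close>.\<close>

lemma root_bound:
  assumes C: "C1_fun S U Ux Uy" "C1_fun S Ux Uxx Uxy" "C1_fun S Uy Uxy Uyy"
    and S: "S = ball 0 1" and M: "\<And>p. p \<in> S \<Longrightarrow> \<bar>U p\<bar> \<le> M"
    and F: "uniformly_elliptic lam Lam F" and t: "F (symmat t 0 t) = 0"
    and sol: "\<And>p. p \<in> S \<Longrightarrow> F (symmat (Uxx p) (Uxy p) (Uyy p)) = 0"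
  shows "\<bar>t\<bar> \<le> 8 * M"
proof -
  let ?F = "\<lambda>M. - F (- M)"
  have F': "uniformly_elliptic lam Lam ?F"
    unfolding uniformly_elliptic_def
  proof (intro conjI ballI impI)
    fix A N :: "real ^ 2 ^ 2" assume AN: "A \<in> Sym2" "N \<in> Sym2" "psd N"
    have "- (A + N) \<in> Sym2" using AN by (simp add: Sym2_def transpose_def vec_eq_iff)
    with F AN have "lam * trace N \<le> F (- (A + N) + N) - F (- (A + N)) \<and> F (- (A + N) + N) - F (- (A + N)) \<le> Lam * trace N"
      unfolding uniformly_elliptic_def by blast
    then show "lam * trace N \<le> - F (- (A + N)) - - F (- A)" "- F (- (A + N)) - - F (- A) \<le> Lam * trace N"
      by simp_all
  qed (use F in \<open>auto simp: uniformly_elliptic_def\<close>)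
  have neg: "C1_fun S (\<lambda>p. - f p) (\<lambda>p. - fx p) (\<lambda>p. - fy p)" if "C1_fun S f fx fy" for f fx fy
    using C1_fun_lincomb[OF that that, of "-1" 0 0] by simp
  have "- t \<le> 8 * M"
    by (rule root_bound_upper[OF C[THEN neg] S _ F']) (use M t sol in \<open>auto simp: symmat_uminus\<close>)
  moreover have "t \<le> 8 * M" by (rule root_bound_upper[OF C S M F t sol])
  ultimately show ?thesis by linarith
qed

section \<open>Interior estimates\<close>

text \<open>The constants in the bounds of the second derivatives and of their Hoelder quotients on the disc of
  radius \<open>1 / 2\<close>. The factor five comes from \<open>\<bar>v\<bar> \<le> 5 M\<close>, the summand eight from \<open>\<bar>t\<bar> \<le> 8 M\<close>, and
  the factor 64 from pairs of points at distance at least \<open>1 / 32\<close>.\<close>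

definition hessian_const :: "real \<Rightarrow> real"
  where "hessian_const K = 5 * gradient_const K (1/8) * gradient_const K (1/16) + 8"

definition hessian_hoelder_const :: "real \<Rightarrow> real"
  where "hessian_hoelder_const K = 5 * hoelder_const K (1/8) * gradient_const K (1/16) + 64 * hessian_const K"

text \<open>The quantities bounded here are those of the solution \<open>U\<close> itself. The proof applies the estimates
  for saddles to \<open>v = U - t \<bar>x\<bar>\<^sup>2 / 2\<close> on squares of half side \<open>1 / 4\<close>, which lie in the unit disc when
  their centre has norm less than \<open>1 / 2\<close>.\<close>

theorem interior_estimates:
  assumes C: "C1_fun S U Ux Uy" "C1_fun S Ux Uxx Uxy" "C1_fun S Uy Uxy Uyy"
    and S: "S = ball 0 1" and M: "\<And>p. p \<in> S \<Longrightarrow> \<bar>U p\<bar> \<le> M" and M0: "0 < M"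
    and F: "uniformly_elliptic lam Lam F" and cF: "continuous_on Sym2 F"
    and sol: "\<And>p. p \<in> S \<Longrightarrow> F (symmat (Uxx p) (Uxy p) (Uyy p)) = 0"
    and K: "K = Lam / lam"
  shows "a \<in> ball 0 (1/2) \<Longrightarrow> \<bar>Ux a\<bar> \<le> (5 * gradient_const K (1/8) + 8) * M \<and> \<bar>Uy a\<bar> \<le> (5 * gradient_const K (1/8) + 8) * M"
    and "a \<in> ball 0 (1/2) \<Longrightarrow> \<bar>Uxx a\<bar> \<le> hessian_const K * M \<and> \<bar>Uxy a\<bar> \<le> hessian_const K * M \<and> \<bar>Uyy a\<bar> \<le> hessian_const K * M"
    and "a \<in> ball 0 (1/2) \<Longrightarrow> b \<in> ball 0 (1/2) \<Longrightarrow> f \<in> {Uxx, Uxy, Uyy} \<Longrightarrow>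
      \<bar>f a - f b\<bar> \<le> hessian_hoelder_const K * M * dist a b powr (1 / (2 * K))"
proof -
  have ll: "0 < lam" "lam \<le> Lam" using F by (auto simp: uniformly_elliptic_def)
  have K1: "1 \<le> K" using ll by (simp add: K)
  obtain t where t: "F (symmat t 0 t) = 0" using elliptic_root[OF F cF] .
  have tM: "\<bar>t\<bar> \<le> 8 * M" by (rule root_bound[OF C S M F t sol])
  define v where "v = (\<lambda>p. U p - t / 2 * ((fst p)\<^sup>2 + (snd p)\<^sup>2))"
  define vx where "vx = (\<lambda>p. Ux p - t * fst p)"
  define vy where "vy = (\<lambda>p. Uy p - t * snd p)"
  define vxx where "vxx = (\<lambda>p. Uxx p - t)"
  define vyy where "vyy = (\<lambda>p. Uyy p - t)"
  note C' = C1_fun_subtract_quadratic[OF C, of t, folded v_def vx_def vy_def vxx_def vyy_def]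
  interpret saddle_differences K S v vx vy vxx Uxy vyy
  proof
    fix p q assume p: "p \<in> S"
    show "(vxx p)\<^sup>2 + (Uxy p)\<^sup>2 \<le> K * ((Uxy p)\<^sup>2 - vxx p * vyy p)"
      "(Uxy p)\<^sup>2 + (vyy p)\<^sup>2 \<le> K * ((Uxy p)\<^sup>2 - vxx p * vyy p)"
      using cone_of_elliptic[OF F, of "Uxx p" "Uxy p" "Uyy p" t 0 t] sol[OF p] t
      by (simp_all add: K vxx_def vyy_def)
    assume q: "q \<in> S"
    show "(vxx p - vxx q)\<^sup>2 + (Uxy p - Uxy q)\<^sup>2 \<le> K * ((Uxy p - Uxy q)\<^sup>2 - (vxx p - vxx q) * (vyy p - vyy q)) \<and>
      (Uxy p - Uxy q)\<^sup>2 + (vyy p - vyy q)\<^sup>2 \<le> K * ((Uxy p - Uxy q)\<^sup>2 - (vxx p - vxx q) * (vyy p - vyy q))"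
      using cone_of_elliptic[OF F, of "Uxx p" "Uxy p" "Uyy p" "Uxx q" "Uxy q" "Uyy q"] sol[OF p] sol[OF q]
      by (simp add: K vxx_def vyy_def)
  qed (rule K1 C')+
  have np: "(fst p)\<^sup>2 + (snd p)\<^sup>2 = (norm p)\<^sup>2" for p :: "real \<times> real"
    by (cases p) (simp add: norm_Pair)
  have vM: "\<bar>v p\<bar> \<le> 5 * M" if p: "p \<in> S" for p
  proof -
    have "(norm p)\<^sup>2 \<le> 1" using p by (simp add: S power_le_one)
    then have "\<bar>t / 2 * (norm p)\<^sup>2\<bar> \<le> 4 * M * 1"
      unfolding abs_mult using tM by (intro mult_mono) auto
    then show ?thesis using M[OF p] unfolding v_def np by linarith
  qed
  have sqS: "sq a (1/4) \<subseteq> S" if a: "a \<in> ball 0 (1/2)" for a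
  proof
    fix q assume q: "q \<in> sq a (1/4)"
    have "norm (q - a) \<le> \<bar>fst (q - a)\<bar> + \<bar>snd (q - a)\<bar>"
      using sqrt_sum_squares_le_sum_abs[of "fst (q - a)" "snd (q - a)"] by (simp add: norm_prod_def)
    also have "\<dots> \<le> 1/4 + 1/4"
      using q by (intro add_mono) (auto simp: sq_def mem_Times_iff abs_if)
    finally have "norm q < 1" using a norm_triangle_ineq2[of q a] by simp
    then show "q \<in> S" by (simp add: S)
  qed
  have sqS8: "sq a (1/8) \<subseteq> S" if "a \<in> ball 0 (1/2)" for a
    using sqS[OF that] sq_subset_sq[of a a "1/8" "1/4"] by auto
  have M5: "0 < 5 * M" using M0 by simp
  have r8: "(0::real) < 1/8" by simp
  show "\<bar>Ux a\<bar> \<le> (5 * gradient_const K (1/8) + 8) * M \<and> \<bar>Uy a\<bar> \<le> (5 * gradient_const K (1/8) + 8) * M"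
    if a: "a \<in> ball 0 (1/2)" for a
  proof -
    have g: "\<bar>vx a\<bar> \<le> gradient_const K (1/8) * (5 * M)" "\<bar>vy a\<bar> \<le> gradient_const K (1/8) * (5 * M)"
      by (rule gradient_bound[OF sqS8[OF a] r8 vM M5], use sqS8[OF a] in auto)+
    have "\<bar>fst a\<bar> \<le> 1" "\<bar>snd a\<bar> \<le> 1"
      using norm_fst_le[of "fst a" "snd a"] norm_snd_le[of "snd a" "fst a"] a by auto
    then have "\<bar>t * fst a\<bar> \<le> 8 * M * 1" "\<bar>t * snd a\<bar> \<le> 8 * M * 1"
      unfolding abs_mult using tM by (intro mult_mono; simp)+
    then show ?thesis using g unfolding vx_def vy_def by (simp add: algebra_simps) linarith
  qed
  have G: "gradient_const K (1/8/2) = gradient_const K (1/16)" by simp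
  have s4: "2 * (1/8) = (1/4::real)" by simp
  note he = hessian_estimates[OF _ r8 _ M5, unfolded G s4]
  have he1: "\<bar>vxx a\<bar> \<le> gradient_const K (1/8) * (gradient_const K (1/16) * (5 * M))"
     "\<bar>Uxy a\<bar> \<le> gradient_const K (1/8) * (gradient_const K (1/16) * (5 * M))"
     "\<bar>vyy a\<bar> \<le> gradient_const K (1/8) * (gradient_const K (1/16) * (5 * M))"
    if a: "a \<in> ball 0 (1/2)" for a
    using he(3)[OF sqS[OF a] vM, of "(1,0)"] he(4)[OF sqS[OF a] vM, of "(1,0)"] he(4)[OF sqS[OF a] vM, of "(0,1)"]
      sqS[OF a] by (auto simp: subset_iff)
  show bd: "\<bar>Uxx a\<bar> \<le> hessian_const K * M \<and> \<bar>Uxy a\<bar> \<le> hessian_const K * M \<and> \<bar>Uyy a\<bar> \<le> hessian_const K * M"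
    if a: "a \<in> ball 0 (1/2)" for a
    using he1[OF a] tM M0 unfolding vxx_def vyy_def hessian_const_def by (simp add: algebra_simps) linarith
  have H0: "0 \<le> hessian_const K" unfolding hessian_const_def
    using gradient_const_pos[OF K1, of "1/8"] gradient_const_pos[OF K1, of "1/16"] by simp
  show "\<bar>f a - f b\<bar> \<le> hessian_hoelder_const K * M * dist a b powr (1 / (2 * K))"
    if a: "a \<in> ball 0 (1/2)" and b: "b \<in> ball 0 (1/2)" and f: "f \<in> {Uxx, Uxy, Uyy}" for a b f
  proof (cases "b \<in> sq a (1/8/4)")
    case True
    have aa: "a \<in> sq a (1/8/4)" by (simp add: sq_def mem_Times_iff)
    have "\<bar>f a - f b\<bar> \<le> hoelder_const K (1/8) * (gradient_const K (1/16) * (5 * M)) * dist a b powr (1 / (2 * K))"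
      using f he(1)[OF sqS[OF a] vM, of "(1,0)" a b] he(2)[OF sqS[OF a] vM, of "(1,0)" a b]
        he(2)[OF sqS[OF a] vM, of "(0,1)" a b] sqS[OF a] aa True
      by (auto simp: subset_iff vxx_def vyy_def)
    also have "\<dots> \<le> hessian_hoelder_const K * M * dist a b powr (1 / (2 * K))"
      unfolding hessian_hoelder_const_def using H0 M0
      by (intro mult_right_mono) (auto simp: algebra_simps)
    finally show ?thesis .
  next
    case False
    have "1/32 \<le> dist a b"
    proof (rule ccontr)
      assume "\<not> 1/32 \<le> dist a b"
      then have "norm (b - a) < 1/32" by (simp add: dist_norm norm_minus_commute)
      then have "\<bar>fst (b - a)\<bar> \<le> 1/32" "\<bar>snd (b - a)\<bar> \<le> 1/32"
        using norm_fst_le[of "fst (b - a)" "snd (b - a)"] norm_snd_le[of "snd (b - a)" "fst (b - a)"]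
        by (cases a; cases b; auto)+
      then have "b \<in> sq a (1/8/4)" by (auto simp: sq_def mem_Times_iff abs_if split: if_splits)
      then show False using False by simp
    qed
    then have d: "1 \<le> 32 * dist a b" by simp
    have be: "0 \<le> 1 / (2 * K)" "1 / (2 * K) \<le> 1" using K1 by auto
    \<comment> \<open>distant points: the trivial bound is absorbed since \<open>dist a b\<close> is bounded below\<close>
    have "1 \<le> (32 * dist a b) powr (1 / (2 * K))" using d be by (intro ge_one_powr_ge_zero) auto
    also have "\<dots> = 32 powr (1 / (2 * K)) * dist a b powr (1 / (2 * K))" by (intro powr_mult) 
    also have "\<dots> \<le> 32 powr 1 * dist a b powr (1 / (2 * K))"
      using be by (intro mult_right_mono powr_mono) auto
    finally have one: "1 \<le> 32 * dist a b powr (1 / (2 * K))" by simp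
    have "\<bar>f a - f b\<bar> \<le> 2 * (hessian_const K * M)" using f bd[OF a] bd[OF b] by auto
    also have "\<dots> \<le> 2 * (hessian_const K * M) * (32 * dist a b powr (1 / (2 * K)))"
      using mult_left_mono[OF one, of "2 * (hessian_const K * M)"] H0 M0 by simp
    also have "\<dots> = 64 * hessian_const K * M * dist a b powr (1 / (2 * K))" by simp
    also have "\<dots> \<le> hessian_hoelder_const K * M * dist a b powr (1 / (2 * K))"
      unfolding hessian_hoelder_const_def
      using M0 hoelder_const_nonneg[OF K1, of "1/8"] gradient_const_pos[OF K1, of "1/16"]
      by (intro mult_right_mono) auto
    finally show ?thesis .
  qed
qed


section \<open>The Euclidean plane as a type of vectors\<close>

text \<open>The isometry between the two representations of the plane.\<close>

definition vec2 :: "real \<times> real \<Rightarrow> real ^ 2"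
  where "vec2 p = (\<chi> i. if i = 1 then fst p else snd p)"

lemma vec2_nth [simp]: "vec2 p $ 1 = fst p" "vec2 p $ 2 = snd p"
  by (simp_all add: vec2_def)

lemma vec2_eq: "vec2 (x $ 1, x $ 2) = x"
  by (simp add: vec_eq_iff forall_2)

lemma norm_vec2: "norm (vec2 p) = norm p"
  by (cases p) (simp add: norm_vec_def L2_set_def sum_2 norm_Pair)

lemma vec2_diff: "vec2 p - vec2 q = vec2 (p - q)"
  by (simp add: vec_eq_iff forall_2)

lemma dist_vec2: "dist (vec2 p) (vec2 q) = dist p q"
  by (simp add: dist_norm vec2_diff norm_vec2)

lemma bounded_linear_vec2: "bounded_linear vec2"
  unfolding linear_conv_bounded_linear[symmetric] by (rule linearI) (auto simp: vec_eq_iff forall_2)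

lemma C1_fun_of_differentiable:
  fixes f :: "real ^ 2 \<Rightarrow> real"
  assumes der: "\<And>x. x \<in> ball 0 1 \<Longrightarrow> (f has_derivative f' x) (at x)"
    and cont: "continuous_on (ball 0 1) (\<lambda>x. f' x (axis 1 1))" "continuous_on (ball 0 1) (\<lambda>x. f' x (axis 2 1))"
  shows "C1_fun (ball 0 1) (\<lambda>p. f (vec2 p)) (\<lambda>p. f' (vec2 p) (axis 1 1)) (\<lambda>p. f' (vec2 p) (axis 2 1))"
  unfolding C1_fun_def
proof (intro conjI ballI)
  fix p :: "real \<times> real" assume p: "p \<in> ball 0 1"
  then have v: "vec2 p \<in> ball 0 1" by (simp add: norm_vec2)
  define g where "g = f' (vec2 p)"
  have lin: "linear g" unfolding g_def using has_derivative_linear[OF der[OF v]] .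
  have dec: "vec2 h = fst h *\<^sub>R axis 1 1 + snd h *\<^sub>R axis 2 1" for h
    by (simp add: vec_eq_iff forall_2 axis_def)
  have "g (vec2 h) = g (axis 1 1) * fst h + g (axis 2 1) * snd h" for h
    unfolding dec linear_add[OF lin] linear_scale[OF lin] by simp
  then show "((\<lambda>p. f (vec2 p)) has_derivative
      (\<lambda>h. f' (vec2 p) (axis 1 1) * fst h + f' (vec2 p) (axis 2 1) * snd h)) (at p)"
    using has_derivative_compose[OF bounded_linear_imp_has_derivative[OF bounded_linear_vec2] der[OF v]]
    by (simp add: g_def)
next
  have c: "continuous_on (ball 0 1) vec2"
    by (rule linear_continuous_on[OF bounded_linear_vec2])
  show "continuous_on (ball 0 1) (\<lambda>p. f' (vec2 p) (axis 1 1))" "continuous_on (ball 0 1) (\<lambda>p. f' (vec2 p) (axis 2 1))"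
    by (rule continuous_on_compose2[OF cont(1) c] continuous_on_compose2[OF cont(2) c]; auto simp: norm_vec2)+
qed simp

lemma C2_on_C1_fun:
  assumes "C2_on (ball 0 1) u"
  shows "C1_fun (ball 0 1) (\<lambda>p. u (vec2 p)) (\<lambda>p. gradient u (vec2 p) $ 1) (\<lambda>p. gradient u (vec2 p) $ 2)"
    and "C1_fun (ball 0 1) (\<lambda>p. gradient u (vec2 p) $ i) (\<lambda>p. hessian u (vec2 p) $ i $ 1) (\<lambda>p. hessian u (vec2 p) $ i $ 2)"
proof -
  have du: "(u has_derivative frechet_derivative u (at x)) (at x)" if "x \<in> ball 0 1" for x
    using assms that by (simp add: C2_on_def frechet_derivative_works)
  have dg: "(gradient u has_derivative (\<lambda>h. hessian u x *v h)) (at x)" if "x \<in> ball 0 1" for x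
    using assms that by (simp add: C2_on_def hessian_def jacobian_works)
  have dgi: "((\<lambda>x. gradient u x $ i) has_derivative (\<lambda>h. (hessian u x *v h) $ i)) (at x)" if "x \<in> ball 0 1" for x i
    using has_derivative_compose[OF dg[OF that] bounded_linear_imp_has_derivative[OF bounded_linear_vec_nth]] .
  have cg: "continuous_on (ball 0 1) (gradient u)"
    by (rule has_derivative_continuous_on[OF has_derivative_at_withinI[OF dg]])
  have ch: "continuous_on (ball 0 1) (hessian u)" using assms by (simp add: C2_on_def)
  have g: "frechet_derivative u (at x) (axis i 1) = gradient u x $ i" for x i by (simp add: gradient_def)
  have h: "(hessian u x *v axis j 1) $ i = hessian u x $ i $ j" for x i j
    by (simp add: matrix_vector_mult_basis column_def)
  show "C1_fun (ball 0 1) (\<lambda>p. u (vec2 p)) (\<lambda>p. gradient u (vec2 p) $ 1) (\<lambda>p. gradient u (vec2 p) $ 2)"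
    using C1_fun_of_differentiable[OF du] cg unfolding g by (auto intro!: continuous_on_component)
  show "C1_fun (ball 0 1) (\<lambda>p. gradient u (vec2 p) $ i) (\<lambda>p. hessian u (vec2 p) $ i $ 1) (\<lambda>p. hessian u (vec2 p) $ i $ 2)"
  proof -
    have "continuous_on (ball 0 1) (\<lambda>x. hessian u x $ i $ j)" for j
      by (intro continuous_on_component ch)
    then show ?thesis using C1_fun_of_differentiable[OF dgi, of i] unfolding h by blast
  qed
qed

lemma hessian_eq_symmat:
  assumes "C2_on (ball 0 1) u" "p \<in> ball 0 1"
  shows "hessian u (vec2 p) = symmat (hessian u (vec2 p) $ 1 $ 1) (hessian u (vec2 p) $ 1 $ 2) (hessian u (vec2 p) $ 2 $ 2)"
  using mixed_partials_commute[OF C2_on_C1_fun(1)[OF assms(1)] C2_on_C1_fun(2)[OF assms(1)] C2_on_C1_fun(2)[OF assms(1)] assms(2)]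
  by (simp add: matrix2_eq_iff)

text \<open>For a continuous function the essential supremum bounds all values, since nonempty open sets are
  not negligible.\<close>

lemma abs_le_Linf_norm:
  assumes c: "continuous_on (ball 0 r) u" and L: "Linf_norm (ball 0 r) u = ennreal m" and m: "0 \<le> m" and x: "x \<in> ball 0 r"
  shows "\<bar>u x\<bar> \<le> m"
proof -
  have "AE x in lebesgue_on (ball 0 r). ennreal \<bar>u x\<bar> \<le> ennreal m"
    using esssup_AE[of "\<lambda>x. ennreal \<bar>u x\<bar>" "lebesgue_on (ball 0 r)"] L by (simp add: Linf_norm_def)
  then have "AE x in lebesgue_on (ball 0 r). \<bar>u x\<bar> \<le> m" using m by simp
  then have "AE x in lebesgue. x \<in> ball 0 r \<longrightarrow> \<bar>u x\<bar> \<le> m"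
    by (subst (asm) AE_restrict_space_iff) auto
  then obtain N where N: "N \<in> null_sets lebesgue" "{x \<in> space lebesgue. \<not> (x \<in> ball 0 r \<longrightarrow> \<bar>u x\<bar> \<le> m)} \<subseteq> N"
    by (auto simp: eventually_ae_filter)
  let ?V = "{x \<in> ball 0 r. \<bar>u x\<bar> > m}"
  have "negligible ?V"
  proof (rule negligible_subset)
    show "negligible N" using N(1) by (simp add: negligible_iff_null_sets)
    show "?V \<subseteq> N" using N(2) by (auto simp: subset_iff)
  qed
  moreover have "open ?V"
  proof -
    have "open ((\<lambda>x. \<bar>u x\<bar>) -` {m<..} \<inter> ball 0 r)"
      by (rule continuous_on_open_vimage[THEN iffD1, rule_format]) (use c in \<open>auto intro!: continuous_intros\<close>)
    moreover have "(\<lambda>x. \<bar>u x\<bar>) -` {m<..} \<inter> ball 0 r = ?V" by auto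
    ultimately show ?thesis by simp
  qed
  ultimately have "?V = {}" using open_not_negligible by blast
  then show ?thesis using x by fastforce
qed

text \<open>The arctangent is at most \<open>pi / 2\<close>, and \<open>k\<^sup>3 / (1 + k) \<le> k / 2\<close> for \<open>k = lam / Lam \<le> 1\<close>.\<close>

lemma alpha_bar_le:
  assumes "0 < lam" "lam \<le> Lam"
  shows "alpha_bar lam Lam \<le> 1 / (2 * (Lam / lam))"
proof -
  define k where "k = lam / Lam"
  have k: "0 < k" "k \<le> 1" using assms by (auto simp: k_def)
  define A where "A = (if lam = Lam then pi / 2 else arctan (2 * k / (1 - k)))"
  have A: "0 \<le> A" "A \<le> pi / 2"
    using k arctan_ubound[of "2 * k / (1 - k)"] by (auto simp: A_def less_imp_le)
  have eq: "alpha_bar lam Lam = 2 / pi * (k ^ 3 / (1 + k)) * A"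
    by (simp add: alpha_bar_def k_def A_def power_divide)
  have "2 / pi * (k ^ 3 / (1 + k)) * A \<le> 2 / pi * (k ^ 3 / (1 + k)) * (pi / 2)"
    using A k by (intro mult_left_mono) auto
  also have "2 / pi * (k ^ 3 / (1 + k)) * (pi / 2) = k ^ 3 / (1 + k)"
  proof -
    have "2 / pi * X * (pi / 2) = X" for X :: real by simp
    then show ?thesis by blast
  qed
  also have "\<dots> \<le> k / 2"
  proof -
    have "k * k \<le> 1 * 1" using k by (intro mult_mono) auto
    moreover have "k * k \<le> k * 1" using k by (intro mult_left_mono) auto
    ultimately have "2 * (k * k) \<le> 1 + k" by linarith
    then have "k * (2 * (k * k)) \<le> k * (1 + k)" using k by (intro mult_left_mono) auto
    then show ?thesis using k by (simp add: field_simps power3_eq_cube)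
  qed
  also have "k / 2 = 1 / (2 * (Lam / lam))" using assms by (simp add: k_def)
  finally show "alpha_bar lam Lam \<le> 1 / (2 * (Lam / lam))" unfolding eq .
qed

section \<open>The Hoelder norm of the solution\<close>

lemma norm_matrix2_le:
  fixes A :: "real ^ 2 ^ 2"
  shows "norm A \<le> \<bar>A $ 1 $ 1\<bar> + \<bar>A $ 1 $ 2\<bar> + \<bar>A $ 2 $ 1\<bar> + \<bar>A $ 2 $ 2\<bar>"
proof -
  have "norm A \<le> norm (A $ 1) + norm (A $ 2)"
    using L2_set_le_sum[of UNIV "\<lambda>i. norm (A $ i)"] by (simp add: norm_vec_def[of A] sum_2)
  moreover have "norm (A $ i) \<le> \<bar>A $ i $ 1\<bar> + \<bar>A $ i $ 2\<bar>" for i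
    using norm_le_l1_cart[of "A $ i"] by (simp add: sum_2)
  ultimately show ?thesis using add_mono[of "norm (A $ 1)" _ "norm (A $ 2)"] by (smt (verit))
qed

text \<open>The sum of the constants for the four parts of the \<open>C\<^sup>2\<close> Hoelder norm.\<close>

definition final_const :: "real \<Rightarrow> real"
  where "final_const K = 1 + 2 * (5 * gradient_const K (1/8) + 8) + 4 * hessian_const K + 4 * hessian_hoelder_const K"

lemma consts_nonneg:
  assumes "1 \<le> K"
  shows "0 \<le> 5 * gradient_const K (1/8) + 8" "0 \<le> hessian_const K" "0 \<le> hessian_hoelder_const K" "0 < final_const K"
proof -
  note c = gradient_const_pos[OF assms, of "1/8"] gradient_const_pos[OF assms, of "1/16"] hoelder_const_nonneg[OF assms, of "1/8"]
  show 1: "0 \<le> 5 * gradient_const K (1/8) + 8" "0 \<le> hessian_const K" using c by (auto simp: hessian_const_def)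
  show "0 \<le> hessian_hoelder_const K" unfolding hessian_hoelder_const_def using c 1(2) by simp
  then show "0 < final_const K" unfolding final_const_def using 1 by simp
qed

theorem C2_hoelder_norm_le:
  assumes F: "uniformly_elliptic lam Lam F" and cF: "continuous_on Sym2 F"
    and u: "C2_on (ball 0 1) u" and sol: "\<forall>x\<in>ball 0 1. F (hessian u x) = 0"
    and M: "\<And>x. x \<in> ball 0 1 \<Longrightarrow> \<bar>u x\<bar> \<le> M" and M0: "0 < M"
  shows "C2_hoelder_norm (alpha_bar lam Lam) (ball 0 (1/2)) u \<le> ennreal (final_const (Lam / lam) * M)"
proof -
  have ll: "0 < lam" "lam \<le> Lam" using F by (auto simp: uniformly_elliptic_def)
  define K where "K = Lam / lam"
  have K1: "1 \<le> K" using ll by (simp add: K_def)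
  define U where "U = (\<lambda>p. u (vec2 p))"
  define H where "H = (\<lambda>i j p. hessian u (vec2 p) $ i $ j)"
  define D where "D = (\<lambda>i p. gradient u (vec2 p) $ i)"
  have hs: "hessian u (vec2 p) = symmat (H 1 1 p) (H 1 2 p) (H 2 2 p)" if "p \<in> ball 0 1" for p
    unfolding H_def by (rule hessian_eq_symmat[OF u that])
  have h21: "H 2 1 p = H 1 2 p" if "p \<in> ball 0 1" for p
    using hs[OF that] by (simp add: H_def matrix2_eq_iff)
  have C0: "C1_fun (ball 0 1) U (D 1) (D 2)" "C1_fun (ball 0 1) (D 1) (H 1 1) (H 1 2)" "C1_fun (ball 0 1) (D 2) (H 2 1) (H 2 2)"
    unfolding U_def D_def H_def using C2_on_C1_fun[OF u] by auto
  have C3: "C1_fun (ball 0 1) (D 2) (H 1 2) (H 2 2)"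
    using C0(3) C1_funD(4)[OF C0(2)] h21 unfolding C1_fun_def by auto
  have MU: "\<bar>U p\<bar> \<le> M" if "p \<in> ball 0 1" for p
    using M[of "vec2 p"] that by (simp add: U_def norm_vec2)
  have solU: "F (symmat (H 1 1 p) (H 1 2 p) (H 2 2 p)) = 0" if "p \<in> ball 0 1" for p
    using sol[rule_format, of "vec2 p"] hs[OF that] that by (simp add: norm_vec2)
  note est = interior_estimates[OF C0(1,2) C3 refl MU M0 F cF solU K_def]
  have est1: "\<bar>D 1 a\<bar> \<le> (5 * gradient_const K (1/8) + 8) * M \<and> \<bar>D 2 a\<bar> \<le> (5 * gradient_const K (1/8) + 8) * M"
    if "a \<in> ball 0 (1/2)" for a
    by (rule est(1)) (use that in auto)
  have est2: "\<bar>H 1 1 a\<bar> \<le> hessian_const K * M \<and> \<bar>H 1 2 a\<bar> \<le> hessian_const K * M \<and> \<bar>H 2 2 a\<bar> \<le> hessian_const K * M"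
    if "a \<in> ball 0 (1/2)" for a
    by (rule est(2)) (use that in auto)
  have est3: "\<bar>f a - f b\<bar> \<le> hessian_hoelder_const K * M * dist a b powr (1 / (2 * K))"
    if "a \<in> ball 0 (1/2)" "b \<in> ball 0 (1/2)" "f \<in> {H 1 1, H 1 2, H 2 2}" for a b f
    by (rule est(3)) (use that in auto)
  note cn = consts_nonneg[OF K1]
  define pt where "pt = (\<lambda>x :: real ^ 2. (x $ 1, x $ 2))"
  have pt: "vec2 (pt x) = x" for x by (simp add: pt_def vec2_eq)
  have ptb: "pt x \<in> ball 0 r" if "x \<in> ball 0 r" for x r
    using that norm_vec2[of "pt x"] by (simp add: pt)
  have ptd: "dist (pt x) (pt y) = dist x y" for x y using dist_vec2[of "pt x" "pt y"] by (simp add: pt)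
  have half: "ball 0 (1/2) \<subseteq> (ball 0 1 :: (real \<times> real) set)" by (intro subset_ball) simp
  let ?B = "ball 0 (1/2) :: (real ^ 2) set"
  have n0: "sup_norm ?B u \<le> ennreal M"
    unfolding sup_norm_def
  proof (intro SUP_least ennreal_leI)
    fix x assume "x \<in> ?B"
    then show "norm (u x) \<le> M" using M[of x] by simp
  qed
  have n1: "sup_norm ?B (gradient u) \<le> ennreal (2 * (5 * gradient_const K (1/8) + 8) * M)"
    unfolding sup_norm_def
  proof (intro SUP_least ennreal_leI)
    fix x assume x: "x \<in> ?B"
    have "norm (gradient u x) \<le> \<bar>D 1 (pt x)\<bar> + \<bar>D 2 (pt x)\<bar>"
      using norm_le_l1_cart[of "gradient u x"] by (simp add: sum_2 D_def pt)
    then show "norm (gradient u x) \<le> 2 * (5 * gradient_const K (1/8) + 8) * M"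
      using est1[OF ptb[OF x]] by linarith
  qed
  have n2: "sup_norm ?B (hessian u) \<le> ennreal (4 * hessian_const K * M)"
    unfolding sup_norm_def
  proof (intro SUP_least ennreal_leI)
    fix x assume x: "x \<in> ?B"
    have p1: "pt x \<in> ball 0 1" using ptb[OF x] half by blast
    have "norm (hessian u x) \<le> \<bar>H 1 1 (pt x)\<bar> + \<bar>H 1 2 (pt x)\<bar> + \<bar>H 2 1 (pt x)\<bar> + \<bar>H 2 2 (pt x)\<bar>"
      using norm_matrix2_le[of "hessian u x"] by (simp add: H_def pt)
    then show "norm (hessian u x) \<le> 4 * hessian_const K * M"
      using est2[OF ptb[OF x]] h21[OF p1] by linarith
  qed
  have n3: "hoelder_seminorm (alpha_bar lam Lam) ?B (hessian u) \<le> ennreal (4 * hessian_hoelder_const K * M)"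
    unfolding hoelder_seminorm_def
  proof (intro SUP_least, clarify, intro ennreal_leI)
    fix x y :: "real ^ 2" assume x: "x \<in> ?B" and y: "y \<in> ?B" and xy: "x \<noteq> y"
    let ?a = "alpha_bar lam Lam" and ?b = "1 / (2 * K)"
    have p1: "pt x \<in> ball 0 1" "pt y \<in> ball 0 1" using ptb[OF x] ptb[OF y] half by blast+
    have d0: "0 < dist x y" using xy by simp
    have d1: "dist x y \<le> 1" using dist_triangle2[of x y 0] x y by (simp add: dist_commute)
    let ?h = "hessian_hoelder_const K * M * dist x y powr ?b"
    have "norm (hessian u x - hessian u y) \<le> \<bar>H 1 1 (pt x) - H 1 1 (pt y)\<bar> + \<bar>H 1 2 (pt x) - H 1 2 (pt y)\<bar>
       + \<bar>H 2 1 (pt x) - H 2 1 (pt y)\<bar> + \<bar>H 2 2 (pt x) - H 2 2 (pt y)\<bar>"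
      using norm_matrix2_le[of "hessian u x - hessian u y"] by (simp add: H_def pt)
    also have "\<dots> \<le> ?h + ?h + ?h + ?h"
      using est3[OF ptb[OF x] ptb[OF y]] h21[OF p1(1)] h21[OF p1(2)] unfolding ptd
      by (intro add_mono) auto
    also have "\<dots> = 4 * hessian_hoelder_const K * M * dist x y powr ?b" by simp
    also have "\<dots> \<le> 4 * hessian_hoelder_const K * M * dist x y powr ?a"
      using alpha_bar_le[OF ll] d0 d1 cn M0
      by (intro mult_left_mono powr_mono') (auto simp: K_def)
    finally show "norm (hessian u x - hessian u y) / dist x y powr ?a \<le> 4 * hessian_hoelder_const K * M"
      using d0 by (simp add: field_simps)
  qed
  have "C2_hoelder_norm (alpha_bar lam Lam) ?B u \<le> ennreal M + ennreal (2 * (5 * gradient_const K (1/8) + 8) * M)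
     + ennreal (4 * hessian_const K * M) + ennreal (4 * hessian_hoelder_const K * M)"
    unfolding C2_hoelder_norm_def by (intro add_mono n0 n1 n2 n3)
  also have "\<dots> = ennreal (M + 2 * (5 * gradient_const K (1/8) + 8) * M + 4 * hessian_const K * M + 4 * hessian_hoelder_const K * M)"
    using cn M0 by (simp add: ennreal_plus del: distrib_right_numeral)
  also have "M + 2 * (5 * gradient_const K (1/8) + 8) * M + 4 * hessian_const K * M + 4 * hessian_hoelder_const K * M
      = final_const K * M"
    by (simp add: final_const_def algebra_simps)
  finally show ?thesis by (simp add: K_def)
qed

theorem theorem4p1:
  fixes lam Lam :: real
  assumes "0 < lam" and "lam \<le> Lam"
  shows "\<exists>C::real. 0 < C \<and>
    (\<forall>(F :: real ^ 2 ^ 2 \<Rightarrow> real) (u :: real ^ 2 \<Rightarrow> real).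
       continuous_on Sym2 F \<longrightarrow>
       uniformly_elliptic lam Lam F \<longrightarrow>
       C2_on (ball 0 1) u \<longrightarrow>
       (\<forall>x\<in>ball 0 1. F (hessian u x) = 0) \<longrightarrow>
       C2_hoelder_norm (alpha_bar lam Lam) (ball 0 (1/2)) u
         \<le> ennreal C * Linf_norm (ball 0 1) u)"
proof (intro exI[of _ "final_const (Lam / lam)"] conjI allI impI)
  let ?C = "final_const (Lam / lam)"
  show C0: "0 < ?C" using assms by (intro consts_nonneg) simp
  fix F :: "real ^ 2 ^ 2 \<Rightarrow> real" and u :: "real ^ 2 \<Rightarrow> real"
  assume cF: "continuous_on Sym2 F" and F: "uniformly_elliptic lam Lam F"
    and u: "C2_on (ball 0 1) u" and sol: "\<forall>x\<in>ball 0 1. F (hessian u x) = 0"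
  let ?L = "Linf_norm (ball 0 1) u"
  show "C2_hoelder_norm (alpha_bar lam Lam) (ball 0 (1/2)) u \<le> ennreal ?C * ?L"
  proof (cases ?L rule: ennreal_cases)
    case top
    then show ?thesis using C0 by (simp add: ennreal_mult_top)
  next
    case (real m)
    have "continuous_on (ball 0 1) u"
      using u by (auto simp: C2_on_def intro!: continuous_at_imp_continuous_on differentiable_imp_continuous_within)
    note bd = abs_le_Linf_norm[OF this real(2,1)]
    show ?thesis
    proof (rule ennreal_le_epsilon)
      \<comment> \<open>\<open>C2_hoelder_norm_le\<close> needs a positive bound, but the supremum of \<open>u\<close> may be zero\<close>
      fix e :: real assume e: "0 < e"
      have M0: "0 < m + e / ?C" using real(1) e C0 by (simp add: add_nonneg_pos)
      have "C2_hoelder_norm (alpha_bar lam Lam) (ball 0 (1/2)) u \<le> ennreal (?C * (m + e / ?C))"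
      proof (rule C2_hoelder_norm_le[OF F cF u sol _ M0])
        fix x :: "real ^ 2" assume "x \<in> ball 0 1"
        from bd[OF this] show "\<bar>u x\<bar> \<le> m + e / ?C" using e C0 by (simp add: add_increasing2)
      qed
      also have "?C * (m + e / ?C) = ?C * m + e" using C0 by (simp add: distrib_left)
      also have "ennreal (?C * m + e) = ennreal ?C * ?L + ennreal e"
        using C0 e real by (simp add: ennreal_mult')
      finally show "C2_hoelder_norm (alpha_bar lam Lam) (ball 0 (1/2)) u \<le> ennreal ?C * ?L + ennreal e" .
    qed
  qed
qed

end
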